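(* For every $k\ge 1$ there is a unary $\mathsf{PV}$ function symbol $h$ such that for every constant $c\ge 1$, \[\mathsf{PV}_1+\mathsf{BB}(\Sigma^b_1)\nvdash \mathsf{UP}_{k,c}(h).\]
   Context: $\mathsf{PV}_1$ is Cook's universal theory with function symbols for all polynomial-time functions. $\Sigma^b_1$ formulas are bounded formulas in the $\mathsf{PV}$ language built from sharply bounded formulas (quantifiers bounded by $|t|$, the binary length of a term) by bounded existential quantification, sharply bounded quantification, conjunction and disjunction. For a formula $\varphi$, $\mathsf{BB}(\varphi):=\forall x,t[(\forall j\le|x|\,\exists y\le t\,\varphi(j,y))\to(\exists w\,\forall j\le|x|\,\varphi(j,w_j))]$ ($w$ codes a sequence with $j$-th element $w_j$), and $\mathsf{BB}(\Sigma^b_1)$ is the scheme of these for all $\varphi\in\Sigma^b_1$ (with parameters). For a unary $\mathsf{PV}$ symbol $f$ and constants $k,c\ge1$, $\mathsf{UP}_{k,c}(f)$ is the sentence \[\forall 1^{(n)}\ \exists C_n\ \big(C_n\text{ codes a circuit of size}\le c\cdot n^k\big)\ \forall x\,(|x|=n\to(f(x)=1\leftrightarrow \mathrm{CircuitVal}(C_n,x)=1)),\] where $1^{(n)}$ ranges over strings of $n$ ones and $\mathrm{CircuitVal}$ is the $\mathsf{PV}$ symbol evaluating a coded circuit on an input. *)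

theory Defs
  imports Main
begin

section \<open>Function symbols and terms of PV\<close>

text \<open>
  Cook's theory PV, over dyadic notation: objects are strings over the digits 1 and 2, the string
  \<open>x\<close> followed by the digit \<open>d\<close> having the value \<open>2 * x + d\<close>, so that strings and natural
  numbers are in bijection.
  \<open>Zero\<close> is the empty string, \<open>S1\<close> and \<open>S2\<close> append a digit, \<open>Tr\<close> deletes the last digit,
  \<open>Cat\<close> is concatenation, \<open>Smash x y\<close> is the concatenation of \<open>|y|\<close> copies of \<open>x\<close>, and
  \<open>Less x y\<close> deletes the last \<open>|y|\<close> digits of \<open>x\<close> (so it is empty iff \<open>|x| \<le> |y|\<close>).

  \<open>Lam n t\<close> is the symbol introduced by the explicit definition
  \<open>f(x\<^sub>0,\<dots>,x\<^sub>n\<^sub>-\<^sub>1) = t\<close>; \<open>Rec g h1 h2 l1 l2\<close> is the symbol introduced by limited recursion on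
  notation on the last argument.  Which of these raw symbols belong to PV is decided by the
  predicate \<open>is_pv_fun\<close> below.
\<close>

datatype pv_fun = Zero | S1 | S2 | Tr | Cat | Smash | Less
  | Lam nat pv_term
  | Rec pv_fun pv_fun pv_fun pv_fun pv_fun
and pv_term = Var nat | App pv_fun "pv_term list"

primrec arity :: "pv_fun \<Rightarrow> nat" where
  "arity Zero = 0"
| "arity S1 = 1"
| "arity S2 = 1"
| "arity Tr = 1"
| "arity Cat = 2"
| "arity Smash = 2"
| "arity Less = 2"
| "arity (Lam n t) = n"
| "arity (Rec g h1 h2 l1 l2) = Suc (arity g)"

fun tm_subst :: "(nat \<Rightarrow> pv_term) \<Rightarrow> pv_term \<Rightarrow> pv_term" where
  "tm_subst \<sigma> (Var i) = \<sigma> i"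
| "tm_subst \<sigma> (App f ts) = App f (map (tm_subst \<sigma>) ts)"

text \<open>All variables of the term have an index less than \<open>n\<close>.\<close>

fun tm_below :: "nat \<Rightarrow> pv_term \<Rightarrow> bool" where
  "tm_below n (Var i) \<longleftrightarrow> i < n"
| "tm_below n (App f ts) \<longleftrightarrow> (\<forall>t\<in>set ts. tm_below n t)"

definition vars :: "nat \<Rightarrow> pv_term list" where
  "vars n = map Var [0..<n]"

abbreviation zero :: pv_term where "zero \<equiv> App Zero []"
abbreviation s1 :: "pv_term \<Rightarrow> pv_term" where "s1 t \<equiv> App S1 [t]"
abbreviation s2 :: "pv_term \<Rightarrow> pv_term" where "s2 t \<equiv> App S2 [t]"
abbreviation one :: pv_term where "one \<equiv> s1 zero"
abbreviation two :: pv_term where "two \<equiv> s2 zero"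
abbreviation tr :: "pv_term \<Rightarrow> pv_term" where "tr t \<equiv> App Tr [t]"
abbreviation cat :: "pv_term \<Rightarrow> pv_term \<Rightarrow> pv_term" where "cat s t \<equiv> App Cat [s, t]"
abbreviation smash :: "pv_term \<Rightarrow> pv_term \<Rightarrow> pv_term" where "smash s t \<equiv> App Smash [s, t]"
abbreviation less :: "pv_term \<Rightarrow> pv_term \<Rightarrow> pv_term" where "less s t \<equiv> App Less [s, t]"


section \<open>The equational theory PV\<close>

text \<open>
  The symbols of PV and the equations derivable in PV are defined simultaneously, because limited
  recursion on notation introduces a symbol only when PV derives the bounds
  \<open>|h\<^sub>i(x,y,z)| \<le> |z * l\<^sub>i(x,y)|\<close>.  The usual stratification into ranks and the recording of the
  derivations inside the symbols are replaced by the joint least fixed point.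
  The rule \<open>pv_unique\<close> (induction on notation) says that two terms \<open>u\<close>, \<open>v\<close> satisfying the same
  recursion on notation in the variable \<open>y\<close> are equal; \<open>z\<close> is the place of the recursive value
  in the step terms \<open>h1\<close>, \<open>h2\<close>.
\<close>

inductive is_pv_fun :: "pv_fun \<Rightarrow> bool"
  and is_pv_term :: "pv_term \<Rightarrow> bool"
  and pv_eq :: "pv_term \<Rightarrow> pv_term \<Rightarrow> bool"
where
  fun_Zero: "is_pv_fun Zero"
| fun_S1: "is_pv_fun S1"
| fun_S2: "is_pv_fun S2"
| fun_Tr: "is_pv_fun Tr"
| fun_Cat: "is_pv_fun Cat"
| fun_Smash: "is_pv_fun Smash"
| fun_Less: "is_pv_fun Less"
| fun_Lam: "\<lbrakk>is_pv_term t; tm_below n t\<rbrakk> \<Longrightarrow> is_pv_fun (Lam n t)"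
| fun_Rec: "\<lbrakk>is_pv_fun g; is_pv_fun h1; is_pv_fun h2; is_pv_fun l1; is_pv_fun l2;
    arity g = n; arity h1 = n + 2; arity h2 = n + 2; arity l1 = n + 1; arity l2 = n + 1;
    pv_eq (less (App h1 (vars (n + 2))) (cat (Var (n + 1)) (App l1 (vars (n + 1))))) zero;
    pv_eq (less (App h2 (vars (n + 2))) (cat (Var (n + 1)) (App l2 (vars (n + 1))))) zero\<rbrakk>
    \<Longrightarrow> is_pv_fun (Rec g h1 h2 l1 l2)"

| term_Var: "is_pv_term (Var i)"
| term_App: "\<lbrakk>is_pv_fun f; length ts = arity f; \<forall>t\<in>set ts. is_pv_term t\<rbrakk>
    \<Longrightarrow> is_pv_term (App f ts)"

| Tr_zero: "pv_eq (tr zero) zero"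
| Tr_s1: "pv_eq (tr (s1 (Var 0))) (Var 0)"
| Tr_s2: "pv_eq (tr (s2 (Var 0))) (Var 0)"
| Cat_zero: "pv_eq (cat (Var 0) zero) (Var 0)"
| Cat_s1: "pv_eq (cat (Var 0) (s1 (Var 1))) (s1 (cat (Var 0) (Var 1)))"
| Cat_s2: "pv_eq (cat (Var 0) (s2 (Var 1))) (s2 (cat (Var 0) (Var 1)))"
| Smash_zero: "pv_eq (smash (Var 0) zero) zero"
| Smash_s1: "pv_eq (smash (Var 0) (s1 (Var 1))) (cat (Var 0) (smash (Var 0) (Var 1)))"
| Smash_s2: "pv_eq (smash (Var 0) (s2 (Var 1))) (cat (Var 0) (smash (Var 0) (Var 1)))"
| Less_zero: "pv_eq (less (Var 0) zero) (Var 0)"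
| Less_s1: "pv_eq (less (Var 0) (s1 (Var 1))) (tr (less (Var 0) (Var 1)))"
| Less_s2: "pv_eq (less (Var 0) (s2 (Var 1))) (tr (less (Var 0) (Var 1)))"
| Lam_eq: "is_pv_fun (Lam n t) \<Longrightarrow> pv_eq (App (Lam n t) (vars n)) t"
| Rec_zero: "\<lbrakk>is_pv_fun (Rec g h1 h2 l1 l2); n = arity g\<rbrakk>
    \<Longrightarrow> pv_eq (App (Rec g h1 h2 l1 l2) (vars n @ [zero])) (App g (vars n))"
| Rec_s1: "\<lbrakk>is_pv_fun (Rec g h1 h2 l1 l2); n = arity g\<rbrakk>
    \<Longrightarrow> pv_eq (App (Rec g h1 h2 l1 l2) (vars n @ [s1 (Var n)]))
          (App h1 (vars n @ [Var n, App (Rec g h1 h2 l1 l2) (vars (n + 1))]))"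
| Rec_s2: "\<lbrakk>is_pv_fun (Rec g h1 h2 l1 l2); n = arity g\<rbrakk>
    \<Longrightarrow> pv_eq (App (Rec g h1 h2 l1 l2) (vars n @ [s2 (Var n)]))
          (App h2 (vars n @ [Var n, App (Rec g h1 h2 l1 l2) (vars (n + 1))]))"

| pv_refl: "is_pv_term t \<Longrightarrow> pv_eq t t"
| pv_sym: "pv_eq t u \<Longrightarrow> pv_eq u t"
| pv_trans: "\<lbrakk>pv_eq t u; pv_eq u v\<rbrakk> \<Longrightarrow> pv_eq t v"
| pv_cong: "\<lbrakk>is_pv_fun f; length ts = arity f; list_all2 pv_eq ts us\<rbrakk>
    \<Longrightarrow> pv_eq (App f ts) (App f us)"
| pv_subst: "\<lbrakk>pv_eq t u; \<forall>i. is_pv_term (\<sigma> i)\<rbrakk> \<Longrightarrow> pv_eq (tm_subst \<sigma> t) (tm_subst \<sigma> u)"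
| pv_unique: "\<lbrakk>pv_eq (tm_subst (Var(y := zero)) u) g;
    pv_eq (tm_subst (Var(y := s1 (Var y))) u) (tm_subst (Var(z := u)) h1);
    pv_eq (tm_subst (Var(y := s2 (Var y))) u) (tm_subst (Var(z := u)) h2);
    pv_eq (tm_subst (Var(y := zero)) v) g;
    pv_eq (tm_subst (Var(y := s1 (Var y))) v) (tm_subst (Var(z := v)) h1);
    pv_eq (tm_subst (Var(y := s2 (Var y))) v) (tm_subst (Var(z := v)) h2)\<rbrakk>
    \<Longrightarrow> pv_eq u v"

declare pv_trans [trans]

lemma is_pv_term_simps [simp]:
  "is_pv_term (Var i)"
  "is_pv_term (App f ts) \<longleftrightarrow> is_pv_fun f \<and> length ts = arity f \<and> (\<forall>t\<in>set ts. is_pv_term t)"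
  by (auto intro: term_Var term_App elim: is_pv_term.cases)

lemmas [simp] = fun_Zero fun_S1 fun_S2 fun_Tr fun_Cat fun_Smash fun_Less

lemma is_pv_fun_Lam [simp]: "is_pv_fun (Lam n t) \<longleftrightarrow> is_pv_term t \<and> tm_below n t"
  by (auto intro: fun_Lam elim: is_pv_fun.cases)


section \<open>First-order logic over the language of PV\<close>

text \<open>De Bruijn indices: the variable bound by the innermost quantifier is \<open>Var 0\<close>.\<close>

datatype fm = Fls | Eq pv_term pv_term | Imp fm fm | And fm fm | Or fm fm | All fm | Ex fm

abbreviation Neg :: "fm \<Rightarrow> fm" where "Neg \<phi> \<equiv> Imp \<phi> Fls"
abbreviation Iff :: "fm \<Rightarrow> fm \<Rightarrow> fm" where "Iff \<phi> \<psi> \<equiv> And (Imp \<phi> \<psi>) (Imp \<psi> \<phi>)"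

primrec is_pv_fm :: "fm \<Rightarrow> bool" where
  "is_pv_fm Fls \<longleftrightarrow> True"
| "is_pv_fm (Eq s t) \<longleftrightarrow> is_pv_term s \<and> is_pv_term t"
| "is_pv_fm (Imp \<phi> \<psi>) \<longleftrightarrow> is_pv_fm \<phi> \<and> is_pv_fm \<psi>"
| "is_pv_fm (And \<phi> \<psi>) \<longleftrightarrow> is_pv_fm \<phi> \<and> is_pv_fm \<psi>"
| "is_pv_fm (Or \<phi> \<psi>) \<longleftrightarrow> is_pv_fm \<phi> \<and> is_pv_fm \<psi>"
| "is_pv_fm (All \<phi>) \<longleftrightarrow> is_pv_fm \<phi>"
| "is_pv_fm (Ex \<phi>) \<longleftrightarrow> is_pv_fm \<phi>"

primrec fm_below :: "nat \<Rightarrow> fm \<Rightarrow> bool" where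
  "fm_below n Fls \<longleftrightarrow> True"
| "fm_below n (Eq s t) \<longleftrightarrow> tm_below n s \<and> tm_below n t"
| "fm_below n (Imp \<phi> \<psi>) \<longleftrightarrow> fm_below n \<phi> \<and> fm_below n \<psi>"
| "fm_below n (And \<phi> \<psi>) \<longleftrightarrow> fm_below n \<phi> \<and> fm_below n \<psi>"
| "fm_below n (Or \<phi> \<psi>) \<longleftrightarrow> fm_below n \<phi> \<and> fm_below n \<psi>"
| "fm_below n (All \<phi>) \<longleftrightarrow> fm_below (Suc n) \<phi>"
| "fm_below n (Ex \<phi>) \<longleftrightarrow> fm_below (Suc n) \<phi>"

abbreviation lift_tm :: "pv_term \<Rightarrow> pv_term" where
  "lift_tm \<equiv> tm_subst (\<lambda>i. Var (Suc i))"

definition up :: "(nat \<Rightarrow> pv_term) \<Rightarrow> nat \<Rightarrow> pv_term" where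
  "up \<sigma> = case_nat (Var 0) (\<lambda>i. lift_tm (\<sigma> i))"

primrec fm_subst :: "(nat \<Rightarrow> pv_term) \<Rightarrow> fm \<Rightarrow> fm" where
  "fm_subst \<sigma> Fls = Fls"
| "fm_subst \<sigma> (Eq s t) = Eq (tm_subst \<sigma> s) (tm_subst \<sigma> t)"
| "fm_subst \<sigma> (Imp \<phi> \<psi>) = Imp (fm_subst \<sigma> \<phi>) (fm_subst \<sigma> \<psi>)"
| "fm_subst \<sigma> (And \<phi> \<psi>) = And (fm_subst \<sigma> \<phi>) (fm_subst \<sigma> \<psi>)"
| "fm_subst \<sigma> (Or \<phi> \<psi>) = Or (fm_subst \<sigma> \<phi>) (fm_subst \<sigma> \<psi>)"
| "fm_subst \<sigma> (All \<phi>) = All (fm_subst (up \<sigma>) \<phi>)"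
| "fm_subst \<sigma> (Ex \<phi>) = Ex (fm_subst (up \<sigma>) \<phi>)"

abbreviation lift_fm :: "fm \<Rightarrow> fm" where
  "lift_fm \<equiv> fm_subst (\<lambda>i. Var (Suc i))"

text \<open>Instantiation of the variable of the outermost quantifier, which has been stripped.\<close>

definition inst :: "fm \<Rightarrow> pv_term \<Rightarrow> fm" where
  "inst \<phi> t = fm_subst (case_nat t Var) \<phi>"

text \<open>Classical natural deduction with equality, all formulas being in the language of PV.\<close>

inductive provable :: "fm set \<Rightarrow> fm \<Rightarrow> bool" (infix "\<turnstile>" 40) where
  Assm: "\<lbrakk>\<phi> \<in> \<Gamma>; is_pv_fm \<phi>\<rbrakk> \<Longrightarrow> \<Gamma> \<turnstile> \<phi>"
| Contr: "\<lbrakk>insert (Neg \<phi>) \<Gamma> \<turnstile> Fls; is_pv_fm \<phi>\<rbrakk> \<Longrightarrow> \<Gamma> \<turnstile> \<phi>"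
| ImpI: "\<lbrakk>insert \<phi> \<Gamma> \<turnstile> \<psi>; is_pv_fm \<phi>\<rbrakk> \<Longrightarrow> \<Gamma> \<turnstile> Imp \<phi> \<psi>"
| ImpE: "\<lbrakk>\<Gamma> \<turnstile> Imp \<phi> \<psi>; \<Gamma> \<turnstile> \<phi>\<rbrakk> \<Longrightarrow> \<Gamma> \<turnstile> \<psi>"
| AndI: "\<lbrakk>\<Gamma> \<turnstile> \<phi>; \<Gamma> \<turnstile> \<psi>\<rbrakk> \<Longrightarrow> \<Gamma> \<turnstile> And \<phi> \<psi>"
| AndE1: "\<Gamma> \<turnstile> And \<phi> \<psi> \<Longrightarrow> \<Gamma> \<turnstile> \<phi>"
| AndE2: "\<Gamma> \<turnstile> And \<phi> \<psi> \<Longrightarrow> \<Gamma> \<turnstile> \<psi>"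
| OrI1: "\<lbrakk>\<Gamma> \<turnstile> \<phi>; is_pv_fm \<psi>\<rbrakk> \<Longrightarrow> \<Gamma> \<turnstile> Or \<phi> \<psi>"
| OrI2: "\<lbrakk>\<Gamma> \<turnstile> \<psi>; is_pv_fm \<phi>\<rbrakk> \<Longrightarrow> \<Gamma> \<turnstile> Or \<phi> \<psi>"
| OrE: "\<lbrakk>\<Gamma> \<turnstile> Or \<phi> \<psi>; insert \<phi> \<Gamma> \<turnstile> \<chi>; insert \<psi> \<Gamma> \<turnstile> \<chi>\<rbrakk> \<Longrightarrow> \<Gamma> \<turnstile> \<chi>"
| AllI: "lift_fm ` \<Gamma> \<turnstile> \<phi> \<Longrightarrow> \<Gamma> \<turnstile> All \<phi>"
| AllE: "\<lbrakk>\<Gamma> \<turnstile> All \<phi>; is_pv_term t\<rbrakk> \<Longrightarrow> \<Gamma> \<turnstile> inst \<phi> t"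
| ExI: "\<lbrakk>\<Gamma> \<turnstile> inst \<phi> t; is_pv_fm \<phi>; is_pv_term t\<rbrakk> \<Longrightarrow> \<Gamma> \<turnstile> Ex \<phi>"
| ExE: "\<lbrakk>\<Gamma> \<turnstile> Ex \<phi>; insert \<phi> (lift_fm ` \<Gamma>) \<turnstile> lift_fm \<psi>\<rbrakk> \<Longrightarrow> \<Gamma> \<turnstile> \<psi>"
| EqRefl: "is_pv_term t \<Longrightarrow> \<Gamma> \<turnstile> Eq t t"
| EqSubst: "\<lbrakk>\<Gamma> \<turnstile> Eq s t; \<Gamma> \<turnstile> inst \<phi> s; is_pv_fm \<phi>\<rbrakk> \<Longrightarrow> \<Gamma> \<turnstile> inst \<phi> t"

text \<open>The universal closures of a formula (one for each sufficiently long quantifier prefix).\<close>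

definition closures :: "fm \<Rightarrow> fm set" where
  "closures \<phi> = {(All ^^ n) \<phi> | n. fm_below n \<phi>}"


section \<open>Some PV functions\<close>

text \<open>
  Limited recursion on notation with \<open>n\<close> parameters, given by terms; in \<open>h1\<close>, \<open>h2\<close> the variables
  \<open>Var n\<close> and \<open>Var (n + 1)\<close> are the recursion variable and the recursive value.  The step values
  are cut down to the length of \<open>l\<close>, which makes the required bound derivable in PV.
\<close>

definition cut :: "pv_term \<Rightarrow> pv_term \<Rightarrow> pv_term" where
  "cut s t = less s (less s t)"

definition lrec :: "nat \<Rightarrow> pv_term \<Rightarrow> pv_term \<Rightarrow> pv_term \<Rightarrow> pv_term \<Rightarrow> pv_fun" where
  "lrec n g h1 h2 l =
     Rec (Lam n g) (Lam (n + 2) (cut h1 l)) (Lam (n + 2) (cut h2 l)) (Lam (n + 1) l) (Lam (n + 1) l)"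

lemma arity_lrec [simp]: "arity (lrec n g h1 h2 l) = n + 1"
  by (simp add: lrec_def)

lemma cut_simps [simp]:
  "tm_below n (cut s t) \<longleftrightarrow> tm_below n s \<and> tm_below n t"
  "is_pv_term (cut s t) \<longleftrightarrow> is_pv_term s \<and> is_pv_term t"
  by (auto simp: cut_def)


lemma pv_cong_unary: "\<lbrakk>pv_eq s s'; is_pv_fun f; arity f = 1\<rbrakk> \<Longrightarrow> pv_eq (App f [s]) (App f [s'])"
  by (rule pv_cong) auto

lemma pv_cong_binary:
  "\<lbrakk>pv_eq s s'; pv_eq t t'; is_pv_fun f; arity f = 2\<rbrakk> \<Longrightarrow> pv_eq (App f [s, t]) (App f [s', t'])"
  by (rule pv_cong) auto

lemma pv_inst:
  assumes "pv_eq t u" "is_pv_term a" "is_pv_term b" "is_pv_term c"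
  shows "pv_eq (tm_subst (\<lambda>i. if i = 0 then a else if i = 1 then b else c) t)
    (tm_subst (\<lambda>i. if i = 0 then a else if i = 1 then b else c) u)"
  using assms by (intro pv_subst) auto

lemma pv_base1:
  assumes "is_pv_term s"
  shows "pv_eq (tr (s1 s)) s" "pv_eq (tr (s2 s)) s" "pv_eq (cat s zero) s" "pv_eq (less s zero) s"
  using pv_inst[OF Tr_s1 assms assms assms] pv_inst[OF Tr_s2 assms assms assms]
    pv_inst[OF Cat_zero assms assms assms] pv_inst[OF Less_zero assms assms assms]
  by simp_all

lemma pv_base2:
  assumes "is_pv_term s" "is_pv_term t"
  shows "pv_eq (cat s (s1 t)) (s1 (cat s t))" "pv_eq (cat s (s2 t)) (s2 (cat s t))"
    "pv_eq (less s (s1 t)) (tr (less s t))" "pv_eq (less s (s2 t)) (tr (less s t))"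
  using pv_inst[OF Cat_s1 assms(1,2,2)] pv_inst[OF Cat_s2 assms(1,2,2)]
    pv_inst[OF Less_s1 assms(1,2,2)] pv_inst[OF Less_s2 assms(1,2,2)]
  by simp_all

lemmas pv_base = pv_base1 pv_base2

lemma less_tr:
  assumes "is_pv_term s" "is_pv_term t"
  shows "pv_eq (less (tr s) t) (tr (less s t))"
proof -
  have "pv_eq (less (tr (Var 0)) (Var 1)) (tr (less (Var 0) (Var 1)))"
    by (rule pv_unique[where y = 1 and z = 2 and g = "tr (Var 0)"
          and ?h1.0 = "tr (Var 2)" and ?h2.0 = "tr (Var 2)"])
       (simp_all add: pv_base pv_cong_unary)
  from pv_inst[OF this assms(1,2,2)] show ?thesis by simp
qed

lemma less_zero_left:
  assumes "is_pv_term t"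
  shows "pv_eq (less zero t) zero"
proof -
  have "pv_eq (less zero (Var 0)) zero"
    by (rule pv_unique[where y = 0 and z = 1 and g = zero
          and ?h1.0 = "tr (Var 1)" and ?h2.0 = "tr (Var 1)"])
       (simp_all add: pv_base pv_refl pv_sym[OF Tr_zero])
  from pv_inst[OF this assms assms assms] show ?thesis by simp
qed

lemma less_commute:
  assumes "is_pv_term s" "is_pv_term t" "is_pv_term u"
  shows "pv_eq (less (less s t) u) (less (less s u) t)"
proof -
  have "pv_eq (less (less (Var 0) (Var 1)) (Var 2)) (less (less (Var 0) (Var 2)) (Var 1))"
    by (rule pv_unique[where y = 2 and z = 3 and g = "less (Var 0) (Var 1)"
          and ?h1.0 = "tr (Var 3)" and ?h2.0 = "tr (Var 3)"])
       (auto intro!: pv_base pv_cong_binary pv_refl pv_trans[OF pv_cong_binary less_tr])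
  from pv_inst[OF this assms] show ?thesis by simp
qed

lemma less_cat:
  assumes "is_pv_term s" "is_pv_term t" "is_pv_term u"
  shows "pv_eq (less s (cat t u)) (less (less s t) u)"
proof -
  have "pv_eq (less (Var 0) (cat (Var 1) (Var 2))) (less (less (Var 0) (Var 1)) (Var 2))"
    by (rule pv_unique[where y = 2 and z = 3 and g = "less (Var 0) (Var 1)"
          and ?h1.0 = "tr (Var 3)" and ?h2.0 = "tr (Var 3)"])
       (auto intro!: pv_base pv_cong_binary pv_refl
          pv_trans[OF pv_cong_binary[OF pv_refl pv_base2(1)] pv_base2(3)]
          pv_trans[OF pv_cong_binary[OF pv_refl pv_base2(2)] pv_base2(4)])
  from pv_inst[OF this assms] show ?thesis by simp
qed

lemma less_self:
  assumes "is_pv_term t"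
  shows "pv_eq (less t t) zero"
proof -
  have *: "pv_eq (less (App f [Var 0]) (App f [Var 0])) (less (Var 0) (Var 0))"
    if "f = S1 \<or> f = S2" for f
  proof -
    have f: "is_pv_fun f" "arity f = 1" using that by auto
    have "pv_eq (less (App f [Var 0]) (App f [Var 0])) (tr (less (App f [Var 0]) (Var 0)))"
      using that by (auto intro: pv_base)
    also have "pv_eq \<dots> (less (tr (App f [Var 0])) (Var 0))"
      by (rule pv_sym[OF less_tr]) (use f in auto)
    also have "pv_eq \<dots> (less (Var 0) (Var 0))"
      by (rule pv_cong_binary) (use that in \<open>auto intro: pv_base pv_refl\<close>)
    finally show ?thesis .
  qed
  have "pv_eq (less (Var 0) (Var 0)) zero"
    by (rule pv_unique[where y = 0 and z = 1 and g = zero and ?h1.0 = "Var 1" and ?h2.0 = "Var 1"])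
       (simp_all add: * pv_base pv_refl)
  from pv_inst[OF this assms assms assms] show ?thesis by simp
qed

lemma cut_bound:
  assumes "is_pv_term s" "is_pv_term t" "is_pv_term u"
  shows "pv_eq (less (cut s t) (cat u t)) zero"
proof -
  let ?c = "cut s t"
  have c: "is_pv_term ?c" using assms by simp
  have "pv_eq (less ?c (cat u t)) (less (less ?c u) t)" by (rule less_cat) (use c assms in auto)
  also have "pv_eq \<dots> (less (less ?c t) u)" by (rule less_commute) (use c assms in auto)
  also have "pv_eq \<dots> (less zero u)"
  proof (rule pv_cong_binary)
    have "pv_eq (less ?c t) (less (less s t) (less s t))"
      unfolding cut_def by (rule less_commute) (use assms in auto)
    also have "pv_eq \<dots> zero" by (rule less_self) (use assms in auto)
    finally show "pv_eq (less ?c t) zero" .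
  qed (use assms pv_refl in auto)
  also have "pv_eq \<dots> zero" by (rule less_zero_left) (use assms in auto)
  finally show ?thesis .
qed

lemma is_pv_fun_lrec [simp]:
  assumes "is_pv_term g" "is_pv_term h1" "is_pv_term h2" "is_pv_term l"
    "tm_below n g" "tm_below (n + 2) h1" "tm_below (n + 2) h2" "tm_below (n + 1) l"
  shows "is_pv_fun (lrec n g h1 h2 l)"
proof -
  have l: "tm_below (n + 2) l"
    using assms(8) by (induction l) auto
  have bound: "pv_eq (less (App (Lam (n + 2) (cut h l)) (vars (n + 2)))
      (cat (Var (n + 1)) (App (Lam (n + 1) l) (vars (n + 1))))) zero"
    if "is_pv_term h" "tm_below (n + 2) h" for h
  proof (rule pv_trans)
    show "pv_eq (less (cut h l) (cat (Var (n + 1)) l)) zero"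
      by (rule cut_bound) (use that assms in auto)
  qed (use that assms l in \<open>auto intro!: pv_cong_binary Lam_eq pv_refl\<close>)
  show ?thesis
    unfolding lrec_def by (rule fun_Rec) (use assms l bound in auto)
qed

text \<open>
  The digit 1 is read as the truth value true, the digit 2 and the empty string as false.
  Lengths, counters and indices are numerals, that is, strings in dyadic notation.
\<close>

text \<open>\<open>ite c a b\<close> is \<open>a\<close> if the last digit of \<open>c\<close> is 1, and \<open>b\<close> otherwise.\<close>

definition ite_fun :: pv_fun where
  "ite_fun = lrec 2 (Var 1) (Var 0) (Var 1) (cat (Var 0) (Var 1))"
abbreviation ite :: "pv_term \<Rightarrow> pv_term \<Rightarrow> pv_term \<Rightarrow> pv_term" where
  "ite c a b \<equiv> App ite_fun [a, b, c]"

abbreviation conj :: "pv_term \<Rightarrow> pv_term \<Rightarrow> pv_term" where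
  "conj s t \<equiv> ite s (ite t one zero) zero"
abbreviation disj :: "pv_term \<Rightarrow> pv_term \<Rightarrow> pv_term" where
  "disj s t \<equiv> ite s one (ite t one zero)"
abbreviation neg :: "pv_term \<Rightarrow> pv_term" where
  "neg s \<equiv> ite s zero one"

definition null_fun :: pv_fun where
  "null_fun = lrec 0 one zero zero zero"
abbreviation null :: "pv_term \<Rightarrow> pv_term" where
  "null t \<equiv> App null_fun [t]"

definition succ_fun :: pv_fun where
  "succ_fun = lrec 0 one (s2 (Var 0)) (s1 (Var 1)) (s1 (s1 (Var 0)))"
abbreviation succ :: "pv_term \<Rightarrow> pv_term" where
  "succ t \<equiv> App succ_fun [t]"

text \<open>The length \<open>|t|\<close>, as a numeral.\<close>

definition len_fun :: pv_fun where
  "len_fun = lrec 0 zero (succ (Var 1)) (succ (Var 1)) (s1 (Var 0))"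
abbreviation len :: "pv_term \<Rightarrow> pv_term" where
  "len t \<equiv> App len_fun [t]"

text \<open>
  The order of the numbers denoted by strings: shorter strings precede longer ones, and strings of
  the same length are ordered lexicographically.  \<open>cmp_fun\<close> (arguments \<open>x\<close>, \<open>y\<close>, \<open>u\<close>) compares the
  prefixes of length \<open>|u|\<close> of strings of the same length, the value being empty, 1 or 2 if the one
  of \<open>x\<close> is equal to, less than, or greater than the one of \<open>y\<close>.
\<close>

definition cmp_fun :: pv_fun where
  "cmp_fun =
    (let x' = cut (Var 0) (s1 (Var 2)); y' = cut (Var 1) (s1 (Var 2));
         h = ite (null (Var 3)) (ite x' (ite y' zero one) (ite y' two zero)) (Var 3)
     in lrec 2 zero h h one)"

definition le_fun :: pv_fun where
  "le_fun = Lam 2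
    (let c = App cmp_fun [Var 0, Var 1, Var 0]
     in conj (null (less (Var 0) (Var 1)))
             (disj (neg (null (less (Var 1) (Var 0)))) (disj (null c) c)))"
abbreviation le :: "pv_term \<Rightarrow> pv_term \<Rightarrow> pv_term" where
  "le s t \<equiv> App le_fun [s, t]"

abbreviation lt :: "pv_term \<Rightarrow> pv_term \<Rightarrow> pv_term" where
  "lt s t \<equiv> neg (le t s)"
abbreviation eq :: "pv_term \<Rightarrow> pv_term \<Rightarrow> pv_term" where
  "eq s t \<equiv> conj (le s t) (le t s)"

text \<open>The string of ones of length \<open>|t|\<close>.\<close>

definition ones_fun :: pv_fun where
  "ones_fun = lrec 0 zero (s1 (Var 1)) (s1 (Var 1)) (s1 (Var 0))"
abbreviation ones :: "pv_term \<Rightarrow> pv_term" where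
  "ones t \<equiv> App ones_fun [t]"


subsection \<open>Sequences\<close>

text \<open>
  A string codes a sequence of strings as follows.  It is read from left to right in blocks of two
  digits: a block 11 or 12 contributes the digit 1 or 2 to the current element, a block 21 or 22
  ends the current element.  Thus the sequence of \<open>a\<close>, \<open>b\<close> with \<open>a = 12\<close> and \<open>b\<close> empty has the code
  11 12 21 21.  Every string is a code (what follows the last block 21 or 22 is not part of
  the sequence), and elements are numbered from 0.
\<close>

definition odd_len_fun :: pv_fun where
  "odd_len_fun = lrec 0 zero (null (Var 1)) (null (Var 1)) one"
abbreviation odd_len :: "pv_term \<Rightarrow> pv_term" where
  "odd_len t \<equiv> App odd_len_fun [t]"

text \<open>The number of elements of the sequence coded by \<open>t\<close>.\<close>

definition count_fun :: pv_fun where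
  "count_fun =
    (let h = ite (conj (odd_len (Var 0)) (neg (Var 0))) (succ (Var 1)) (Var 1)
     in lrec 0 zero h h (s1 (Var 0)))"
abbreviation count :: "pv_term \<Rightarrow> pv_term" where
  "count t \<equiv> App count_fun [t]"

text \<open>\<open>elt w j\<close> is the \<open>j\<close>-th element \<open>w\<^sub>j\<close>, and empty if there is none.\<close>

definition elt_fun :: pv_fun where
  "elt_fun =
    (let c = conj (conj (odd_len (Var 1)) (Var 1)) (eq (count (Var 1)) (Var 0))
     in lrec 1 zero (ite c (s1 (Var 2)) (Var 2)) (ite c (s2 (Var 2)) (Var 2)) (s1 (Var 1)))"
abbreviation elt :: "pv_term \<Rightarrow> pv_term \<Rightarrow> pv_term" where
  "elt w j \<equiv> App elt_fun [j, w]"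

text \<open>The \<open>j\<close>-th digit of \<open>t\<close>, numbered from 0 on the left, and empty if there is none.\<close>

definition digit_fun :: pv_fun where
  "digit_fun =
    (let c = eq (len (Var 1)) (Var 0)
     in lrec 1 zero (ite c one (Var 2)) (ite c two (Var 2)) one)"
abbreviation digit :: "pv_term \<Rightarrow> pv_term \<Rightarrow> pv_term" where
  "digit t j \<equiv> App digit_fun [j, t]"


subsection \<open>Circuits\<close>

text \<open>
  Boolean circuits over conjunction, disjunction (both of fan-in two) and negation.  With \<open>n\<close> inputs
  and \<open>s\<close> gates there are \<open>2 + n + s\<close> nodes: node 0 is the constant false, node 1 the constant true,
  nodes \<open>2, \<dots>, n + 1\<close> are the inputs and the remaining ones are the gates.  A circuit is the
  sequence of a sequence of gates and of the index of the output node; a gate is the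
  sequence of its type (0, 1, 2 for conjunction, disjunction, negation) and the indices of two
  earlier nodes, the second of which is ignored by negation.  The size is the number of gates.
\<close>

abbreviation gates :: "pv_term \<Rightarrow> pv_term" where "gates c \<equiv> elt c zero"
abbreviation out_node :: "pv_term \<Rightarrow> pv_term" where "out_node c \<equiv> elt c one"

abbreviation gate_val :: "pv_term \<Rightarrow> pv_term \<Rightarrow> pv_term" where
  "gate_val g v \<equiv>
    (let a = digit v (elt g one); b = digit v (elt g two)
     in ite (eq (elt g zero) zero) (conj a b) (ite (eq (elt g zero) one) (disj a b) (neg a)))"

text \<open>
  Arguments: sequence of gates, input, \<open>u\<close>.  The string of the values of the two constants, the
  inputs and the first \<open>|u|\<close> gates (or all gates, if there are fewer).
\<close>

definition node_vals_fun :: pv_fun where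
  "node_vals_fun =
    (let h = ite (lt (len (Var 2)) (count (Var 0)))
               (ite (gate_val (elt (Var 0) (len (Var 2))) (Var 3)) (s1 (Var 3)) (s2 (Var 3)))
               (Var 3)
     in lrec 2 (cat (s1 two) (Var 1)) h h (cat (cat (s1 two) (Var 1)) (s1 (Var 2))))"
abbreviation node_vals :: "pv_term \<Rightarrow> pv_term \<Rightarrow> pv_term" where
  "node_vals gs x \<equiv> App node_vals_fun [gs, x, gs]"

definition circuit_val_fun :: pv_fun where
  "circuit_val_fun = Lam 2 (conj (digit (node_vals (gates (Var 0)) (Var 1)) (out_node (Var 0))) one)"
abbreviation circuit_val :: "pv_term \<Rightarrow> pv_term \<Rightarrow> pv_term" where
  "circuit_val c x \<equiv> App circuit_val_fun [c, x]"

text \<open>\<open>t\<close> codes a gate whose predecessors have indices less than \<open>m\<close>.\<close>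

abbreviation is_gate :: "pv_term \<Rightarrow> pv_term \<Rightarrow> pv_term" where
  "is_gate t m \<equiv> conj (eq (count t) (succ two))
     (conj (le (elt t zero) two) (conj (lt (elt t one) m) (lt (elt t two) m)))"

text \<open>
  Arguments: sequence, \<open>x\<close>, \<open>u\<close>.  The first \<open>|u|\<close> elements (or all, if there are fewer) are gates
  of a circuit with \<open>|x|\<close> inputs.
\<close>

definition are_gates_fun :: pv_fun where
  "are_gates_fun =
    (let h = conj (Var 3) (disj (neg (lt (len (Var 2)) (count (Var 0))))
               (is_gate (elt (Var 0) (len (Var 2))) (len (cat (cat (s1 two) (Var 1)) (Var 2)))))
     in lrec 2 one h h one)"
abbreviation are_gates :: "pv_term \<Rightarrow> pv_term \<Rightarrow> pv_term" where
  "are_gates gs x \<equiv> App are_gates_fun [gs, x, gs]"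

text \<open>Arguments: \<open>C\<close>, \<open>x\<close>.  \<open>C\<close> codes a circuit with \<open>|x|\<close> inputs.\<close>

definition is_circuit_fun :: pv_fun where
  "is_circuit_fun = Lam 2
    (conj (eq (count (Var 0)) two)
    (conj (are_gates (gates (Var 0)) (Var 1))
          (lt (out_node (Var 0)) (len (node_vals (gates (Var 0)) (Var 1))))))"
abbreviation is_circuit :: "pv_term \<Rightarrow> pv_term \<Rightarrow> pv_term" where
  "is_circuit c x \<equiv> App is_circuit_fun [c, x]"

abbreviation circuit_size :: "pv_term \<Rightarrow> pv_term" where
  "circuit_size c \<equiv> count (gates c)"


subsection \<open>All these are PV functions\<close>

text \<open>The axioms below constrain only the symbols satisfying \<open>is_pv_fun\<close>.\<close>

lemma is_pv_fun_ite [simp]: "is_pv_fun ite_fun" "arity ite_fun = 3"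
  by (simp_all add: ite_fun_def Let_def)
lemma is_pv_fun_null [simp]: "is_pv_fun null_fun" "arity null_fun = 1"
  by (simp_all add: null_fun_def Let_def)
lemma is_pv_fun_succ [simp]: "is_pv_fun succ_fun" "arity succ_fun = 1"
  by (simp_all add: succ_fun_def Let_def)
lemma is_pv_fun_len [simp]: "is_pv_fun len_fun" "arity len_fun = 1"
  by (simp_all add: len_fun_def Let_def)
lemma is_pv_fun_cmp [simp]: "is_pv_fun cmp_fun" "arity cmp_fun = 3"
  by (simp_all add: cmp_fun_def Let_def)
lemma is_pv_fun_le [simp]: "is_pv_fun le_fun" "arity le_fun = 2"
  by (simp_all add: le_fun_def Let_def)
lemma is_pv_fun_ones [simp]: "is_pv_fun ones_fun" "arity ones_fun = 1"
  by (simp_all add: ones_fun_def Let_def)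
lemma is_pv_fun_odd_len [simp]: "is_pv_fun odd_len_fun" "arity odd_len_fun = 1"
  by (simp_all add: odd_len_fun_def Let_def)
lemma is_pv_fun_count [simp]: "is_pv_fun count_fun" "arity count_fun = 1"
  by (simp_all add: count_fun_def Let_def)
lemma is_pv_fun_elt [simp]: "is_pv_fun elt_fun" "arity elt_fun = 2"
  by (simp_all add: elt_fun_def Let_def)
lemma is_pv_fun_digit [simp]: "is_pv_fun digit_fun" "arity digit_fun = 2"
  by (simp_all add: digit_fun_def Let_def)
lemma is_pv_fun_node_vals [simp]: "is_pv_fun node_vals_fun" "arity node_vals_fun = 3"
  by (simp_all add: node_vals_fun_def Let_def)
lemma is_pv_fun_circuit_val [simp]: "is_pv_fun circuit_val_fun" "arity circuit_val_fun = 2"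
  by (simp_all add: circuit_val_fun_def Let_def)
lemma is_pv_fun_are_gates [simp]: "is_pv_fun are_gates_fun" "arity are_gates_fun = 3"
  by (simp_all add: are_gates_fun_def Let_def)
lemma is_pv_fun_is_circuit [simp]: "is_pv_fun is_circuit_fun" "arity is_circuit_fun = 2"
  by (simp_all add: is_circuit_fun_def Let_def)


section \<open>The theory PV1\<close>

text \<open>
  The universal theory of Krajicek, Pudlak and Takeuti: the equations derivable in PV; two basic
  facts on dyadic notation; and induction on notation for open formulas in Skolemised form.
  Every open formula has a characteristic function in PV, so it suffices to have induction for
  \<open>f(p,y) = 1\<close>, for every PV symbol \<open>f\<close>.  Its universal form says that if \<open>f(p,0) = 1\<close>
  and \<open>f(p,b) \<noteq> 1\<close>, then the longest proper prefix \<open>w\<close> of \<open>b\<close> with \<open>f(p,w) = 1\<close>, which is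
  the value of the PV function \<open>longest_fun n f\<close>, does not satisfy the induction step.
\<close>

definition longest_fun :: "nat \<Rightarrow> pv_fun \<Rightarrow> pv_fun" where
  "longest_fun n f =
    (let h = ite (eq (App f (vars (n + 1))) one) (Var n) (Var (n + 1))
     in lrec n zero h h (Var n))"

definition induction_axiom :: "nat \<Rightarrow> pv_fun \<Rightarrow> fm" where
  "induction_axiom n f =
    (let F = (\<lambda>t. Eq (App f (vars n @ [t])) one);
         w = App (longest_fun n f) (vars (n + 1))
     in Imp (And (F zero) (Neg (F (Var n)))) (And (F w) (Neg (And (F (s1 w)) (F (s2 w))))))"

definition PV1 :: "fm set" where
  "PV1 =
     \<Union> {closures (Eq s t) | s t. pv_eq s t}
   \<union> {Neg (Eq one zero)}
   \<union> closures (Or (Eq (Var 0) zero)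
       (Or (Eq (Var 0) (s1 (tr (Var 0)))) (Eq (Var 0) (s2 (tr (Var 0))))))
   \<union> \<Union> {closures (induction_axiom n f) | n f. is_pv_fun f \<and> arity f = n + 1}"


section \<open>Bounded collection\<close>

abbreviation Le :: "pv_term \<Rightarrow> pv_term \<Rightarrow> fm" where
  "Le s t \<equiv> Eq (le s t) one"

definition BAll :: "pv_term \<Rightarrow> fm \<Rightarrow> fm" where
  "BAll t \<phi> = All (Imp (Le (Var 0) (lift_tm t)) \<phi>)"

definition BEx :: "pv_term \<Rightarrow> fm \<Rightarrow> fm" where
  "BEx t \<phi> = Ex (And (Le (Var 0) (lift_tm t)) \<phi>)"

inductive sharply_bounded :: "fm \<Rightarrow> bool" where
  "sharply_bounded Fls"
| "\<lbrakk>is_pv_term s; is_pv_term t\<rbrakk> \<Longrightarrow> sharply_bounded (Eq s t)"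
| "\<lbrakk>sharply_bounded \<phi>; sharply_bounded \<psi>\<rbrakk> \<Longrightarrow> sharply_bounded (Imp \<phi> \<psi>)"
| "\<lbrakk>sharply_bounded \<phi>; sharply_bounded \<psi>\<rbrakk> \<Longrightarrow> sharply_bounded (And \<phi> \<psi>)"
| "\<lbrakk>sharply_bounded \<phi>; sharply_bounded \<psi>\<rbrakk> \<Longrightarrow> sharply_bounded (Or \<phi> \<psi>)"
| "\<lbrakk>is_pv_term t; sharply_bounded \<phi>\<rbrakk> \<Longrightarrow> sharply_bounded (BAll (len t) \<phi>)"
| "\<lbrakk>is_pv_term t; sharply_bounded \<phi>\<rbrakk> \<Longrightarrow> sharply_bounded (BEx (len t) \<phi>)"

inductive Sigma_b_1 :: "fm \<Rightarrow> bool" where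
  "sharply_bounded \<phi> \<Longrightarrow> Sigma_b_1 \<phi>"
| "\<lbrakk>Sigma_b_1 \<phi>; Sigma_b_1 \<psi>\<rbrakk> \<Longrightarrow> Sigma_b_1 (And \<phi> \<psi>)"
| "\<lbrakk>Sigma_b_1 \<phi>; Sigma_b_1 \<psi>\<rbrakk> \<Longrightarrow> Sigma_b_1 (Or \<phi> \<psi>)"
| "\<lbrakk>is_pv_term t; Sigma_b_1 \<phi>\<rbrakk> \<Longrightarrow> Sigma_b_1 (BEx t \<phi>)"
| "\<lbrakk>is_pv_term t; Sigma_b_1 \<phi>\<rbrakk> \<Longrightarrow> Sigma_b_1 (BEx (len t) \<phi>)"
| "\<lbrakk>is_pv_term t; Sigma_b_1 \<phi>\<rbrakk> \<Longrightarrow> Sigma_b_1 (BAll (len t) \<phi>)"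

text \<open>
  In \<open>\<phi>\<close> the variable 0 is \<open>y\<close>, the variable 1 is \<open>j\<close>, and the others are parameters, which are
  moved past the quantifiers on \<open>x\<close> and \<open>t\<close> (and on \<open>w\<close>, in place of \<open>y\<close>).  Under the
  quantifiers on \<open>x, t, j, y\<close> these are the variables 3, 2, 1, 0; under those on \<open>x, t, w, j\<close>,
  again 3, 2, 1, 0.
\<close>

definition BB :: "fm \<Rightarrow> fm" where
  "BB \<phi> = All (All (Imp
     (BAll (len (Var 1)) (BEx (Var 1)
       (fm_subst (\<lambda>i. if i < 2 then Var i else Var (i + 2)) \<phi>)))
     (Ex (BAll (len (Var 2))
       (fm_subst (\<lambda>i. if i = 0 then elt (Var 1) (Var 0)
                      else if i = 1 then Var 0 else Var (i + 2)) \<phi>)))))"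

definition BB_Sigma_b_1 :: "fm set" where
  "BB_Sigma_b_1 = \<Union> {closures (BB \<phi>) | \<phi>. Sigma_b_1 \<phi>}"


section \<open>Circuit upper bounds\<close>

text \<open>For a string \<open>t\<close> of length \<open>n\<close>, a string of length \<open>n ^ k\<close> and one of length \<open>c * n ^ k\<close>.\<close>

primrec power_string :: "nat \<Rightarrow> pv_term \<Rightarrow> pv_term" where
  "power_string 0 t = one"
| "power_string (Suc k) t = smash (power_string k t) t"

primrec bound_string :: "nat \<Rightarrow> nat \<Rightarrow> pv_term \<Rightarrow> pv_term" where
  "bound_string k 0 t = zero"
| "bound_string k (Suc c) t = cat (bound_string k c t) (power_string k t)"

text \<open>
  The first quantifier ranges over the strings \<open>N\<close> of ones, \<open>n\<close> being the length of \<open>N\<close>; the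
  second and third are on the circuit and on \<open>x\<close>.
\<close>

definition UP :: "nat \<Rightarrow> nat \<Rightarrow> pv_fun \<Rightarrow> fm" where
  "UP k c f = All (Imp (Eq (ones (Var 0)) (Var 0))
     (Ex (And (And (Eq (is_circuit (Var 0) (Var 1)) one)
                   (Le (circuit_size (Var 0)) (len (bound_string k c (Var 1)))))
       (All (Imp (Eq (len (Var 0)) (len (Var 2)))
         (Iff (Eq (App f [Var 0]) one) (Eq (circuit_val (Var 1) (Var 0)) one)))))))"


subsection \<open>The axioms and the sentences are formulas of PV\<close>

lemma is_pv_term_subst: "\<lbrakk>is_pv_term t; \<forall>i. is_pv_term (\<sigma> i)\<rbrakk> \<Longrightarrow> is_pv_term (tm_subst \<sigma> t)"
  by (induction \<sigma> t rule: tm_subst.induct) auto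

lemma is_pv_fm_subst: "\<lbrakk>is_pv_fm \<phi>; \<forall>i. is_pv_term (\<sigma> i)\<rbrakk> \<Longrightarrow> is_pv_fm (fm_subst \<sigma> \<phi>)"
proof (induction \<phi> arbitrary: \<sigma>)
  case (All \<phi>)
  then show ?case by (auto simp: up_def is_pv_term_subst split: nat.split)
next
  case (Ex \<phi>)
  then show ?case by (auto simp: up_def is_pv_term_subst split: nat.split)
qed (auto simp: is_pv_term_subst)

lemma is_pv_term_vars: "t \<in> set (vars n) \<Longrightarrow> is_pv_term t"
  by (auto simp: vars_def)

lemma is_pv_term_substD: "is_pv_term (tm_subst \<sigma> t) \<Longrightarrow> is_pv_term t"
  by (induction \<sigma> t rule: tm_subst.induct) auto

lemma length_vars [simp]: "length (vars n) = n"
  by (simp add: vars_def)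

lemma is_pv_fun_RecD:
  "is_pv_fun (Rec g h1 h2 l1 l2) \<Longrightarrow>
    is_pv_fun g \<and> is_pv_fun h1 \<and> is_pv_fun h2 \<and> arity h1 = arity g + 2 \<and> arity h2 = arity g + 2"
  by (auto elim: is_pv_fun.cases)

lemma pv_eq_is_pv_term: "pv_eq s t \<Longrightarrow> is_pv_term s \<and> is_pv_term t"
proof (induction rule: is_pv_fun_is_pv_term_pv_eq.inducts(3)
    [where ?P1.0 = "\<lambda>_. True" and ?P2.0 = "\<lambda>_. True"])
  case (pv_cong f ts us)
  then show ?case
    by (auto simp: list_all2_conv_all_nth in_set_conv_nth)
qed (auto dest: is_pv_term_substD is_pv_term_vars is_pv_fun_RecD intro: is_pv_term_subst)

lemma is_pv_fm_induction_axiom: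
  assumes "is_pv_fun f" "arity f = n + 1"
  shows "is_pv_fm (induction_axiom n f)"
proof -
  have "is_pv_fun (longest_fun n f)" "arity (longest_fun n f) = n + 1"
    using assms by (auto simp: longest_fun_def Let_def is_pv_term_vars) (auto simp: vars_def)
  then show ?thesis
    using assms by (auto simp: induction_axiom_def Let_def is_pv_term_vars)
qed

lemma is_pv_fm_bounded:
  "is_pv_term t \<Longrightarrow> is_pv_fm (BAll t \<phi>) \<longleftrightarrow> is_pv_fm \<phi>"
  "is_pv_term t \<Longrightarrow> is_pv_fm (BEx t \<phi>) \<longleftrightarrow> is_pv_fm \<phi>"
  by (auto simp: BAll_def BEx_def intro: is_pv_term_subst)

lemma is_pv_fm_BB:
  assumes "Sigma_b_1 \<phi>"
  shows "is_pv_fm (BB \<phi>)"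
proof -
  have "is_pv_fm \<psi>" if "sharply_bounded \<psi>" for \<psi>
    using that by induction (auto simp: is_pv_fm_bounded)
  with assms have "is_pv_fm \<phi>"
    by induction (auto simp: is_pv_fm_bounded)
  then show ?thesis
    by (auto simp: BB_def is_pv_fm_bounded intro!: is_pv_fm_subst)
qed

lemma is_pv_fm_UP:
  assumes "is_pv_fun f" "arity f = 1"
  shows "is_pv_fm (UP k c f)"
proof -
  have power: "is_pv_term (power_string k (Var (Suc 0)))"
    by (induction k) auto
  have "is_pv_term (bound_string k c (Var (Suc 0)))"
    by (induction c) (auto simp: power)
  with assms show ?thesis
    by (auto simp: UP_def)
qed

end

theory Submission
  imports Defs "HOL-Library.Countable"
begin

text \<open>
  Suppose that, for the given \<open>k\<close>, all PV functions have provable upper bounds.  By soundness they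
  all have circuits of size \<open>O(n\<^sup>k)\<close>.  A countable model of \<open>PV1\<close> with \<open>BB\<close> is built from standard
  positions as in a Herbrand saturated model: a collection instance either receives a bounded
  index \<open>j\<close> together with the promise that it has no witness, or the finitely many rounds that
  refute this promise are played for all \<open>j\<close> in parallel, which produces the sequence of witnesses.
  So a proof of \<open>UP\<close> is a student who asks for counterexamples to polynomially many circuits in
  each of constantly many rounds.

  The teacher answers from short descriptions.  The digits of the circuits asked in a round form a
  PV function of \<open>1\<^sup>m\<close>, the description \<open>v\<close> of the earlier answers and an index \<open>l\<close>, hence are given
  by a circuit \<open>D\<close> of size a fixed power of \<open>m\<close>.  The counterexample to the \<open>l\<close>-th circuit is the
  input coding \<open>(D, v, l)\<close>: the hard function decodes the circuit and negates its value.  All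
  answers of the round are described by \<open>(v, D)\<close>, and \<open>n\<close> is a power of \<open>m\<close> so large that the
  inputs fit in for all rounds.
\<close>

section \<open>The standard model\<close>

text \<open>The hard function is fixed before the constant \<open>c\<close> and before the proof
  whose queries it has to refute, so it cannot contain the PV functions by which the student
  computes these queries. It receives them with the input, in the form of the circuit
  \<open>D\<close>. Circuits of one fixed polynomial degree exist for all these functions because
  the assumption to be contradicted bounds every symbol with the same exponent \<open>k\<close>;
  only the constant factor varies with the symbol, and a large \<open>m\<close> absorbs it. Parallel
  queries are cheap: the whole round shares one circuit, and a query adds only its index, a short
  numeral. Successive rounds are expensive: descriptions of length \<open>m ^ e\<close> become
  descriptions of length \<open>m ^ ((e + 1) * (2 * k + 1) + 1)\<close>, so the number of rounds has
  to be constant. Collection fits because the inconsistency of a promise is witnessed by one finite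
  list of rounds, the same for all positions. Playing it for all indices at once increases the
  number of queries in a round, not the number of rounds.\<close>

text \<open>
  A string is the list of its digits from right to left, \<open>True\<close> standing for the digit 1 and
  \<open>False\<close> for the digit 2; thus recursion on notation is recursion on lists.
\<close>

type_synonym str = "bool list"
type_synonym env = "nat \<Rightarrow> str"

primrec fval :: "pv_fun \<Rightarrow> str list \<Rightarrow> str" and tval :: "pv_term \<Rightarrow> env \<Rightarrow> str" where
  "fval Zero as = []"
| "fval S1 as = True # as ! 0"
| "fval S2 as = False # as ! 0"
| "fval Tr as = tl (as ! 0)"
| "fval Cat as = as ! 1 @ as ! 0"
| "fval Smash as = concat (map (\<lambda>_. as ! 0) (as ! 1))"
| "fval Less as = drop (length (as ! 1)) (as ! 0)"
| "fval (Lam n t) as = tval t (\<lambda>i. as ! i)"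
| "fval (Rec g h1 h2 l1 l2) as =
     rec_list (fval g (butlast as))
       (\<lambda>d y z. if d then fval h1 (butlast as @ [y, z]) else fval h2 (butlast as @ [y, z])) (last as)"
| "tval (Var i) \<rho> = \<rho> i"
| "tval (App f ts) \<rho> = fval f (map (\<lambda>t. tval t \<rho>) ts)"

section \<open>Substitution and soundness of the equational calculus\<close>

lemma tval_subst: "tval (tm_subst \<sigma> t) \<rho> = tval t (\<lambda>i. tval (\<sigma> i) \<rho>)"
proof (induction \<sigma> t rule: tm_subst.induct)
  case (2 \<sigma> f ts)
  then have "map (\<lambda>t. tval t \<rho>) (map (tm_subst \<sigma>) ts) = map (\<lambda>t. tval t (\<lambda>i. tval (\<sigma> i) \<rho>)) ts"
    by simp
  then show ?case by (simp only: tm_subst.simps tval.simps)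
qed simp

lemma tval_cong: "tm_below n t \<Longrightarrow> (\<And>i. i < n \<Longrightarrow> \<rho> i = \<rho>' i) \<Longrightarrow> tval t \<rho> = tval t \<rho>'"
proof (induction n t rule: tm_below.induct)
  case (2 n f ts)
  then have "map (\<lambda>t. tval t \<rho>) ts = map (\<lambda>t. tval t \<rho>') ts" by simp
  then show ?case by (simp only: tval.simps)
qed simp

lemma tm_below_mono: "tm_below m t \<Longrightarrow> m \<le> n \<Longrightarrow> tm_below n t"
  by (induction m t rule: tm_below.induct) auto

lemma ex_tm_below: "\<exists>n. tm_below n t"
proof (induction n\<equiv>"0::nat" t rule: tm_below.induct)
  case (1 i)
  show ?case by (auto intro: exI[of _ "Suc i"])
next
  case (2 f ts)
  then obtain N where N: "\<forall>t\<in>set ts. tm_below (N t) t" by metis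
  have "tm_below (\<Sum>t\<in>set ts. N t) t" if "t \<in> set ts" for t
    using N that by (meson finite_set member_le_sum tm_below_mono zero_le)
  then show ?case by auto
qed

lemma tm_below_subst:
  "tm_below n t \<Longrightarrow> (\<And>i. i < n \<Longrightarrow> tm_below m (\<sigma> i)) \<Longrightarrow> tm_below m (tm_subst \<sigma> t)"
  by (induction n t rule: tm_below.induct) auto

lemma tval_vars [simp]: "map (\<lambda>t. tval t \<rho>) (vars n) = map \<rho> [0..<n]"
  by (simp add: vars_def)

lemma fval_Rec_snoc:
  "fval (Rec g h1 h2 l1 l2) (as @ [y]) =
     rec_list (fval g as) (\<lambda>d y z. fval (if d then h1 else h2) (as @ [y, z])) y"
proof -
  have "(\<lambda>d y z. if d then fval h1 (as @ [y, z]) else fval h2 (as @ [y, z])) =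
      (\<lambda>d y z. fval (if d then h1 else h2) (as @ [y, z]))" by (intro ext) simp
  then show ?thesis by (simp only: fval.simps butlast_snoc last_snoc)
qed

lemma concat_map_const_append: "concat (map (\<lambda>_. x) y) @ x = x @ concat (map (\<lambda>_. x) y)"
  by (induction y) auto

lemma pv_eq_sound: "pv_eq t u \<Longrightarrow> tval t \<rho> = tval u \<rho>"
proof (induction arbitrary: \<rho> rule: is_pv_fun_is_pv_term_pv_eq.inducts(3)
    [where ?P1.0 = "\<lambda>_. True" and ?P2.0 = "\<lambda>_. True"])
  case (Lam_eq n t)
  then have "tm_below n t" by simp
  then show ?case by (simp only: tval.simps fval.simps tval_vars) (rule tval_cong, auto)
next
  case (Rec_zero g h1 h2 l1 l2 n)
  then show ?case by (simp only: tval.simps fval_Rec_snoc map_append list.map tval_vars) simp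
next
  case (Rec_s1 g h1 h2 l1 l2 n)
  have "map \<rho> [0..<n+1] = map \<rho> [0..<n] @ [\<rho> n]" by simp
  with Rec_s1 show ?case
    by (simp only: tval.simps fval_Rec_snoc map_append list.map tval_vars) simp
next
  case (Rec_s2 g h1 h2 l1 l2 n)
  have "map \<rho> [0..<n+1] = map \<rho> [0..<n] @ [\<rho> n]" by simp
  with Rec_s2 show ?case
    by (simp only: tval.simps fval_Rec_snoc map_append list.map tval_vars) simp
next
  case (pv_cong f ts us)
  then have "map (\<lambda>t. tval t \<rho>) ts = map (\<lambda>t. tval t \<rho>) us"
    by (auto simp: list_all2_conv_all_nth intro: nth_equalityI)
  then show ?case by (simp only: tval.simps)
next
  case (pv_subst t u \<sigma>)
  then show ?case by (simp add: tval_subst)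
next
  case (pv_unique y u g z h1 h2 v)
  have sub: "tval (tm_subst (Var(x := s)) t) \<rho> = tval t (\<rho>(x := tval s \<rho>))" for s t x \<rho>
    unfolding tval_subst by (rule arg_cong[of _ _ "tval t"]) auto
  \<comment> \<open>The rule \<open>pv_unique\<close> is sound because a recursion on notation
    determines its values; the two terms are compared by induction on the list put for
    \<open>y\<close>.\<close>
  have *: "tval u (\<rho>(y := w)) = tval v (\<rho>(y := w))" for w
  proof (induction w)
    case Nil
    have "tval u (\<rho>(y := [])) = tval g \<rho>" "tval v (\<rho>(y := [])) = tval g \<rho>"
      using pv_unique.IH(1)[of \<rho>] pv_unique.IH(4)[of \<rho>] by (simp_all add: sub)
    then show ?case by (simp only:)
  next
    case (Cons d w)
    \<comment> \<open>The premises are used at \<open>r\<close>: substituting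
      \<open>s1 (Var y)\<close> or \<open>s2 (Var y)\<close> prepends a digit to \<open>w\<close>,
      while the right-hand sides are evaluated at \<open>w\<close> itself.\<close>
    obtain r where r: "r = \<rho>(y := w)" by blast
    have ry: "r y = w" and r_upd: "r(y := x) = \<rho>(y := x)" for x by (simp_all add: r)
    have eqs: "tval u (r(y := True # w)) = tval h1 (r(z := tval u r))"
      "tval u (r(y := False # w)) = tval h2 (r(z := tval u r))"
      "tval v (r(y := True # w)) = tval h1 (r(z := tval v r))"
      "tval v (r(y := False # w)) = tval h2 (r(z := tval v r))"
      using pv_unique.IH(2)[of r] pv_unique.IH(3)[of r] pv_unique.IH(5)[of r] pv_unique.IH(6)[of r]
      unfolding sub by (simp_all add: ry)
    moreover have "tval u r = tval v r" using Cons by (simp only: r)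
    ultimately show ?case unfolding r_upd by (cases d) metis+
  qed
  from *[of "\<rho> y"] show ?case by simp
qed (auto simp: concat_map_const_append drop_Suc tl_drop simp del: fval.simps(9))

subsection \<open>Values of the symbols of the definitions\<close>

definition tru :: "str \<Rightarrow> bool" where "tru c \<longleftrightarrow> c \<noteq> [] \<and> hd c"

definition bv :: "bool \<Rightarrow> str" where "bv P = (if P then [True] else [])"

lemma tru_simps [simp]: "\<not> tru []" "tru (d # c) = d" "tru (bv P) = P"
  by (simp_all add: tru_def bv_def)

lemma bv_eq_iff [simp]:
  "bv P = [True] \<longleftrightarrow> P" "[True] = bv P \<longleftrightarrow> P" "bv P = [] \<longleftrightarrow> \<not> P" "bv P = bv Q \<longleftrightarrow> (P \<longleftrightarrow> Q)"
  by (auto simp: bv_def)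


lemma tval_cut: "tval (cut s t) \<rho> = drop (length (tval s \<rho>) - length (tval t \<rho>)) (tval s \<rho>)"
  by (simp add: cut_def)

text \<open>To evaluate an \<open>lrec\<close> symbol, the function \<open>R\<close> is guessed. The
  cut built into \<open>lrec\<close> deletes nothing as long as the values of \<open>R\<close> obey
  the bound \<open>l\<close>, so the recursion equations of \<open>R\<close> suffice.\<close>

lemma fval_lrec:
  assumes "length as = n" "tm_below (n + 1) l"
    and "R [] = tval g (\<lambda>i. as ! i)"
    and step: "\<And>d y. R (d # y) = tval (if d then h1 else h2) (\<lambda>i. (as @ [y, R y]) ! i)"
    and bound: "\<And>d y. length (R (d # y)) \<le> length (tval l (\<lambda>i. (as @ [y]) ! i))"
  shows "fval (lrec n g h1 h2 l) (as @ [y]) = R y"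
proof (induction y)
  case Nil
  show ?case using assms(1,3) by (simp add: lrec_def fval_Rec_snoc del: fval.simps(9))
next
  case (Cons d y)
  have l: "tval l (\<lambda>i. (as @ [y, R y]) ! i) = tval l (\<lambda>i. (as @ [y]) ! i)"
    by (rule tval_cong[OF assms(2)]) (use assms(1) in \<open>auto simp: nth_append less_Suc_eq\<close>)
  have "fval (lrec n g h1 h2 l) (as @ [d # y]) =
      tval (cut (if d then h1 else h2) l) (\<lambda>i. (as @ [y, fval (lrec n g h1 h2 l) (as @ [y])]) ! i)"
    by (simp add: lrec_def fval_Rec_snoc del: fval.simps(9))
  then show ?case using step[of d y] bound[of d y] unfolding Cons tval_cut l by simp
qed

lemma fval_lrec_0:
  assumes "tm_below 1 l" "R [] = tval g (\<lambda>i. [] ! i)"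
    and "\<And>d y. R (d # y) = tval (if d then h1 else h2) (\<lambda>i. [y, R y] ! i)"
    and "\<And>d y. length (R (d # y)) \<le> length (tval l (\<lambda>i. [y] ! i))"
  shows "fval (lrec 0 g h1 h2 l) [y] = R y"
  using fval_lrec[of "[]" 0 l R g h1 h2 y] assms by auto

lemma fval_lrec_1:
  assumes "tm_below 2 l" "R [] = tval g (\<lambda>i. [a] ! i)"
    and "\<And>d y. R (d # y) = tval (if d then h1 else h2) (\<lambda>i. [a, y, R y] ! i)"
    and "\<And>d y. length (R (d # y)) \<le> length (tval l (\<lambda>i. [a, y] ! i))"
  shows "fval (lrec 1 g h1 h2 l) [a, y] = R y"
  using fval_lrec[of "[a]" 1 l R g h1 h2 y] assms by (auto simp: numeral_2_eq_2)

lemma fval_lrec_2: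
  assumes "tm_below 3 l" "R [] = tval g (\<lambda>i. [a, b] ! i)"
    and "\<And>d y. R (d # y) = tval (if d then h1 else h2) (\<lambda>i. [a, b, y, R y] ! i)"
    and "\<And>d y. length (R (d # y)) \<le> length (tval l (\<lambda>i. [a, b, y] ! i))"
  shows "fval (lrec 2 g h1 h2 l) [a, b, y] = R y"
  using fval_lrec[of "[a, b]" 2 l R g h1 h2 y] assms by (auto simp: numeral_3_eq_3 numeral_2_eq_2)

lemma fval_ite [simp]: "fval ite_fun [a, b, c] = (if tru c then a else b)"
  unfolding ite_fun_def by (rule fval_lrec_2) (auto simp: tru_def)

lemma fval_null [simp]: "fval null_fun [c] = bv (c = [])"
  unfolding null_fun_def
  by (rule fval_lrec_0[where R = "\<lambda>c. bv (c = [])"]) (auto simp: bv_def)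

fun suc_str :: "str \<Rightarrow> str" where
  "suc_str [] = [True]"
| "suc_str (True # y) = False # y"
| "suc_str (False # y) = True # suc_str y"

lemma length_suc_str: "length (suc_str y) \<le> Suc (length y)"
  by (induction y rule: suc_str.induct) auto

lemma fval_succ [simp]: "fval succ_fun [y] = suc_str y"
  unfolding succ_fun_def
proof (rule fval_lrec_0)
  show "length (suc_str (d # y)) \<le> length (tval (s1 (s1 (Var 0))) (\<lambda>i. [y] ! i))" for d y
    using length_suc_str[of y] by (cases d) auto
  show "suc_str (d # y) =
      tval (if d then s2 (Var 0) else s1 (Var 1)) (\<lambda>i. [y, suc_str y] ! i)" for d y
    by (cases d) auto
qed auto

primrec val :: "str \<Rightarrow> nat" where
  "val [] = 0"
| "val (d # y) = 2 * val y + (if d then 1 else 2)"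

primrec num :: "nat \<Rightarrow> str" where
  "num 0 = []"
| "num (Suc n) = suc_str (num n)"

lemma val_suc_str [simp]: "val (suc_str y) = Suc (val y)"
  by (induction y rule: suc_str.induct) auto

lemma val_num [simp]: "val (num n) = n"
  by (induction n) auto

lemma val_inj: "val x = val y \<Longrightarrow> x = y"
proof (induction x arbitrary: y)
  case Nil
  then show ?case by (cases y) (auto split: if_splits)
next
  case (Cons d x)
  then obtain e z where y: "y = e # z" by (cases y) (auto split: if_splits)
  have "(d \<longleftrightarrow> e) \<and> val x = val z" using Cons(2) unfolding y by (auto split: if_splits) presburger+
  with Cons(1)[of z] y show ?case by auto
qed

lemma num_val [simp]: "num (val x) = x"
  by (rule val_inj) simp

lemma num_inj [simp]: "num m = num n \<longleftrightarrow> m = n"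
  by (metis val_num)

lemma num_eq_iff: "num n = x \<longleftrightarrow> val x = n"
  by auto

lemma power_length_le_val: "2 ^ length x \<le> val x + 1"
  by (induction x) auto

lemma val_less_power_length: "val x + 2 \<le> 2 ^ Suc (length x)"
  by (induction x) auto

lemma length_le_val: "length x \<le> val x"
proof (induction x)
  case (Cons d x)
  then show ?case by (simp split: if_split)
qed simp

lemma length_num: "length (num n) \<le> n"
  using length_le_val[of "num n"] by simp

lemma fval_len [simp]: "fval len_fun [y] = num (length y)"
  unfolding len_fun_def
proof (rule fval_lrec_0)
  show "length (num (length (d # y))) \<le> length (tval (s1 (Var 0)) (\<lambda>i. [y] ! i))"
    for d :: bool and y using length_num[of "length (d # y)"] by simp
qed auto

text \<open>The prefixes compared by \<open>cmp_fun\<close> are suffixes of lists.\<close>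

lemma fval_cmp:
  assumes "length x = length y" "length u \<le> length x"
  defines "p \<equiv> val (drop (length x - length u) x)"
    and "q \<equiv> val (drop (length y - length u) y)"
  shows "fval cmp_fun [x, y, u] = (if p < q then [True] else if p > q then [False] else [])"
proof -
  define X where "X m = drop (length x - Suc m) x" for m
  define Y where "Y m = drop (length y - Suc m) y" for m
  define stp where "stp m z = (if z = [] then
      (if tru (X m) then (if tru (Y m) then [] else [True])
       else (if tru (Y m) then [False] else [])) else z)" for m :: nat and z :: str
  define R where "R = rec_list [] (\<lambda>(d::bool) y z. stp (length y) z)"
  have R: "R [] = []" "R (d # w) = stp (length w) (R w)" for d w by (simp_all add: R_def)
  have bound: "length (R w) \<le> 1" for w
    by (induction w) (auto simp: R stp_def)
  have "fval cmp_fun [x, y, u] = R u"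
    unfolding cmp_fun_def Let_def
  proof (rule fval_lrec_2, goal_cases)
    case (3 d w)
    show ?case
      by (cases d) (simp_all add: R stp_def tval_cut X_def Y_def numeral_3_eq_3)
  next
    case (4 d w)
    show ?case using bound[of "d # w"] by simp
  qed (auto simp: R numeral_3_eq_3)
  moreover have "R u = (if p < q then [True] else if p > q then [False] else [])"
    using assms(2) unfolding p_def q_def
  proof (induction u)
    case Nil
    then show ?case by (simp add: R)
  next
    case (Cons d u)
    let ?m = "length u"
    have m: "?m < length x" "?m < length y" using Cons assms(1) by auto
    \<comment> \<open>\<open>a\<close> and \<open>b\<close> are new least significant digits. A
      difference of the shorter prefixes is doubled, so it outweighs the digits 1 and 2 and the
      earlier verdict stands.\<close>
    obtain a where a: "X ?m = a # drop (length x - ?m) x"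
      unfolding X_def using m(1) by (metis Cons_nth_drop_Suc Suc_diff_Suc diff_less zero_less_Suc
        less_le_trans Suc_leI)
    obtain b where b: "Y ?m = b # drop (length y - ?m) y"
      unfolding Y_def using m(2) by (metis Cons_nth_drop_Suc Suc_diff_Suc diff_less zero_less_Suc
        less_le_trans Suc_leI)
    have "drop (length x - length (d # u)) x = X ?m" "drop (length y - length (d # u)) y = Y ?m"
      by (simp_all add: X_def Y_def)
    then show ?case using Cons unfolding a b R stp_def by auto
  qed
  ultimately show ?thesis by simp
qed

lemma fval_le [simp]: "fval le_fun [x, y] = bv (val x \<le> val y)"
proof -
  consider "length x < length y" | "length x > length y" | "length x = length y" by linarith
  then show ?thesis
  proof cases
    case 1
    then have "(2::nat) ^ Suc (length x) \<le> 2 ^ length y" by (intro power_increasing) auto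
    then have "val x \<le> val y" using val_less_power_length[of x] power_length_le_val[of y] by linarith
    with 1 show ?thesis by (simp add: le_fun_def Let_def bv_def)
  next
    case 2
    then have "(2::nat) ^ Suc (length y) \<le> 2 ^ length x" by (intro power_increasing) auto
    then have "\<not> val x \<le> val y" using val_less_power_length[of y] power_length_le_val[of x] by linarith
    with 2 show ?thesis by (simp add: le_fun_def Let_def bv_def)
  next
    case 3
    then show ?thesis by (auto simp: le_fun_def Let_def fval_cmp bv_def)
  qed
qed

lemma tval_eq [simp]:
  "tval (eq s t) \<rho> = bv (tval s \<rho> = tval t \<rho>)"
  by (auto dest: val_inj simp: bv_def)

lemma fval_ones [simp]: "fval ones_fun [y] = replicate (length y) True"
  unfolding ones_fun_def by (rule fval_lrec_0) auto

lemma fval_odd_len [simp]: "fval odd_len_fun [y] = bv (odd (length y))"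
  unfolding odd_len_fun_def by (rule fval_lrec_0) (auto simp: bv_def)


subsection \<open>Sequences\<close>

text \<open>The tail \<open>y\<close> of \<open>d # y\<close> is the part already read. If its
  length is odd, \<open>d\<close> completes a block whose first digit is the head of
  \<open>y\<close>: digit 1 announces data, digit 2 ends the current element, whose number is
  \<open>cnt y\<close>.\<close>

primrec cnt :: "str \<Rightarrow> nat" where
  "cnt [] = 0"
| "cnt (d # y) = (if odd (length y) \<and> \<not> tru y then Suc (cnt y) else cnt y)"

primrec el :: "str \<Rightarrow> nat \<Rightarrow> str" where
  "el [] j = []"
| "el (d # y) j = (if odd (length y) \<and> tru y \<and> cnt y = j then d # el y j else el y j)"

lemma cnt_le_length: "cnt y \<le> length y"
  by (induction y) auto

lemma length_el: "length (el y j) \<le> length y"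
  by (induction y) auto

lemma fval_count [simp]: "fval count_fun [y] = num (cnt y)"
  unfolding count_fun_def Let_def
proof (rule fval_lrec_0)
  show "length (num (cnt (d # y))) \<le> length (tval (s1 (Var 0)) (\<lambda>i. [y] ! i))" for d y
    using length_num[of "cnt (d # y)"] cnt_le_length[of "d # y"] by simp
qed auto

lemma fval_elt [simp]: "fval elt_fun [j, w] = el w (val j)"
  unfolding elt_fun_def Let_def
proof (rule fval_lrec_1)
  show "length (el (d # y) (val j)) \<le> length (tval (s1 (Var 1)) (\<lambda>i. [j, y] ! i))" for d y
    using length_el[of "d # y" "val j"] by simp
qed (auto simp: num_eq_iff)

lemma fval_digit [simp]:
  "fval digit_fun [j, t] = (if val j < length t then [rev t ! val j] else [])"
  unfolding digit_fun_def Let_def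
  by (rule fval_lrec_1[where R = "\<lambda>t. if val j < length t then [rev t ! val j] else []"])
     (auto simp: num_eq_iff nth_append)

primrec dbl :: "str \<Rightarrow> str" where
  "dbl [] = []"
| "dbl (d # e) = d # True # dbl e"

text \<open>In list order the end of an element comes first: \<open>True # False\<close> is the
  final block 21 read backwards, and \<open>dbl\<close> supplies the leading 1 of each data
  block.\<close>

definition blk :: "str \<Rightarrow> str" where "blk e = True # False # dbl e"

definition code :: "str list \<Rightarrow> str" where "code es = fold (\<lambda>e y. blk e @ y) es []"

lemma code_Nil [simp]: "code [] = []" and code_snoc: "code (es @ [e]) = blk e @ code es"
  by (simp_all add: code_def)

lemma length_dbl [simp]: "length (dbl e) = 2 * length e"
  by (induction e) auto

lemma length_blk [simp]: "length (blk e) = 2 * length e + 2"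
  by (simp add: blk_def)

lemma dbl_append:
  assumes "even (length y)"
  shows "cnt (dbl e @ y) = cnt y"
    and "el (dbl e @ y) j = (if j = cnt y then e @ el y j else el y j)"
proof -
  show "cnt (dbl e @ y) = cnt y" for e
    using assms by (induction e) auto
  then show "el (dbl e @ y) j = (if j = cnt y then e @ el y j else el y j)"
    using assms by (induction e) auto
qed

lemma blk_append:
  assumes "even (length y)"
  shows "cnt (blk e @ y) = Suc (cnt y)"
    and "el (blk e @ y) j = (if j = cnt y then e @ el y j else el y j)"
  using dbl_append[OF assms] assms by (auto simp: blk_def)

lemma code_props:
  "even (length (code es)) \<and> cnt (code es) = length es \<and>
    (\<forall>j. el (code es) j = (if j < length es then es ! j else []))"
proof (induction es rule: rev_induct)
  case (snoc e es)
  then show ?case by (auto simp: code_snoc blk_append nth_append)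
qed simp


lemma cnt_code [simp]: "cnt (code es) = length es"
  and el_code [simp]: "j < length es \<Longrightarrow> el (code es) j = es ! j"
  using code_props[of es] by simp_all

text \<open>Once the end block of an element has been read, the counter exceeds its number, so
  further digits on the right belong to later elements. This makes elements robust under
  padding.\<close>

lemma el_append: "j < cnt y \<Longrightarrow> el (z @ y) j = el y j"
proof (induction z)
  case (Cons d z)
  have "cnt y \<le> cnt (z @ y)" by (induction z) auto
  with Cons show ?case by auto
qed simp

lemma length_code: "length (code es) = (\<Sum>e\<leftarrow>es. 2 * length e + 2)"
  by (induction es rule: rev_induct) (auto simp: code_snoc)

subsection \<open>Polynomial length bounds\<close>

text \<open>One constant is both shift and exponent, so that a polynomial bound has a single witness
  and also covers \<open>n = 0\<close>.\<close>

definition pb :: "(nat \<Rightarrow> nat) \<Rightarrow> bool" where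
  "pb p \<longleftrightarrow> (\<exists>K. \<forall>n. p n \<le> (K + n) ^ K)"

lemma pbI: "(\<And>n. p n \<le> (K + n) ^ L) \<Longrightarrow> pb p"
proof -
  assume p: "\<And>n. p n \<le> (K + n) ^ L"
  have "p n \<le> ((K + L + 1) + n) ^ (K + L + 1)" for n
  proof -
    note p[of n]
    also have "(K + n) ^ L \<le> ((K + L + 1) + n) ^ L" by (rule power_mono) auto
    also have "\<dots> \<le> ((K + L + 1) + n) ^ (K + L + 1)" by (rule power_increasing) auto
    finally show ?thesis .
  qed
  then show ?thesis unfolding pb_def by blast
qed

lemma pb_mono: "pb q \<Longrightarrow> (\<And>n. p n \<le> q n) \<Longrightarrow> pb p"
  unfolding pb_def by (meson order_trans)

lemma pb_const: "pb (\<lambda>n. c)" and pb_id: "pb (\<lambda>n. n)"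
  by (rule pbI[of _ c 1], simp) (rule pbI[of _ 0 1], simp)

lemma pb_Suc: "pb Suc"
  by (rule pbI[of _ 1 1]) simp

lemma pb_mult: assumes "pb p" "pb q" shows "pb (\<lambda>n. p n * q n)"
proof -
  from assms obtain K L where "\<And>n. p n \<le> (K + n) ^ K" "\<And>n. q n \<le> (L + n) ^ L"
    unfolding pb_def by blast
  then have "p n * q n \<le> (K + n) ^ K * (L + n) ^ L" for n by (intro mult_mono) auto
  also have "\<dots> n \<le> (K + L + n) ^ K * (K + L + n) ^ L" for n by (intro mult_mono power_mono) auto
  finally show ?thesis by (intro pbI[of _ "K + L" "K + L"]) (simp add: power_add)
qed

lemma pb_add: assumes "pb p" "pb q" shows "pb (\<lambda>n. p n + q n)"
proof -
  have *: "pb (\<lambda>n. r n + 1)" if "pb r" for r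
  proof -
    from that obtain K where r: "\<And>n. r n \<le> (K + n) ^ K" unfolding pb_def by blast
    have "r n + 1 \<le> (K + 2 + n) ^ (K + 1)" for n
    proof -
      have "(K + n) ^ K \<le> (K + 2 + n) ^ K" by (rule power_mono) auto
      moreover have "1 \<le> (K + 2 + n) ^ K" by (rule one_le_power) simp
      ultimately have "r n + 1 \<le> 2 * (K + 2 + n) ^ K" using r[of n] by linarith
      also have "\<dots> \<le> (K + 2 + n) * (K + 2 + n) ^ K" by (rule mult_right_mono) auto
      finally show ?thesis by simp
    qed
    then show ?thesis by (rule pbI)
  qed
  have "pb (\<lambda>n. (p n + 1) * (q n + 1))" by (intro pb_mult * assms)
  then show ?thesis by (rule pb_mono) simp
qed

lemma pb_power: "pb p \<Longrightarrow> pb (\<lambda>n. p n ^ j)"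
  by (induction j) (auto intro: pb_const pb_mult)

lemma pb_sum: "(\<And>i. i \<in> I \<Longrightarrow> pb (p i)) \<Longrightarrow> pb (\<lambda>n. \<Sum>i\<in>I. p i n)"
  by (induction I rule: infinite_finite_induct) (auto intro: pb_const pb_add)

lemma pb_comp: assumes "pb p" "pb q" shows "pb (\<lambda>n. p (q n))"
proof -
  from assms obtain K where p: "\<And>n. p n \<le> (K + n) ^ K" unfolding pb_def by blast
  have "pb (\<lambda>n. (K + q n) ^ K)" using assms by (intro pb_power pb_add pb_const)
  then show ?thesis by (rule pb_mono) (rule p)
qed

section \<open>Polynomial growth of PV functions\<close>

lemma length_concat_map_const: "length (concat (map (\<lambda>_. x) y)) = length x * length y"
  by (induction y) auto

lemma is_pv_fun_Rec_bounds:
  assumes "is_pv_fun (Rec g h1 h2 l1 l2)" "n = arity g"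
  shows "is_pv_fun g" "is_pv_fun l1" "is_pv_fun l2" "arity l1 = n + 1" "arity l2 = n + 1"
    "pv_eq (less (App h1 (vars (n + 2))) (cat (Var (n + 1)) (App l1 (vars (n + 1))))) zero"
    "pv_eq (less (App h2 (vars (n + 2))) (cat (Var (n + 1)) (App l2 (vars (n + 1))))) zero"
  using assms(1) unfolding assms(2) by (cases rule: is_pv_fun.cases; simp)+

text \<open>Soundness turns the derivable bounds of limited recursion into true ones: a step adds at
  most the length of a value of \<open>l1\<close> or \<open>l2\<close>. These are polynomial by
  induction, and there are as many steps as the last argument has digits.\<close>

lemma length_bound:
  "is_pv_fun f \<Longrightarrow>
    \<exists>p. mono p \<and> pb p \<and> (\<forall>as. length as = arity f \<longrightarrow> length (fval f as) \<le> p (\<Sum>a\<leftarrow>as. length a))"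
  "is_pv_term t \<Longrightarrow> tm_below n t \<Longrightarrow>
    \<exists>p. mono p \<and> pb p \<and> (\<forall>\<rho>. length (tval t \<rho>) \<le> p (\<Sum>i<n. length (\<rho> i)))"
proof (induction f and t arbitrary: and n rule: pv_fun.induct pv_term.induct)
  case Zero
  show ?case by (intro exI[of _ "\<lambda>_. 0"]) (auto simp: pb_const mono_def)
next
  case S1
  show ?case by (intro exI[of _ "\<lambda>n. n + 1"])
    (auto simp: mono_def length_Suc_conv intro: pb_Suc)
next
  case S2
  show ?case by (intro exI[of _ "\<lambda>n. n + 1"])
    (auto simp: mono_def length_Suc_conv intro: pb_Suc)
next
  case Tr
  show ?case by (intro exI[of _ "\<lambda>n. n"]) (auto simp: mono_def length_Suc_conv intro: pb_id)
next
  case Cat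
  show ?case by (intro exI[of _ "\<lambda>n. n"])
    (auto simp: mono_def length_Suc_conv numeral_2_eq_2 intro: pb_id)
next
  case Smash
  have "a * b \<le> (a + b) * (a + b)" for a b :: nat by (rule mult_mono) auto
  then show ?case by (intro exI[of _ "\<lambda>n. n * n"])
    (auto simp: mono_def length_Suc_conv numeral_2_eq_2 length_concat_map_const
      intro: pb_id pb_mult mult_mono)
next
  case Less
  show ?case by (intro exI[of _ "\<lambda>n. n"])
    (auto simp: mono_def length_Suc_conv numeral_2_eq_2 intro: pb_id)
next
  case (Lam n t)
  then obtain p where p: "mono p" "pb p" "\<And>\<rho>. length (tval t \<rho>) \<le> p (\<Sum>i<n. length (\<rho> i))"
    by auto
  have "length (fval (Lam n t) as) \<le> p (\<Sum>a\<leftarrow>as. length a)" if "length as = n" for as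
    using p(3)[of "\<lambda>i. as ! i"] that by (simp add: sum_list_sum_nth atLeast0LessThan)
  with p show ?case by auto
next
  case (Rec g h1 h2 l1 l2)
  define n where "n = arity g"
  note inv = is_pv_fun_Rec_bounds[OF Rec.prems n_def]
  have step: "length (fval h (xs @ [y, z])) \<le> length z + length (fval l (xs @ [y]))"
    if e: "pv_eq (less (App h (vars (n + 2))) (cat (Var (n + 1)) (App l (vars (n + 1))))) zero"
      and "length xs = n" for h l xs y z
  proof -
    define \<rho> where "\<rho> i = (xs @ [y, z]) ! i" for i
    have m: "map \<rho> [0..<n+2] = xs @ [y, z]" "map \<rho> [0..<n+1] = xs @ [y]"
      using that(2) by (auto simp: \<rho>_def list_eq_iff_nth_eq nth_append less_Suc_eq)
    have "map (\<lambda>t. tval t \<rho>) (vars (n + 2)) = xs @ [y, z]"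
        "map (\<lambda>t. tval t \<rho>) (vars (n + 1)) = xs @ [y]"
      unfolding tval_vars m by auto
    moreover have "\<rho> (n + 1) = z" using that(2) by (simp add: \<rho>_def nth_append)
    ultimately show ?thesis using pv_eq_sound[OF e, of \<rho>]
      by (simp del: tval_vars upt_Suc)
  qed
  from Rec.IH(1)[OF inv(1)] obtain pg where pg: "mono pg" "pb pg"
    "\<And>as. length as = n \<Longrightarrow> length (fval g as) \<le> pg (\<Sum>a\<leftarrow>as. length a)"
    by (auto simp: n_def)
  from Rec.IH(4)[OF inv(2)] obtain p1 where p1: "mono p1" "pb p1"
    "\<And>as. length as = n + 1 \<Longrightarrow> length (fval l1 as) \<le> p1 (\<Sum>a\<leftarrow>as. length a)"
    by (auto simp: inv)
  from Rec.IH(5)[OF inv(3)] obtain p2 where p2: "mono p2" "pb p2"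
    "\<And>as. length as = n + 1 \<Longrightarrow> length (fval l2 as) \<le> p2 (\<Sum>a\<leftarrow>as. length a)"
    by (auto simp: inv)
  define p where "p m = pg m + m * (p1 m + p2 m)" for m
  have mono: "mono p"
    using pg(1) p1(1) p2(1) unfolding p_def mono_def by (auto intro!: add_mono mult_mono)
  have *: "length (fval (Rec g h1 h2 l1 l2) (xs @ [y])) \<le>
      pg S + length y * (p1 S + p2 S)"
    if xs: "length xs = n" and "(\<Sum>a\<leftarrow>xs. length a) + length y \<le> S" for xs y S
    using that(2)
  proof (induction y)
    case Nil
    have "length (fval g xs) \<le> pg (\<Sum>a\<leftarrow>xs. length a)" by (rule pg) (rule xs)
    also have "\<dots> \<le> pg S" by (rule monoD[OF pg(1)]) (use Nil in simp)
    finally show ?case by (simp add: fval_Rec_snoc del: fval.simps(9))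
  next
    case (Cons d y)
    define z where "z = fval (Rec g h1 h2 l1 l2) (xs @ [y])"
    have "length (fval (Rec g h1 h2 l1 l2) (xs @ [d # y])) =
        length (fval (if d then h1 else h2) (xs @ [y, z]))"
      by (simp add: fval_Rec_snoc z_def del: fval.simps(9))
    also have "\<dots> \<le> length z + length (fval (if d then l1 else l2) (xs @ [y]))"
      using step[OF inv(6) xs] step[OF inv(7) xs] by auto
    also have "length (fval (if d then l1 else l2) (xs @ [y])) \<le>
        p1 (\<Sum>a\<leftarrow>xs @ [y]. length a) + p2 (\<Sum>a\<leftarrow>xs @ [y]. length a)"
      using p1(3)[of "xs @ [y]"] p2(3)[of "xs @ [y]"] xs by (auto intro: trans_le_add1 trans_le_add2)
    also have "\<dots> \<le> p1 S + p2 S"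
      using Cons.prems by (intro add_mono monoD[OF p1(1)] monoD[OF p2(1)]) auto
    also have "length z \<le> pg S + length y * (p1 S + p2 S)"
      unfolding z_def using Cons by simp
    finally show ?case by (simp add: add.assoc add.commute add.left_commute)
  qed
  have "length (fval (Rec g h1 h2 l1 l2) as) \<le> p (\<Sum>a\<leftarrow>as. length a)"
    if len: "length as = Suc n" for as
  proof -
    obtain xs y where as: "as = xs @ [y]" "length xs = n"
      by (rule rev_cases[of as]) (use len in auto)
    have "length (fval (Rec g h1 h2 l1 l2) (xs @ [y])) \<le>
       pg (\<Sum>a\<leftarrow>as. length a) + length y * (p1 (\<Sum>a\<leftarrow>as. length a) + p2 (\<Sum>a\<leftarrow>as. length a))"
      by (rule *) (use as in auto)
    also have "\<dots> \<le> p (\<Sum>a\<leftarrow>as. length a)"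
      unfolding p_def as(1) by (intro add_mono mult_mono order_refl) auto
    finally show ?thesis unfolding as(1) .
  qed
  moreover have "pb p" unfolding p_def by (intro pb_add pb_mult pg(2) p1(2) p2(2) pb_id)
  ultimately show ?case using mono unfolding arity.simps n_def[symmetric] by blast
next
  case (Var i)
  have "length (\<rho> i) \<le> (\<Sum>i<n. length (\<rho> i))" for \<rho> :: env
    using Var by (intro member_le_sum) auto
  then show ?case by (intro exI[of _ "\<lambda>n. n"]) (auto simp: mono_def intro: pb_id)
next
  case (App f ts)
  from App obtain pf where pf: "mono pf" "pb pf"
    "\<And>as. length as = arity f \<Longrightarrow> length (fval f as) \<le> pf (\<Sum>a\<leftarrow>as. length a)"
    by auto
  from App have "\<forall>t\<in>set ts. \<exists>p. mono p \<and> pb p \<and> (\<forall>\<rho>. length (tval t \<rho>) \<le> p (\<Sum>i<n. length (\<rho> i)))"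
    by simp
  then obtain P where P: "\<And>t. t \<in> set ts \<Longrightarrow> mono (P t)" "\<And>t. t \<in> set ts \<Longrightarrow> pb (P t)"
    "\<And>t \<rho>. t \<in> set ts \<Longrightarrow> length (tval t \<rho>) \<le> P t (\<Sum>i<n. length (\<rho> i))"
    by metis
  define p where "p m = pf (\<Sum>i<length ts. P (ts ! i) m)" for m
  have "mono p" unfolding p_def mono_def
    by (auto intro!: monoD[OF pf(1)] sum_mono monoD[OF P(1)])
  moreover have "pb p" unfolding p_def by (intro pb_comp[OF pf(2)] pb_sum P(2)) auto
  moreover have "length (tval (App f ts) \<rho>) \<le> p (\<Sum>i<n. length (\<rho> i))" for \<rho>
  proof -
    have "length (tval (App f ts) \<rho>) \<le> pf (\<Sum>a\<leftarrow>map (\<lambda>t. tval t \<rho>) ts. length a)"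
      using pf(3)[of "map (\<lambda>t. tval t \<rho>) ts"] App.prems by simp
    also have "\<dots> \<le> p (\<Sum>i<n. length (\<rho> i))"
      unfolding p_def by (rule monoD[OF pf(1)])
        (auto simp: sum_list_sum_nth atLeast0LessThan intro!: sum_mono P(3))
    finally show ?thesis .
  qed
  ultimately show ?case by blast
qed


subsection \<open>Definable functions\<close>

text \<open>Definability is stated for functions of a whole environment, which makes substitution a
  composition and spares the counting of arguments. A term still looks at finitely many variables
  only.\<close>

definition pvd :: "(env \<Rightarrow> str) \<Rightarrow> bool" where
  "pvd F \<longleftrightarrow> (\<exists>t. is_pv_term t \<and> (\<forall>\<rho>. F \<rho> = tval t \<rho>))"

lemma pvd_tval: "is_pv_term t \<Longrightarrow> pvd (tval t)"
  unfolding pvd_def by auto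

lemma pvd_var: "pvd (\<lambda>\<rho>. \<rho> i)"
  unfolding pvd_def by (rule exI[of _ "Var i"]) auto

lemma pvd_subst:
  assumes "pvd F" "\<And>i. pvd (\<lambda>\<rho>. G \<rho> i)"
  shows "pvd (\<lambda>\<rho>. F (G \<rho>))"
proof -
  from assms(1) obtain t where t: "is_pv_term t" "\<And>\<rho>. F \<rho> = tval t \<rho>" unfolding pvd_def by auto
  from assms(2) obtain \<sigma> where \<sigma>: "\<And>i. is_pv_term (\<sigma> i)" "\<And>i \<rho>. G \<rho> i = tval (\<sigma> i) \<rho>"
    unfolding pvd_def by metis
  have "F (G \<rho>) = tval (tm_subst \<sigma> t) \<rho>" for \<rho>
  proof -
    have "G \<rho> = (\<lambda>i. tval (\<sigma> i) \<rho>)" by (rule ext) (rule \<sigma>(2))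
    then show ?thesis by (simp add: t tval_subst)
  qed
  moreover have "is_pv_term (tm_subst \<sigma> t)" using t \<sigma> by (simp add: is_pv_term_subst)
  ultimately show ?thesis unfolding pvd_def by blast
qed

lemma pvd_App:
  assumes "is_pv_fun f" "length Fs = arity f" "\<forall>F\<in>set Fs. pvd F"
  shows "pvd (\<lambda>\<rho>. fval f (map (\<lambda>F. F \<rho>) Fs))"
proof -
  from assms(3) obtain T where T: "\<And>F. F \<in> set Fs \<Longrightarrow> is_pv_term (T F)"
    "\<And>F \<rho>. F \<in> set Fs \<Longrightarrow> F \<rho> = tval (T F) \<rho>" unfolding pvd_def by metis
  have "fval f (map (\<lambda>F. F \<rho>) Fs) = tval (App f (map T Fs)) \<rho>" for \<rho>
  proof -
    have "map (\<lambda>F. F \<rho>) Fs = map (\<lambda>t. tval t \<rho>) (map T Fs)" using T(2) by simp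
    then show ?thesis by (simp only: tval.simps)
  qed
  moreover have "is_pv_term (App f (map T Fs))" using assms T(1) by simp
  ultimately show ?thesis unfolding pvd_def by blast
qed

lemma pvd_App1: "is_pv_fun f \<Longrightarrow> arity f = 1 \<Longrightarrow> pvd A \<Longrightarrow> pvd (\<lambda>\<rho>. fval f [A \<rho>])"
  and pvd_App2: "is_pv_fun f \<Longrightarrow> arity f = 2 \<Longrightarrow> pvd A \<Longrightarrow> pvd B \<Longrightarrow> pvd (\<lambda>\<rho>. fval f [A \<rho>, B \<rho>])"
  and pvd_App3: "is_pv_fun f \<Longrightarrow> arity f = 3 \<Longrightarrow> pvd A \<Longrightarrow> pvd B \<Longrightarrow> pvd C \<Longrightarrow>
    pvd (\<lambda>\<rho>. fval f [A \<rho>, B \<rho>, C \<rho>])"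
  using pvd_App[of f "[A]"] pvd_App[of f "[A, B]"] pvd_App[of f "[A, B, C]"] by auto

lemma pvd_Cons: "pvd A \<Longrightarrow> pvd (\<lambda>\<rho>. d # A \<rho>)"
  using pvd_App1[of S1 A] pvd_App1[of S2 A] by (cases d) auto

lemma pvd_const: "pvd (\<lambda>\<rho>. c)"
proof (induction c)
  case Nil
  show ?case using pvd_App[of Zero "[]"] by simp
qed (rule pvd_Cons)

lemma pvd_append: "pvd A \<Longrightarrow> pvd B \<Longrightarrow> pvd (\<lambda>\<rho>. A \<rho> @ B \<rho>)"
  using pvd_App2[of Cat B A] by simp


lemma pvd_drop: "pvd A \<Longrightarrow> pvd B \<Longrightarrow> pvd (\<lambda>\<rho>. drop (length (B \<rho>)) (A \<rho>))"
  using pvd_App2[of Less A B] by simp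

lemma pvd_ones: "pvd A \<Longrightarrow> pvd (\<lambda>\<rho>. replicate (length (A \<rho>)) True)"
  using pvd_App1[of ones_fun A] by simp

lemma pvd_bounded:
  assumes "pvd F"
  shows "\<exists>N p. mono p \<and> pb p \<and> (\<forall>\<rho>. length (F \<rho>) \<le> p (\<Sum>i<N. length (\<rho> i)))"
proof -
  from assms obtain t where t: "is_pv_term t" "\<And>\<rho>. F \<rho> = tval t \<rho>" unfolding pvd_def by auto
  obtain N where "tm_below N t" using ex_tm_below by blast
  with length_bound(2)[OF t(1) this] show ?thesis unfolding t(2) by blast
qed

text \<open>Such a number can serve as an iteration count, since recursion on notation makes as many
  steps as its argument has digits.\<close>

definition lenb :: "(env \<Rightarrow> nat) \<Rightarrow> bool" where
  "lenb f \<longleftrightarrow> (\<exists>L. pvd L \<and> (\<forall>\<rho>. f \<rho> \<le> length (L \<rho>)))"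

lemma lenb_mono: "lenb g \<Longrightarrow> (\<And>\<rho>. f \<rho> \<le> g \<rho>) \<Longrightarrow> lenb f"
  unfolding lenb_def by (meson order_trans)

lemma lenb_length: "pvd F \<Longrightarrow> lenb (\<lambda>\<rho>. length (F \<rho>))"
  unfolding lenb_def by blast

lemma lenb_const: "lenb (\<lambda>\<rho>. c)"
  using lenb_length[OF pvd_const[of "replicate c True"]] by simp

lemma lenb_add: "lenb f \<Longrightarrow> lenb g \<Longrightarrow> lenb (\<lambda>\<rho>. f \<rho> + g \<rho>)"
proof -
  assume "lenb f" "lenb g"
  then obtain L M where LM: "pvd L" "pvd M" "\<And>\<rho>. f \<rho> \<le> length (L \<rho>)" "\<And>\<rho>. g \<rho> \<le> length (M \<rho>)"
    unfolding lenb_def by blast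
  show ?thesis unfolding lenb_def
    by (rule exI[of _ "\<lambda>\<rho>. L \<rho> @ M \<rho>"]) (use LM in \<open>auto intro: pvd_append add_mono\<close>)
qed

lemma lenb_mult: "lenb f \<Longrightarrow> lenb g \<Longrightarrow> lenb (\<lambda>\<rho>. f \<rho> * g \<rho>)"
proof -
  assume "lenb f" "lenb g"
  then obtain L M where LM: "pvd L" "pvd M" "\<And>\<rho>. f \<rho> \<le> length (L \<rho>)" "\<And>\<rho>. g \<rho> \<le> length (M \<rho>)"
    unfolding lenb_def by blast
  have "pvd (\<lambda>\<rho>. fval Smash [L \<rho>, M \<rho>])" using LM by (intro pvd_App2) auto
  moreover have "f \<rho> * g \<rho> \<le> length (fval Smash [L \<rho>, M \<rho>])" for \<rho>
    using LM by (simp add: length_concat_map_const mult_mono)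
  ultimately show ?thesis unfolding lenb_def by blast
qed

lemma lenb_power: "lenb f \<Longrightarrow> lenb (\<lambda>\<rho>. f \<rho> ^ j)"
  by (induction j) (auto intro: lenb_const lenb_mult)

lemma lenb_sum: "(\<And>i. i \<in> I \<Longrightarrow> lenb (f i)) \<Longrightarrow> lenb (\<lambda>\<rho>. \<Sum>i\<in>I. f i \<rho>)"
  by (induction I rule: infinite_finite_induct) (auto intro: lenb_const lenb_add)

lemma lenb_pb: "lenb f \<Longrightarrow> pb p \<Longrightarrow> lenb (\<lambda>\<rho>. p (f \<rho>))"
proof -
  assume f: "lenb f" "pb p"
  then obtain K where p: "\<And>n. p n \<le> (K + n) ^ K" unfolding pb_def by blast
  have "lenb (\<lambda>\<rho>. (K + f \<rho>) ^ K)" using f by (intro lenb_power lenb_add lenb_const)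
  then show ?thesis by (rule lenb_mono) (rule p)
qed

text \<open>The length of a PV function need not be monotone in the lengths of its arguments. The
  maximum over all environments within the given lengths is, and it exists because the polynomial
  bound of \<open>F\<close> caps the set.\<close>

lemma lenb_subst:
  assumes "pvd F" "\<And>i. lenb (g i)"
  shows "lenb (\<lambda>\<rho>. Max {length (F \<rho>') | \<rho>'. \<forall>i. length (\<rho>' i) \<le> g i \<rho>})"
    and "(\<And>i. length (\<rho>' i) \<le> g i \<rho>) \<Longrightarrow>
      length (F \<rho>') \<le> Max {length (F \<rho>') | \<rho>'. \<forall>i. length (\<rho>' i) \<le> g i \<rho>}"
proof -
  obtain N p where p: "mono p" "pb p" "\<And>\<rho>. length (F \<rho>) \<le> p (\<Sum>i<N. length (\<rho> i))"
    using pvd_bounded[OF assms(1)] by blast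
  let ?S = "\<lambda>\<rho>. {length (F \<rho>') | \<rho>'. \<forall>i. length (\<rho>' i) \<le> g i \<rho>}"
  have bound: "s \<le> p (\<Sum>i<N. g i \<rho>)" if "s \<in> ?S \<rho>" for s \<rho>
  proof -
    from that obtain \<rho>' where "s = length (F \<rho>')" "\<forall>i. length (\<rho>' i) \<le> g i \<rho>" by blast
    moreover from this have "p (\<Sum>i<N. length (\<rho>' i)) \<le> p (\<Sum>i<N. g i \<rho>)"
      by (intro monoD[OF p(1)] sum_mono) auto
    ultimately show ?thesis using p(3)[of \<rho>'] by simp
  qed
  then have fin: "finite (?S \<rho>)" for \<rho> by (meson finite_nat_set_iff_bounded_le)
  have "length (F (\<lambda>_. [])) \<in> ?S \<rho>" for \<rho> by auto
  then have ne: "?S \<rho> \<noteq> {}" for \<rho> by blast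
  have Max: "Max (?S \<rho>) \<le> p (\<Sum>i<N. g i \<rho>)" for \<rho>
    by (rule Max.boundedI[OF fin ne bound])
  have "lenb (\<lambda>\<rho>. p (\<Sum>i<N. g i \<rho>))" by (rule lenb_pb[OF lenb_sum[OF assms(2)] p(2)])
  then show "lenb (\<lambda>\<rho>. Max (?S \<rho>))" by (rule lenb_mono) (rule Max)
  show "length (F \<rho>') \<le> Max (?S \<rho>)" if "\<And>i. length (\<rho>' i) \<le> g i \<rho>"
    by (rule Max_ge[OF fin]) (use that in auto)
qed

text \<open>The counterpart of \<open>fval_lrec\<close> for environments. In \<open>H1\<close> and
  \<open>H2\<close> the recursive value is variable 0, the recursion variable is variable 1, and the
  parameters are shifted by two.\<close>

lemma pvd_rec:
  assumes "pvd G" "pvd H1" "pvd H2" "pvd B"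
    and R: "\<And>\<rho>. R \<rho> [] = G \<rho>"
      "\<And>\<rho> d y. R \<rho> (d # y) = (if d then H1 else H2) (case_nat (R \<rho> y) (case_nat y \<rho>))"
    and bound: "lenb l" "\<And>\<rho> d y. length (R \<rho> (d # y)) \<le> l (case_nat y \<rho>)"
  shows "pvd (\<lambda>\<rho>. R \<rho> (B \<rho>))"
proof -
  obtain g where g: "is_pv_term g" "\<And>\<rho>. G \<rho> = tval g \<rho>" using assms(1) unfolding pvd_def by auto
  obtain h1 where h1: "is_pv_term h1" "\<And>\<rho>. H1 \<rho> = tval h1 \<rho>" using assms(2) unfolding pvd_def by auto
  obtain h2 where h2: "is_pv_term h2" "\<And>\<rho>. H2 \<rho> = tval h2 \<rho>" using assms(3) unfolding pvd_def by auto
  obtain L where L: "pvd L" "\<And>\<rho>. l \<rho> \<le> length (L \<rho>)" using bound(1) unfolding lenb_def by auto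
  obtain lt where lt: "is_pv_term lt" "\<And>\<rho>. L \<rho> = tval lt \<rho>" using L(1) unfolding pvd_def by auto
  obtain b where b: "is_pv_term b" "\<And>\<rho>. B \<rho> = tval b \<rho>" using assms(4) unfolding pvd_def by auto
  obtain ng nh1 nh2 nl where "tm_below ng g" "tm_below nh1 h1" "tm_below nh2 h2" "tm_below nl lt"
    using ex_tm_below by meson
  then have N: "tm_below N g" "tm_below N h1" "tm_below N h2" "tm_below N lt"
    if "N = ng + nh1 + nh2 + nl" for N
    using that by (auto elim!: tm_below_mono)
  then obtain N where N: "tm_below N g" "tm_below N h1" "tm_below N h2" "tm_below N lt" by blast
  \<comment> \<open>\<open>Rec\<close> takes the parameters first and the recursion variable and
    recursive value last, whereas the environments of \<open>H1\<close> and \<open>H2\<close> have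
    these two in front. All variables that occur are below \<open>N\<close>.\<close>
  define \<sigma> where "\<sigma> = case_nat (Var (N + 1)) (case_nat (Var N) Var)"
  define \<tau> where "\<tau> = case_nat (Var N) Var"
  define f where "f = lrec N g (tm_subst \<sigma> h1) (tm_subst \<sigma> h2) (tm_subst \<tau> lt)"
  have below: "tm_below (N + 2) (tm_subst \<sigma> h1)" "tm_below (N + 2) (tm_subst \<sigma> h2)"
    "tm_below (N + 1) (tm_subst \<tau> lt)"
    using N by (auto intro!: tm_below_subst simp: \<sigma>_def \<tau>_def split: nat.split)
  have \<sigma>: "is_pv_term (\<sigma> i)" "is_pv_term (\<tau> i)" for i
    by (auto simp: \<sigma>_def \<tau>_def split: nat.split)
  have f: "is_pv_fun f" "arity f = N + 1"
    unfolding f_def by (rule is_pv_fun_lrec) (use below g h1 h2 lt N \<sigma> in \<open>auto intro: is_pv_term_subst\<close>)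
  have fval: "fval f (map \<rho> [0..<N] @ [y]) = R \<rho> y" for \<rho> y
    unfolding f_def
  proof (rule fval_lrec)
    show "length (map \<rho> [0..<N]) = N" by simp
    show "tm_below (N + 1) (tm_subst \<tau> lt)" by fact
    have "tval g ((!) (map \<rho> [0..<N])) = tval g \<rho>" by (rule tval_cong[OF N(1)]) auto
    then show "R \<rho> [] = tval g ((!) (map \<rho> [0..<N]))" by (simp add: R g)
  next
    fix d y
    have "tval (tm_subst \<sigma> h) (\<lambda>i. (map \<rho> [0..<N] @ [y, R \<rho> y]) ! i) =
        tval h (case_nat (R \<rho> y) (case_nat y \<rho>))" if "tm_below N h" for h
      unfolding tval_subst
      by (rule tval_cong[OF that]) (auto simp: \<sigma>_def nth_append split: nat.split)
    then show "R \<rho> (d # y) = tval (if d then tm_subst \<sigma> h1 else tm_subst \<sigma> h2)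
        (\<lambda>i. (map \<rho> [0..<N] @ [y, R \<rho> y]) ! i)"
      using N by (simp add: R h1 h2)
    have "tval (tm_subst \<tau> lt) (\<lambda>i. (map \<rho> [0..<N] @ [y]) ! i) = tval lt (case_nat y \<rho>)"
      unfolding tval_subst
      by (rule tval_cong[OF N(4)]) (auto simp: \<tau>_def nth_append split: nat.split)
    then show "length (R \<rho> (d # y)) \<le>
        length (tval (tm_subst \<tau> lt) (\<lambda>i. (map \<rho> [0..<N] @ [y]) ! i))"
      using order_trans[OF bound(2) L(2)] by (simp add: lt)
  qed
  show ?thesis unfolding pvd_def
  proof (intro exI conjI allI)
    show "is_pv_term (App f (vars N @ [b]))"
      using f b by (auto simp: is_pv_term_vars)
    show "R \<rho> (B \<rho>) = tval (App f (vars N @ [b])) \<rho>" for \<rho>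
      by (simp add: fval b)
  qed
qed

subsection \<open>Definable predicates and numbers\<close>

definition pvp :: "(env \<Rightarrow> bool) \<Rightarrow> bool" where
  "pvp P \<longleftrightarrow> pvd (\<lambda>\<rho>. bv (P \<rho>))"

definition pvn :: "(env \<Rightarrow> nat) \<Rightarrow> bool" where
  "pvn N \<longleftrightarrow> pvd (\<lambda>\<rho>. num (N \<rho>))"

lemma pvd_if:
  assumes "pvp P" "pvd A" "pvd B"
  shows "pvd (\<lambda>\<rho>. if P \<rho> then A \<rho> else B \<rho>)"
  using pvd_App3[of ite_fun A B "\<lambda>\<rho>. bv (P \<rho>)"] assms by (simp add: pvp_def)

lemma pvp_const: "pvp (\<lambda>\<rho>. c)"
  unfolding pvp_def by (rule pvd_const)

lemma pvp_if: "pvp P \<Longrightarrow> pvp Q \<Longrightarrow> pvp R \<Longrightarrow> pvp (\<lambda>\<rho>. if P \<rho> then Q \<rho> else R \<rho>)"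
  using pvd_if[of P "\<lambda>\<rho>. bv (Q \<rho>)" "\<lambda>\<rho>. bv (R \<rho>)"] unfolding pvp_def by (simp add: if_distrib[of bv])

lemma pvp_not:
  assumes "pvp P"
  shows "pvp (\<lambda>\<rho>. \<not> P \<rho>)"
proof -
  have "(\<lambda>\<rho>. \<not> P \<rho>) = (\<lambda>\<rho>. if P \<rho> then False else True)" by auto
  then show ?thesis using pvp_if[OF assms pvp_const pvp_const] by (simp only:)
qed

lemma pvp_conj:
  assumes "pvp P" "pvp Q"
  shows "pvp (\<lambda>\<rho>. P \<rho> \<and> Q \<rho>)"
proof -
  have "(\<lambda>\<rho>. P \<rho> \<and> Q \<rho>) = (\<lambda>\<rho>. if P \<rho> then Q \<rho> else False)" by auto
  then show ?thesis using pvp_if[OF assms pvp_const] by (simp only:)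
qed

lemma pvp_disj:
  assumes "pvp P" "pvp Q"
  shows "pvp (\<lambda>\<rho>. P \<rho> \<or> Q \<rho>)"
proof -
  have "(\<lambda>\<rho>. P \<rho> \<or> Q \<rho>) = (\<lambda>\<rho>. if P \<rho> then True else Q \<rho>)" by auto
  then show ?thesis using pvp_if[OF assms(1) pvp_const assms(2)] by (simp only:)
qed

lemma pvp_imp:
  assumes "pvp P" "pvp Q"
  shows "pvp (\<lambda>\<rho>. P \<rho> \<longrightarrow> Q \<rho>)"
  unfolding imp_conv_disj by (intro pvp_disj pvp_not assms)

lemma pvd_num: "pvn N \<Longrightarrow> pvd (\<lambda>\<rho>. num (N \<rho>))"
  by (simp add: pvn_def)

lemma pvn_val: "pvd A \<Longrightarrow> pvn (\<lambda>\<rho>. val (A \<rho>))"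
  by (simp add: pvn_def)

lemma pvn_const: "pvn (\<lambda>\<rho>. c)"
  unfolding pvn_def by (rule pvd_const)

lemma pvn_Suc: "pvn N \<Longrightarrow> pvn (\<lambda>\<rho>. Suc (N \<rho>))"
  unfolding pvn_def using pvd_App1[of succ_fun "\<lambda>\<rho>. num (N \<rho>)"] by simp

lemma pvn_length: "pvd A \<Longrightarrow> pvn (\<lambda>\<rho>. length (A \<rho>))"
  unfolding pvn_def using pvd_App1[of len_fun A] by simp

lemma pvn_cnt: "pvd A \<Longrightarrow> pvn (\<lambda>\<rho>. cnt (A \<rho>))"
  unfolding pvn_def using pvd_App1[of count_fun A] by simp

lemma pvp_le: "pvn M \<Longrightarrow> pvn N \<Longrightarrow> pvp (\<lambda>\<rho>. M \<rho> \<le> N \<rho>)"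
  unfolding pvn_def pvp_def using pvd_App2[of le_fun "\<lambda>\<rho>. num (M \<rho>)" "\<lambda>\<rho>. num (N \<rho>)"]
  by simp

lemma pvp_less: "pvn M \<Longrightarrow> pvn N \<Longrightarrow> pvp (\<lambda>\<rho>. M \<rho> < N \<rho>)"
  using pvp_not[OF pvp_le[of N M]] by (simp add: not_le)

lemma pvp_eq_nat: "pvn M \<Longrightarrow> pvn N \<Longrightarrow> pvp (\<lambda>\<rho>. M \<rho> = N \<rho>)"
  using pvp_conj[OF pvp_le[of M N] pvp_le[of N M]] by (simp add: eq_iff)

lemma inj_val: "inj val"
  by (rule injI) (rule val_inj)

lemma pvp_eq: "pvd A \<Longrightarrow> pvd B \<Longrightarrow> pvp (\<lambda>\<rho>. A \<rho> = B \<rho>)"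
  using pvp_eq_nat[OF pvn_val[of A] pvn_val[of B]] by (simp add: inj_eq[OF inj_val])

lemma pvp_tru: "pvd A \<Longrightarrow> pvp (\<lambda>\<rho>. tru (A \<rho>))"
  unfolding pvp_def using pvd_App3[of ite_fun "\<lambda>_. [True]" "\<lambda>_. []" A]
  by (simp add: bv_def pvd_const)

lemma pvd_el: "pvd A \<Longrightarrow> pvn N \<Longrightarrow> pvd (\<lambda>\<rho>. el (A \<rho>) (N \<rho>))"
  unfolding pvn_def using pvd_App2[of elt_fun "\<lambda>\<rho>. num (N \<rho>)" A] by simp

lemma pvp_digit: "pvd A \<Longrightarrow> pvn N \<Longrightarrow> pvp (\<lambda>\<rho>. N \<rho> < length (A \<rho>) \<and> rev (A \<rho>) ! N \<rho>)"
proof -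
  assume "pvd A" "pvn N"
  then have "pvp (\<lambda>\<rho>. tru (fval digit_fun [num (N \<rho>), A \<rho>]))"
    by (intro pvp_tru pvd_App2) (auto simp: pvn_def)
  moreover have "tru (fval digit_fun [num (N \<rho>), A \<rho>]) \<longleftrightarrow> N \<rho> < length (A \<rho>) \<and> rev (A \<rho>) ! N \<rho>" for \<rho>
    by simp
  ultimately show ?thesis by simp
qed

lemma pvd_dbl:
  assumes "pvd A"
  shows "pvd (\<lambda>\<rho>. dbl (A \<rho>))"
proof (rule pvd_rec[where R = "\<lambda>\<rho>. dbl"])
  show "pvd (\<lambda>\<rho>. [])" "pvd (\<lambda>\<rho>. True # True # \<rho> 0)" "pvd (\<lambda>\<rho>. False # True # \<rho> 0)"
    by (intro pvd_Cons pvd_var pvd_const)+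
  show "lenb (\<lambda>\<rho>. 2 * length (\<rho> 0) + 2)"
    by (intro lenb_add lenb_mult lenb_const lenb_length pvd_var)
qed (use assms in auto)

lemma pvd_blk: "pvd A \<Longrightarrow> pvd (\<lambda>\<rho>. blk (A \<rho>))"
  unfolding blk_def by (intro pvd_Cons pvd_dbl)

lemma pvd_code:
  shows "pvd A \<Longrightarrow> pvd (\<lambda>\<rho>. code [A \<rho>])"
    and "pvd A \<Longrightarrow> pvd B \<Longrightarrow> pvd (\<lambda>\<rho>. code [A \<rho>, B \<rho>])"
    and "pvd A \<Longrightarrow> pvd B \<Longrightarrow> pvd C \<Longrightarrow> pvd (\<lambda>\<rho>. code [A \<rho>, B \<rho>, C \<rho>])"
  by (auto simp: code_def intro!: pvd_append pvd_blk)


lemma pvd_replicate_power: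
  assumes "pvd A"
  shows "pvd (\<lambda>\<rho>. replicate (length (A \<rho>) ^ j) True)"
proof (induction j)
  case 0
  show ?case by (simp add: pvd_const)
next
  case (Suc j)
  have "pvd (\<lambda>\<rho>. replicate (length (fval Smash [A \<rho>, replicate (length (A \<rho>) ^ j) True])) True)"
    by (intro pvd_ones pvd_App2 Suc assms) auto
  moreover have "length (fval Smash [A \<rho>, replicate (length (A \<rho>) ^ j) True]) = length (A \<rho>) ^ Suc j"
    for \<rho> by (simp add: length_concat sum_list_replicate)
  ultimately show ?case by (simp del: fval.simps)
qed

text \<open>Blocks of ones end no element, so that padding does not affect the sequence.\<close>

definition pad :: "nat \<Rightarrow> str \<Rightarrow> str" where "pad n s = replicate (n - length s) True @ s"

lemma length_pad [simp]: "length s \<le> n \<Longrightarrow> length (pad n s) = n"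
  by (simp add: pad_def)

lemma el_pad [simp]: "j < cnt s \<Longrightarrow> el (pad n s) j = el s j"
  by (simp add: pad_def el_append)

lemma pvd_pad: "pvd A \<Longrightarrow> pvd B \<Longrightarrow> pvd (\<lambda>\<rho>. pad (length (B \<rho>)) (A \<rho>))"
proof -
  assume "pvd A" "pvd B"
  then have "pvd (\<lambda>\<rho>. replicate (length (drop (length (A \<rho>)) (B \<rho>))) True @ A \<rho>)"
    by (intro pvd_append pvd_ones pvd_drop)
  then show ?thesis by (simp add: pad_def)
qed


subsection \<open>Bounded search and sequence comprehension\<close>

text \<open>The search runs downwards and returns 0 also when it fails, so its result has to be
  tested again, as in \<open>ex_less_iff_srch\<close>.\<close>

primrec srch :: "(nat \<Rightarrow> bool) \<Rightarrow> nat \<Rightarrow> nat" where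
  "srch P 0 = 0"
| "srch P (Suc n) = (if P n then n else srch P n)"

lemma srch_le: "srch P n \<le> n"
  by (induction n) auto

lemma srchI: "P l \<Longrightarrow> l < n \<Longrightarrow> P (srch P n) \<and> srch P n < n"
  by (induction n) (auto simp: less_Suc_eq)

lemma ex_less_iff_srch: "(\<exists>l<n. P l) \<longleftrightarrow> srch P n < n \<and> P (srch P n)"
  using srchI by blast

lemma lenb_Suc: "lenb f \<Longrightarrow> lenb (\<lambda>\<rho>. Suc (f \<rho>))"
  using lenb_add[of f "\<lambda>_. 1"] by (simp add: lenb_const)

lemma pvd_shift:
  assumes "pvd (\<lambda>\<rho>. F (\<lambda>i. \<rho> (Suc i)) (\<rho> 0))" "pvd A" "\<And>i. pvd (\<lambda>\<rho>. G \<rho> i)"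
  shows "pvd (\<lambda>\<rho>. F (G \<rho>) (A \<rho>))"
proof -
  have "pvd (\<lambda>\<rho>. case_nat (A \<rho>) (G \<rho>) i)" for i
    using assms(2,3) by (cases i) auto
  from pvd_subst[OF assms(1), of "\<lambda>\<rho>. case_nat (A \<rho>) (G \<rho>)", OF this] show ?thesis by simp
qed

lemma pvd_shift_nat:
  assumes "pvd (\<lambda>\<rho>. F (\<lambda>i. \<rho> (Suc i)) (val (\<rho> 0)))" "pvn N"
  shows "pvd (\<lambda>\<rho>. F \<rho> (N \<rho>))"
  using pvd_shift[of "\<lambda>\<rho> x. F \<rho> (val x)" "\<lambda>\<rho>. num (N \<rho>)" "\<lambda>\<rho>. \<rho>"] assms pvd_var
  by (simp add: pvn_def)

lemma pvd_shift2:
  assumes "pvd (\<lambda>\<rho>. F (\<lambda>i. \<rho> (Suc i)) (val (\<rho> 0)))" "pvn N"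
  shows "pvd (\<lambda>\<rho>. F (\<lambda>i. \<rho> (Suc (Suc i))) (N \<rho>))"
  using pvd_shift[of "\<lambda>\<rho> x. F \<rho> (val x)" "\<lambda>\<rho>. num (N \<rho>)" "\<lambda>\<rho> i. \<rho> (Suc (Suc i))"] assms pvd_var
  by (simp add: pvn_def)

lemma pvp_shift_nat:
  assumes "pvp (\<lambda>\<rho>. P (\<lambda>i. \<rho> (Suc i)) (val (\<rho> 0)))" "pvn N"
  shows "pvp (\<lambda>\<rho>. P \<rho> (N \<rho>))"
  using assms pvd_shift_nat[of "\<lambda>\<rho> n. bv (P \<rho> n)"] by (simp add: pvp_def)

lemma pvp_subst:
  assumes "pvp P" "\<And>i. pvd (\<lambda>\<rho>. G \<rho> i)"
  shows "pvp (\<lambda>\<rho>. P (G \<rho>))"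
  using pvd_subst[of "\<lambda>\<rho>. bv (P \<rho>)" G] assms by (simp add: pvp_def)

lemma pvd_case_nat:
  "pvd A \<Longrightarrow> (\<And>i. pvd (\<lambda>\<rho>. G \<rho> i)) \<Longrightarrow> pvd (\<lambda>\<rho>. case_nat (A \<rho>) (G \<rho>) i)"
  by (cases i) auto

text \<open>Recursion on notation on a sufficiently long string \<open>B\<close>, whose length
  serves as the counter of the search. The minimum lets the recursion idle after \<open>N\<close>
  steps.\<close>

lemma pvn_srch:
  assumes "pvp (\<lambda>\<rho>. P (\<lambda>i. \<rho> (Suc i)) (val (\<rho> 0)))" "pvn N" "lenb N"
  shows "pvn (\<lambda>\<rho>. srch (P \<rho>) (N \<rho>))"
proof -
  obtain B where B: "pvd B" "\<And>\<rho>. N \<rho> \<le> length (B \<rho>)" using assms(3) unfolding lenb_def by auto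
  define H where "H \<rho> = (if length (\<rho> 1) < N (\<lambda>i. \<rho> (Suc (Suc i))) \<and>
    P (\<lambda>i. \<rho> (Suc (Suc i))) (length (\<rho> 1)) then num (length (\<rho> 1)) else \<rho> 0)" for \<rho>
  have "pvd (\<lambda>\<rho>. bv (P (\<lambda>i. \<rho> (Suc (Suc i))) (length (\<rho> 1))))"
    by (rule pvd_shift2[of "\<lambda>\<rho> n. bv (P \<rho> n)"])
      (use assms in \<open>auto simp: pvp_def intro: pvn_length pvd_var\<close>)
  moreover have "pvd (\<lambda>\<rho>. num (N (\<lambda>i. \<rho> (Suc (Suc i)))))"
    by (rule pvd_subst) (use assms in \<open>auto simp: pvn_def intro: pvd_var\<close>)
  ultimately have H: "pvd H" unfolding H_def
    by (intro pvd_if pvp_conj pvp_less pvn_length pvd_var pvd_num) (auto simp: pvp_def pvn_def)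
  have "pvd (\<lambda>\<rho>. num (srch (P \<rho>) (min (N \<rho>) (length (B \<rho>)))))"
  proof (rule pvd_rec[where R = "\<lambda>\<rho> y. num (srch (P \<rho>) (min (N \<rho>) (length y)))" and G = "\<lambda>\<rho>. []" and ?H1.0 = H and ?H2.0 = H and l = "\<lambda>\<rho>. Suc (length (\<rho> 0))"])
    show "lenb (\<lambda>\<rho>. Suc (length (\<rho> 0)))" by (intro lenb_Suc lenb_length pvd_var)
    show "length (num (srch (P \<rho>) (min (N \<rho>) (length (d # y))))) \<le> Suc (length (case_nat y \<rho> 0))"
      for \<rho> d y
      using order_trans[OF length_num srch_le, of "P \<rho>" "min (N \<rho>) (length (d # y))"] by simp
    show "num (srch (P \<rho>) (min (N \<rho>) (length (d # y)))) =
        (if d then H else H) (case_nat (num (srch (P \<rho>) (min (N \<rho>) (length y)))) (case_nat y \<rho>))"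
      for \<rho> d y
      by (cases "length y < N \<rho>") (auto simp: H_def min_absorb1 min_absorb2 Suc_le_eq)
  qed (use H B in \<open>auto intro: pvd_const\<close>)
  then show ?thesis using B(2) by (simp add: pvn_def min_absorb1)
qed

lemma pvp_ex:
  assumes "pvp (\<lambda>\<rho>. P (\<lambda>i. \<rho> (Suc i)) (val (\<rho> 0)))" "pvn N" "lenb N"
  shows "pvp (\<lambda>\<rho>. \<exists>l<N \<rho>. P \<rho> l)"
  unfolding ex_less_iff_srch
  by (intro pvp_conj pvp_less pvn_srch pvp_shift_nat[of P] assms)

lemma pvp_all:
  assumes "pvp (\<lambda>\<rho>. P (\<lambda>i. \<rho> (Suc i)) (val (\<rho> 0)))" "pvn N" "lenb N"
  shows "pvp (\<lambda>\<rho>. \<forall>l<N \<rho>. P \<rho> l)"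
  using pvp_not[OF pvp_ex[of "\<lambda>\<rho> l. \<not> P \<rho> l", OF pvp_not]] assms by simp

lemma pvd_digits:
  assumes "pvp (\<lambda>\<rho>. P (\<lambda>i. \<rho> (Suc i)) (val (\<rho> 0)))" "pvn N" "lenb N"
  shows "pvd (\<lambda>\<rho>. rev (map (P \<rho>) [0..<N \<rho>]))"
proof -
  obtain B where B: "pvd B" "\<And>\<rho>. N \<rho> \<le> length (B \<rho>)" using assms(3) unfolding lenb_def by auto
  define H where "H \<rho> = (if length (\<rho> 1) < N (\<lambda>i. \<rho> (Suc (Suc i))) then
    (if P (\<lambda>i. \<rho> (Suc (Suc i))) (length (\<rho> 1)) then True # \<rho> 0 else False # \<rho> 0) else \<rho> 0)" for \<rho>
  have "pvd (\<lambda>\<rho>. bv (P (\<lambda>i. \<rho> (Suc (Suc i))) (length (\<rho> 1))))"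
    by (rule pvd_shift2[of "\<lambda>\<rho> n. bv (P \<rho> n)"])
      (use assms in \<open>auto simp: pvp_def intro: pvn_length pvd_var\<close>)
  moreover have "pvd (\<lambda>\<rho>. num (N (\<lambda>i. \<rho> (Suc (Suc i)))))"
    by (rule pvd_subst) (use assms in \<open>auto simp: pvn_def intro: pvd_var\<close>)
  ultimately have H: "pvd H" unfolding H_def
    by (intro pvd_if pvp_less pvn_length pvd_var pvd_Cons) (auto simp: pvp_def pvn_def)
  have "pvd (\<lambda>\<rho>. rev (map (P \<rho>) [0..<min (N \<rho>) (length (B \<rho>))]))"
  proof (rule pvd_rec[where R = "\<lambda>\<rho> y. rev (map (P \<rho>) [0..<min (N \<rho>) (length y)])" and G = "\<lambda>\<rho>. []" and ?H1.0 = H and ?H2.0 = H and l = "\<lambda>\<rho>. Suc (length (\<rho> 0))"])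
    show "lenb (\<lambda>\<rho>. Suc (length (\<rho> 0)))" by (intro lenb_Suc lenb_length pvd_var)
    show "rev (map (P \<rho>) [0..<min (N \<rho>) (length (d # y))]) =
        (if d then H else H) (case_nat (rev (map (P \<rho>) [0..<min (N \<rho>) (length y)])) (case_nat y \<rho>))"
      for \<rho> d y
      by (cases "length y < N \<rho>") (auto simp: H_def min_absorb1 min_absorb2 Suc_le_eq)
  qed (use H B in \<open>auto intro: pvd_const\<close>)
  then show ?thesis using B(2) by (simp add: min_absorb1)
qed

lemma pvd_code_map:
  assumes "pvd (\<lambda>\<rho>. G (\<lambda>i. \<rho> (Suc i)) (val (\<rho> 0)))" "pvn N" "lenb N"
  shows "pvd (\<lambda>\<rho>. code (map (G \<rho>) [0..<N \<rho>]))"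
proof -
  obtain B where B: "pvd B" "\<And>\<rho>. N \<rho> \<le> length (B \<rho>)" using assms(3) unfolding lenb_def by auto
  define H where "H \<rho> = (if length (\<rho> 1) < N (\<lambda>i. \<rho> (Suc (Suc i))) then
    blk (G (\<lambda>i. \<rho> (Suc (Suc i))) (length (\<rho> 1))) @ \<rho> 0 else \<rho> 0)" for \<rho>
  have G: "pvd (\<lambda>\<rho>. G (\<lambda>i. \<rho> (Suc (Suc i))) (length (\<rho> 1)))"
    by (rule pvd_shift2[OF assms(1)]) (intro pvn_length pvd_var)
  have "pvd (\<lambda>\<rho>. num (N (\<lambda>i. \<rho> (Suc (Suc i)))))"
    by (rule pvd_subst) (use assms in \<open>auto simp: pvn_def intro: pvd_var\<close>)
  then have H: "pvd H" unfolding H_def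
    by (intro pvd_if pvp_less pvn_length pvd_var pvd_append pvd_blk G) (auto simp: pvn_def)
  \<comment> \<open>Bounds \<open>G\<close> at every index up to the length of the recursion
    variable, because a numeral is no longer than the number it denotes.\<close>
  define M where "M \<rho> = Max {length (G (\<lambda>i. \<rho>' (Suc i)) (val (\<rho>' 0))) | \<rho>'.
    \<forall>i. length (\<rho>' i) \<le> length (\<rho> i)}" for \<rho> :: env
  have M: "lenb M" unfolding M_def by (rule lenb_subst(1)[OF assms(1)]) (intro lenb_length pvd_var)
  have GM: "length (G \<rho> l) \<le> M (case_nat y \<rho>)" if "l \<le> length y" for \<rho> l y
  proof -
    have "length (G (\<lambda>i. case_nat (num l) \<rho> (Suc i)) (val (case_nat (num l) \<rho> 0))) \<le> M (case_nat y \<rho>)"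
      unfolding M_def
    proof (rule lenb_subst(2)[OF assms(1), where g = "\<lambda>i \<rho>. length (\<rho> i)"])
      show "length (case_nat (num l) \<rho> i) \<le> length (case_nat y \<rho> i)" for i
        using order_trans[OF length_num that] by (auto split: nat.split)
    qed (intro lenb_length pvd_var)
    then show ?thesis by simp
  qed
  let ?l = "\<lambda>\<rho>. Suc (length (\<rho> 0)) * (2 * M \<rho> + 2)"
  have "pvd (\<lambda>\<rho>. code (map (G \<rho>) [0..<min (N \<rho>) (length (B \<rho>))]))"
  proof (rule pvd_rec[where R = "\<lambda>\<rho> y. code (map (G \<rho>) [0..<min (N \<rho>) (length y)])" and G = "\<lambda>\<rho>. []" and ?H1.0 = H and ?H2.0 = H and l = ?l])
    show "lenb ?l" by (intro lenb_mult lenb_add lenb_Suc lenb_length lenb_const pvd_var M)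
    show "code (map (G \<rho>) [0..<min (N \<rho>) (length (d # y))]) =
        (if d then H else H) (case_nat (code (map (G \<rho>) [0..<min (N \<rho>) (length y)])) (case_nat y \<rho>))"
      for \<rho> d y
      by (cases "length y < N \<rho>") (auto simp: H_def min_absorb1 min_absorb2 Suc_le_eq code_snoc)
    show "length (code (map (G \<rho>) [0..<min (N \<rho>) (length (d # y))])) \<le> ?l (case_nat y \<rho>)" for \<rho> d y
    proof -
      let ?n = "min (N \<rho>) (length (d # y))"
      have "length (code (map (G \<rho>) [0..<?n])) = (\<Sum>i<?n. 2 * length (G \<rho> i) + 2)"
        by (simp add: length_code comp_def sum_list_sum_nth atLeast0LessThan)
      also have "\<dots> \<le> (\<Sum>i<?n. 2 * M (case_nat y \<rho>) + 2)"
        by (intro sum_mono add_mono mult_left_mono GM) auto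
      also have "\<dots> = ?n * (2 * M (case_nat y \<rho>) + 2)" by simp
      also have "\<dots> \<le> ?l (case_nat y \<rho>)" by (intro mult_right_mono) auto
      finally show ?thesis .
    qed
  qed (use H B in \<open>auto intro: pvd_const\<close>)
  then show ?thesis using B(2) by (simp add: min_absorb1)
qed

lemmas lenb_intros = lenb_length lenb_const lenb_Suc lenb_add lenb_mult lenb_power

lemmas pvd_intros = pvd_var pvd_const pvd_Cons pvd_append pvd_if pvp_const pvp_not pvp_conj
  pvp_disj pvp_imp pvp_le pvp_less pvp_eq_nat pvp_eq pvd_num pvn_val pvn_const pvn_Suc pvn_length
  pvn_cnt pvd_el pvd_code pvp_ex pvp_all pvn_srch

section \<open>Models of bounded collection\<close>

text \<open>
  Formulas are interpreted in a set of sequences of strings modulo an ultrafilter: equality holds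
  if it holds almost everywhere.
\<close>

primrec sat :: "nat filter \<Rightarrow> (nat \<Rightarrow> str) set \<Rightarrow> (nat \<Rightarrow> nat \<Rightarrow> str) \<Rightarrow> fm \<Rightarrow> bool" where
  "sat U E x Fls \<longleftrightarrow> False"
| "sat U E x (Eq s t) \<longleftrightarrow> (\<forall>\<^sub>F i in U. tval s (\<lambda>v. x v i) = tval t (\<lambda>v. x v i))"
| "sat U E x (Imp \<phi> \<psi>) \<longleftrightarrow> (sat U E x \<phi> \<longrightarrow> sat U E x \<psi>)"
| "sat U E x (And \<phi> \<psi>) \<longleftrightarrow> sat U E x \<phi> \<and> sat U E x \<psi>"
| "sat U E x (Or \<phi> \<psi>) \<longleftrightarrow> sat U E x \<phi> \<or> sat U E x \<psi>"
| "sat U E x (All \<phi>) \<longleftrightarrow> (\<forall>a\<in>E. sat U E (case_nat a x) \<phi>)"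
| "sat U E x (Ex \<phi>) \<longleftrightarrow> (\<exists>a\<in>E. sat U E (case_nat a x) \<phi>)"

lemma case_nat_apply: "(\<lambda>v. case_nat a x v i) = case_nat (a i) (\<lambda>v. x v i)"
  by (rule ext) (simp split: nat.split)

lemma case_nat_eta: "case_nat (\<rho> 0) (\<lambda>i. \<rho> (Suc i)) = \<rho>"
  by (rule ext) (simp split: nat.split)

lemma sat_subst: "sat U E x (fm_subst \<sigma> \<phi>) \<longleftrightarrow> sat U E (\<lambda>v i. tval (\<sigma> v) (\<lambda>u. x u i)) \<phi>"
proof (induction \<phi> arbitrary: \<sigma> x)
  case (All \<phi>)
  have "(\<lambda>v i. tval (up \<sigma> v) (\<lambda>u. case_nat a x u i)) =
      case_nat a (\<lambda>v i. tval (\<sigma> v) (\<lambda>u. x u i))" for a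
    by (intro ext) (simp add: up_def tval_subst split: nat.split)
  then show ?case by (simp add: All)
next
  case (Ex \<phi>)
  have "(\<lambda>v i. tval (up \<sigma> v) (\<lambda>u. case_nat a x u i)) =
      case_nat a (\<lambda>v i. tval (\<sigma> v) (\<lambda>u. x u i))" for a
    by (intro ext) (simp add: up_def tval_subst split: nat.split)
  then show ?case by (simp add: Ex)
qed (simp_all add: tval_subst)

lemma sat_lift: "sat U E (case_nat a x) (lift_fm \<phi>) \<longleftrightarrow> sat U E x \<phi>"
  by (simp add: sat_subst)

lemma sat_inst:
  "sat U E x (inst \<phi> t) \<longleftrightarrow> sat U E (case_nat (\<lambda>i. tval t (\<lambda>u. x u i)) x) \<phi>"
proof -
  have "(\<lambda>v i. tval (case_nat t Var v) (\<lambda>u. x u i)) = case_nat (\<lambda>i. tval t (\<lambda>u. x u i)) x"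
    by (intro ext) (simp split: nat.split)
  then show ?thesis by (simp add: inst_def sat_subst)
qed

lemma sat_cong:
  "\<forall>\<^sub>F i in U. \<forall>v. x v i = y v i \<Longrightarrow> sat U E x \<phi> \<longleftrightarrow> sat U E y \<phi>"
proof (induction \<phi> arbitrary: x y)
  case (Eq s t)
  have *: "\<forall>\<^sub>F i in U. (\<lambda>v. x v i) = (\<lambda>v. y v i)"
    using Eq by (rule eventually_mono) auto
  show ?case by (simp, rule eventually_cong[OF *]) simp
next
  case (All \<phi>)
  have "\<forall>\<^sub>F i in U. \<forall>v. case_nat a x v i = case_nat a y v i" for a
    using All.prems by (rule eventually_mono) (simp split: nat.split)
  then show ?case using All.IH by fastforce
next
  case (Ex \<phi>)
  have "\<forall>\<^sub>F i in U. \<forall>v. case_nat a x v i = case_nat a y v i" for a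
    using Ex.prems by (rule eventually_mono) (simp split: nat.split)
  then show ?case using Ex.IH by fastforce
qed auto


text \<open>\<open>E\<close> may be much smaller than the full ultrapower, so quantifiers need not
  reduce to single coordinates. \<open>collection\<close> passes from witnesses for the bounded
  indices in \<open>E\<close> to one sequence that works for all indices in almost every coordinate.
  It is asked of PV predicates only; the bound on the witness is left out.\<close>

locale bb_model =
  fixes U :: "nat filter" and E :: "(nat \<Rightarrow> str) set"
  assumes ultra: "(\<forall>\<^sub>F i in U. \<not> A i) \<longleftrightarrow> \<not> (\<forall>\<^sub>F i in U. A i)"
    and closed: "pvd F \<Longrightarrow> (\<And>v. x v \<in> E) \<Longrightarrow> (\<lambda>i. F (\<lambda>v. x v i)) \<in> E"
    and collection: "\<lbrakk>pvp P; pvd B; \<And>v. x v \<in> E;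
      \<And>j. j \<in> E \<Longrightarrow> \<forall>\<^sub>F i in U. val (j i) \<le> length (B (\<lambda>v. x v i)) \<Longrightarrow>
        \<exists>z\<in>E. \<forall>\<^sub>F i in U. P (case_nat (z i) (case_nat (j i) (\<lambda>v. x v i)))\<rbrakk> \<Longrightarrow>
      \<exists>w\<in>E. \<forall>\<^sub>F i in U. \<forall>j\<le>length (B (\<lambda>v. x v i)).
        P (case_nat (el (w i) j) (case_nat (num j) (\<lambda>v. x v i)))"
begin

abbreviation sats :: "(nat \<Rightarrow> nat \<Rightarrow> str) \<Rightarrow> fm \<Rightarrow> bool" where "sats \<equiv> sat U E"

section \<open>Soundness of natural deduction in the model\<close>

lemma ev_imp: "((\<forall>\<^sub>F i in U. P i) \<longrightarrow> (\<forall>\<^sub>F i in U. Q i)) \<longleftrightarrow> (\<forall>\<^sub>F i in U. P i \<longrightarrow> Q i)"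
proof
  assume "\<forall>\<^sub>F i in U. P i \<longrightarrow> Q i"
  then show "(\<forall>\<^sub>F i in U. P i) \<longrightarrow> (\<forall>\<^sub>F i in U. Q i)" by (auto elim: eventually_elim2)
next
  assume "(\<forall>\<^sub>F i in U. P i) \<longrightarrow> (\<forall>\<^sub>F i in U. Q i)"
  then consider "\<forall>\<^sub>F i in U. \<not> P i" | "\<forall>\<^sub>F i in U. Q i" using ultra[of P] by blast
  then show "\<forall>\<^sub>F i in U. P i \<longrightarrow> Q i" by cases (auto elim: eventually_mono)
qed

lemma ev_disj: "(\<forall>\<^sub>F i in U. P i) \<or> (\<forall>\<^sub>F i in U. Q i) \<longleftrightarrow> (\<forall>\<^sub>F i in U. P i \<or> Q i)"
  using ev_imp[of "\<lambda>i. \<not> P i" Q] ultra[of P] by (auto simp: imp_conv_disj)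

lemma ev_False: "((\<forall>\<^sub>F i in U. P i) \<longrightarrow> False) \<longleftrightarrow> (\<forall>\<^sub>F i in U. \<not> P i)"
  using ultra[of P] by blast

lemma closed_term: "is_pv_term t \<Longrightarrow> (\<And>v. x v \<in> E) \<Longrightarrow> (\<lambda>i. tval t (\<lambda>v. x v i)) \<in> E"
  by (rule closed[OF pvd_tval])

lemma case_nat_closed: "a \<in> E \<Longrightarrow> (\<And>v. x v \<in> E) \<Longrightarrow> case_nat a x v \<in> E"
  by (cases v) auto

lemma soundness:
  "\<Gamma> \<turnstile> \<phi> \<Longrightarrow> (\<And>v. x v \<in> E) \<Longrightarrow> (\<And>\<gamma>. \<gamma> \<in> \<Gamma> \<Longrightarrow> sats x \<gamma>) \<Longrightarrow> sats x \<phi>"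
proof (induction arbitrary: x rule: provable.induct)
  case (Contr \<phi> \<Gamma>)
  show ?case
  proof (rule ccontr)
    assume "\<not> sats x \<phi>"
    then have "sats x Fls" by (intro Contr.IH) (use Contr.prems in auto)
    then show False by simp
  qed
next
  case (ImpI \<phi> \<Gamma> \<psi>)
  then show ?case by auto
next
  case (OrE \<Gamma> \<phi> \<psi> \<chi>)
  then show ?case by (metis insert_iff sat.simps(5))
next
  case (AllI \<Gamma> \<phi>)
  have "sats (case_nat a x) \<phi>" if "a \<in> E" for a
    by (rule AllI.IH) (use AllI.prems that in \<open>auto simp: sat_lift case_nat_closed\<close>)
  then show ?case by simp
next
  case (AllE \<Gamma> \<phi> t)
  then show ?case by (simp add: sat_inst closed_term)
next
  case (ExI \<Gamma> \<phi> t)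
  then have "sats (case_nat (\<lambda>i. tval t (\<lambda>u. x u i)) x) \<phi>" by (simp add: sat_inst)
  moreover have "(\<lambda>i. tval t (\<lambda>u. x u i)) \<in> E" using ExI by (intro closed_term) auto
  ultimately show ?case by auto
next
  case (ExE \<Gamma> \<phi> \<psi>)
  from ExE.IH(1)[OF ExE.prems] obtain a where a: "a \<in> E" "sats (case_nat a x) \<phi>" by auto
  have "sats (case_nat a x) (lift_fm \<psi>)"
    by (rule ExE.IH(2)) (use ExE.prems a in \<open>auto simp: sat_lift case_nat_closed\<close>)
  then show ?case by (simp add: sat_lift)
next
  case (EqSubst \<Gamma> s t \<phi>)
  then have "\<forall>\<^sub>F i in U. tval s (\<lambda>v. x v i) = tval t (\<lambda>v. x v i)" by simp
  then have "\<forall>\<^sub>F i in U. \<forall>v. case_nat (\<lambda>i. tval s (\<lambda>u. x u i)) x v i =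
      case_nat (\<lambda>i. tval t (\<lambda>u. x u i)) x v i"
    by (rule eventually_mono) (simp split: nat.split)
  from sat_cong[OF this, of E \<phi>] EqSubst.IH(2)[OF EqSubst.prems] show ?case
    unfolding sat_inst by blast
qed auto

section \<open>Validity of the axioms of \<open>PV1\<close>\<close>

lemma sat_closures:
  assumes "\<gamma> \<in> closures \<phi>" "\<And>x. (\<And>v. x v \<in> E) \<Longrightarrow> sats x \<phi>" "\<And>v. x v \<in> E"
  shows "sats x \<gamma>"
proof -
  have "sats x ((All ^^ n) \<phi>)" for n
    using assms(3)
  proof (induction n arbitrary: x)
    case (Suc n)
    then show ?case by (simp add: case_nat_closed)
  qed (simp add: assms(2))
  with assms(1) show ?thesis by (auto simp: closures_def)
qed

text \<open>The axiom is open and the connectives commute with the ultrafilter, so it is enough that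
  it holds in every coordinate.\<close>

lemma sat_induction_axiom:
  assumes "is_pv_fun f" "arity f = n + 1"
  shows "sats x (induction_axiom n f)"
proof -
  define as where "as i = map (\<lambda>v. x v i) [0..<n]" for i
  define T where "T i y \<longleftrightarrow> fval f (as i @ [y]) = [True]" for i y
  define R where "R i = rec_list [] (\<lambda>(d::bool) y z. if T i y then y else z)" for i
  have R: "R i [] = []" "R i (d # y) = (if T i y then y else R i y)" for i d y
    by (simp_all add: R_def)
  have R_len: "length (R i y) \<le> length y" for i y
    by (induction y) (auto simp: R)
  let ?h = "ite (eq (App f (vars (n + 1))) one) (Var n) (Var (n + 1))"
  have longest: "tval (App (longest_fun n f) (vars (n + 1))) (\<lambda>v. x v i) = R i (x n i)" for i
  proof -
    have upd: "map (\<lambda>t. tval t (\<lambda>j. (as i @ [y, z]) ! j)) (vars (n + 1)) = as i @ [y]" for y z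
      unfolding tval_vars by (auto simp: as_def nth_append list_eq_iff_nth_eq less_Suc_eq)
    have "tval ?h (\<lambda>j. (as i @ [y, R i y]) ! j) = (if T i y then y else R i y)" for y
    proof -
      have "tval (eq (App f (vars (n + 1))) one) (\<lambda>j. (as i @ [y, R i y]) ! j) = bv (T i y)"
        unfolding tval_eq T_def tval.simps(2)[of f] upd by simp
      then show ?thesis
        by (simp only: tval.simps(2)[of ite_fun] list.map fval_ite tru_simps)
          (simp add: as_def nth_append)
    qed
    then have "fval (longest_fun n f) (as i @ [x n i]) = R i (x n i)"
      unfolding longest_fun_def Let_def
      by (intro fval_lrec) (use R_len in \<open>auto simp: R as_def nth_append\<close>)
    then show ?thesis
      by (simp only: tval.simps tval_vars) (simp add: as_def)
  qed
  have F: "tval (App f (vars n @ [t])) (\<lambda>v. x v i) = [True] \<longleftrightarrow> T i (tval t (\<lambda>v. x v i))" for t i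
    by (simp add: T_def as_def)
  \<comment> \<open>If \<open>T i b\<close> holds, then \<open>b\<close> is the longest prefix and
    the failure at \<open>d # b\<close> is the failing successor; otherwise the prefix found for
    \<open>b\<close> is inherited.\<close>
  have "T i [] \<Longrightarrow> \<not> T i b \<Longrightarrow> T i (R i b) \<and> \<not> (T i (True # R i b) \<and> T i (False # R i b))" for i b
  proof (induction b)
    case (Cons d b)
    then show ?case by (cases d) (auto simp: R)
  qed auto
  then have "\<forall>\<^sub>F i in U. T i [] \<and> \<not> T i (x n i) \<longrightarrow>
      T i (R i (x n i)) \<and> \<not> (T i (True # R i (x n i)) \<and> T i (False # R i (x n i)))"
    by (intro always_eventually) blast
  moreover have one: "tval one \<rho> = [True]" "tval zero \<rho> = []" "tval (s1 t) \<rho> = True # tval t \<rho>"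
    "tval (s2 t) \<rho> = False # tval t \<rho>" for t \<rho> by simp_all
  ultimately show ?thesis
    unfolding induction_axiom_def Let_def sat.simps one(1) F longest one tval.simps(1)
    by (simp only: ev_False eventually_conj_iff[symmetric] ev_imp)
qed

lemma sat_PV1:
  assumes "\<gamma> \<in> PV1" "\<And>v. x v \<in> E"
  shows "sats x \<gamma>"
proof -
  have T: "\<not> (\<forall>\<^sub>F i in U. False)" using ultra[of "\<lambda>_. True"] by simp
  from assms(1) consider (eq) s t where "\<gamma> \<in> closures (Eq s t)" "pv_eq s t"
    | (neq) "\<gamma> = Neg (Eq one zero)"
    | (cases) "\<gamma> \<in> closures (Or (Eq (Var 0) zero)
       (Or (Eq (Var 0) (s1 (tr (Var 0)))) (Eq (Var 0) (s2 (tr (Var 0))))))"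
    | (ind) n f where "\<gamma> \<in> closures (induction_axiom n f)" "is_pv_fun f" "arity f = n + 1"
    unfolding PV1_def by blast
  then show ?thesis
  proof cases
    case eq
    show ?thesis by (rule sat_closures[OF eq(1) _ assms(2)]) (simp add: pv_eq_sound[OF eq(2)])
  next
    case neq
    then show ?thesis using T by simp
  next
    case cases
    have "sats x (Or (Eq (Var 0) zero) (Or (Eq (Var 0) (s1 (tr (Var 0)))) (Eq (Var 0) (s2 (tr (Var 0))))))"
      for x
    proof -
      have "y = [] \<or> y = True # tl y \<or> y = False # tl y" for y :: str by (cases y) auto
      then show ?thesis by (simp add: ev_disj)
    qed
    then show ?thesis by (intro sat_closures[OF cases _ assms(2)])
  next
    case ind
    show ?thesis by (rule sat_closures[OF ind(1) sat_induction_axiom[OF ind(2,3)] assms(2)])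
  qed
qed

section \<open>Bounded quantifiers and bounded formulas in the model\<close>

lemma ball_iff:
  assumes "pvp P" "pvd B" "\<And>v. x v \<in> E"
  shows "(\<forall>a\<in>E. (\<forall>\<^sub>F i in U. val (a i) \<le> length (B (\<lambda>v. x v i))) \<longrightarrow>
        (\<forall>\<^sub>F i in U. P (case_nat (a i) (\<lambda>v. x v i)))) \<longleftrightarrow>
      (\<forall>\<^sub>F i in U. \<forall>l<Suc (length (B (\<lambda>v. x v i))). P (case_nat (num l) (\<lambda>v. x v i)))"
    (is "?L \<longleftrightarrow> ?R")
proof
  assume ?R
  then show ?L
  proof (intro ballI impI)
    fix a assume "a \<in> E" and "\<forall>\<^sub>F i in U. val (a i) \<le> length (B (\<lambda>v. x v i))"
    from this(2) \<open>?R\<close> show "\<forall>\<^sub>F i in U. P (case_nat (a i) (\<lambda>v. x v i))"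
      by (rule eventually_elim2) (metis le_imp_less_Suc num_val)
  qed
next
  assume L: ?L
  \<comment> \<open>A counterexample, if there is one, is found by bounded search and is hence a PV
    function of the parameters. So it names an element of \<open>E\<close>, and the quantifier over
    \<open>E\<close> cannot miss it. A failed search yields 0, which is within the bound.\<close>
  define s where "s \<rho> = srch (\<lambda>l. \<not> P (case_nat (num l) \<rho>)) (Suc (length (B \<rho>)))" for \<rho>
  have "pvd (\<lambda>\<rho>. num (s \<rho>))"
    unfolding s_def by (intro pvd_num pvn_srch pvp_not)
      (use assms in \<open>auto intro!: pvn_Suc pvn_length lenb_Suc lenb_length simp: case_nat_eta\<close>)
  then have "(\<lambda>i. num (s (\<lambda>v. x v i))) \<in> E" by (rule closed) (rule assms)
  moreover have "val (num (s \<rho>)) \<le> length (B \<rho>)" for \<rho>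
    using srch_le[of "\<lambda>l. \<not> P (case_nat (num l) \<rho>)" "length (B \<rho>)"] by (simp add: s_def)
  ultimately have "\<forall>\<^sub>F i in U. P (case_nat (num (s (\<lambda>v. x v i))) (\<lambda>v. x v i))"
    using L by auto
  then show ?R
  proof (rule eventually_mono)
    fix i assume i: "P (case_nat (num (s (\<lambda>v. x v i))) (\<lambda>v. x v i))"
    show "\<forall>l<Suc (length (B (\<lambda>v. x v i))). P (case_nat (num l) (\<lambda>v. x v i))"
    proof (intro allI impI, rule ccontr)
      fix l assume "l < Suc (length (B (\<lambda>v. x v i)))" "\<not> P (case_nat (num l) (\<lambda>v. x v i))"
      then show False
        using i srchI[of "\<lambda>l. \<not> P (case_nat (num l) (\<lambda>v. x v i))" l "Suc (length (B (\<lambda>v. x v i)))"]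
        by (simp add: s_def del: srch.simps)
    qed
  qed
qed

lemma sat_BAll:
  "sats x (BAll t \<phi>) \<longleftrightarrow>
    (\<forall>a\<in>E. (\<forall>\<^sub>F i in U. val (a i) \<le> val (tval t (\<lambda>v. x v i))) \<longrightarrow> sats (case_nat a x) \<phi>)"
  by (simp add: BAll_def tval_subst)

lemma sat_BEx:
  "sats x (BEx t \<phi>) \<longleftrightarrow>
    (\<exists>a\<in>E. (\<forall>\<^sub>F i in U. val (a i) \<le> val (tval t (\<lambda>v. x v i))) \<and> sats (case_nat a x) \<phi>)"
  by (simp add: BEx_def tval_subst)

text \<open>Los's theorem for sharply bounded formulas: quantifiers are treated by
  \<open>ball_iff\<close>, connectives by the ultrafilter property.\<close>

lemma sharply_bounded_sat:
  "sharply_bounded \<phi> \<Longrightarrow>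
    \<exists>P. pvp P \<and> (\<forall>x. (\<forall>v. x v \<in> E) \<longrightarrow> (sats x \<phi> \<longleftrightarrow> (\<forall>\<^sub>F i in U. P (\<lambda>v. x v i))))"
proof (induction rule: sharply_bounded.induct)
  case 1
  have "\<not> (\<forall>\<^sub>F i in U. False)" using ultra[of "\<lambda>_. True"] by simp
  then show ?case by (intro exI[of _ "\<lambda>_. False"]) (simp add: pvp_const)
next
  case (2 s t)
  then show ?case
    by (intro exI[of _ "\<lambda>\<rho>. tval s \<rho> = tval t \<rho>"]) (simp add: pvp_eq pvd_tval)
next
  case (3 \<phi> \<psi>)
  then obtain P Q where "pvp P" "pvp Q"
    "\<And>x. (\<forall>v. x v \<in> E) \<Longrightarrow> (sats x \<phi> \<longleftrightarrow> (\<forall>\<^sub>F i in U. P (\<lambda>v. x v i)))"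
    "\<And>x. (\<forall>v. x v \<in> E) \<Longrightarrow> (sats x \<psi> \<longleftrightarrow> (\<forall>\<^sub>F i in U. Q (\<lambda>v. x v i)))" by blast
  then show ?case
    by (intro exI[of _ "\<lambda>\<rho>. P \<rho> \<longrightarrow> Q \<rho>"]) (simp add: pvp_imp ev_imp)
next
  case (4 \<phi> \<psi>)
  then obtain P Q where "pvp P" "pvp Q"
    "\<And>x. (\<forall>v. x v \<in> E) \<Longrightarrow> (sats x \<phi> \<longleftrightarrow> (\<forall>\<^sub>F i in U. P (\<lambda>v. x v i)))"
    "\<And>x. (\<forall>v. x v \<in> E) \<Longrightarrow> (sats x \<psi> \<longleftrightarrow> (\<forall>\<^sub>F i in U. Q (\<lambda>v. x v i)))" by blast
  then show ?case
    by (intro exI[of _ "\<lambda>\<rho>. P \<rho> \<and> Q \<rho>"]) (simp add: pvp_conj eventually_conj_iff)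
next
  case (5 \<phi> \<psi>)
  then obtain P Q where "pvp P" "pvp Q"
    "\<And>x. (\<forall>v. x v \<in> E) \<Longrightarrow> (sats x \<phi> \<longleftrightarrow> (\<forall>\<^sub>F i in U. P (\<lambda>v. x v i)))"
    "\<And>x. (\<forall>v. x v \<in> E) \<Longrightarrow> (sats x \<psi> \<longleftrightarrow> (\<forall>\<^sub>F i in U. Q (\<lambda>v. x v i)))" by blast
  then show ?case
    by (intro exI[of _ "\<lambda>\<rho>. P \<rho> \<or> Q \<rho>"]) (simp add: pvp_disj ev_disj)
next
  case (6 t \<phi>)
  then obtain P where P: "pvp P"
    "\<And>x. (\<forall>v. x v \<in> E) \<Longrightarrow> (sats x \<phi> \<longleftrightarrow> (\<forall>\<^sub>F i in U. P (\<lambda>v. x v i)))" by blast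
  let ?Q = "\<lambda>\<rho>. \<forall>l<Suc (length (tval t \<rho>)). P (case_nat (num l) \<rho>)"
  have "pvp ?Q"
    by (intro pvp_all) (use P 6 in \<open>auto intro!: pvn_Suc pvn_length lenb_Suc lenb_length pvd_tval simp: case_nat_eta\<close>)
  moreover have "sats x (BAll (len t) \<phi>) \<longleftrightarrow> (\<forall>\<^sub>F i in U. ?Q (\<lambda>v. x v i))" if "\<forall>v. x v \<in> E" for x
    using ball_iff[OF P(1) pvd_tval[of t], of x] 6 that
    by (simp add: sat_BAll P(2) case_nat_closed case_nat_apply)
  ultimately show ?case by blast
next
  case (7 t \<phi>)
  then obtain P where P: "pvp P"
    "\<And>x. (\<forall>v. x v \<in> E) \<Longrightarrow> (sats x \<phi> \<longleftrightarrow> (\<forall>\<^sub>F i in U. P (\<lambda>v. x v i)))" by blast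
  let ?Q = "\<lambda>\<rho>. \<not> (\<forall>l<Suc (length (tval t \<rho>)). \<not> P (case_nat (num l) \<rho>))"
  have "pvp ?Q"
    by (intro pvp_not pvp_all) (use P 7 in \<open>auto intro!: pvn_Suc pvn_length lenb_Suc lenb_length pvd_tval simp: case_nat_eta\<close>)
  moreover have "sats x (BEx (len t) \<phi>) \<longleftrightarrow> (\<forall>\<^sub>F i in U. ?Q (\<lambda>v. x v i))" if "\<forall>v. x v \<in> E" for x
    using ball_iff[OF pvp_not[OF P(1)] pvd_tval[of t], of x] 7 that
    unfolding ultra by (auto simp add: sat_BEx P(2) case_nat_closed case_nat_apply)
  ultimately show ?case by blast
qed

lemma ex_pair_iff:
  fixes x :: "nat \<Rightarrow> nat \<Rightarrow> str"
  assumes "\<And>v. x v \<in> E"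
  shows "(\<exists>a\<in>E. \<exists>b\<in>E. \<forall>\<^sub>F i in U. Q i (a i) (b i)) \<longleftrightarrow>
    (\<exists>z\<in>E. \<forall>\<^sub>F i in U. Q i (el (z i) 0) (el (z i) 1))"
proof
  assume "\<exists>a\<in>E. \<exists>b\<in>E. \<forall>\<^sub>F i in U. Q i (a i) (b i)"
  then obtain a b where ab: "a \<in> E" "b \<in> E" "\<forall>\<^sub>F i in U. Q i (a i) (b i)" by blast
  have "pvd (\<lambda>\<rho>. code [\<rho> 0, \<rho> 1])" by (intro pvd_intros)
  then have "(\<lambda>i. (\<lambda>\<rho>. code [\<rho> 0, \<rho> 1]) (\<lambda>v. case_nat a (case_nat b x) v i)) \<in> E"
    by (rule closed) (intro case_nat_closed ab assms)
  then show "\<exists>z\<in>E. \<forall>\<^sub>F i in U. Q i (el (z i) 0) (el (z i) 1)"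
    using ab(3) by (intro bexI[of _ "\<lambda>i. code [a i, b i]"]) auto
next
  assume "\<exists>z\<in>E. \<forall>\<^sub>F i in U. Q i (el (z i) 0) (el (z i) 1)"
  then obtain z where z: "z \<in> E" "\<forall>\<^sub>F i in U. Q i (el (z i) 0) (el (z i) 1)" by blast
  have "pvd (\<lambda>\<rho>. el (\<rho> 0) j)" for j by (intro pvd_intros)
  then have "(\<lambda>i. (\<lambda>\<rho>. el (\<rho> 0) j) (\<lambda>v. case_nat z x v i)) \<in> E" for j
    by (rule closed) (intro case_nat_closed z assms)
  then have "(\<lambda>i. el (z i) j) \<in> E" for j by simp
  then show "\<exists>a\<in>E. \<exists>b\<in>E. \<forall>\<^sub>F i in U. Q i (a i) (b i)"
    using z(2) by (intro bexI[of _ "\<lambda>i. el (z i) 0"] bexI[of _ "\<lambda>i. el (z i) 1"]) auto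
qed

text \<open>Prenex operations: pairing merges witnesses, bounds move into the predicate, and a
  sharply bounded universal quantifier is moved inside by \<open>collection\<close>, the sequence of
  witnesses becoming the new witness. What remains is a PV predicate, to which
  \<open>collection\<close> applies again.\<close>

lemma Sigma_b_1_sat:
  "Sigma_b_1 \<phi> \<Longrightarrow> \<exists>P. pvp P \<and> (\<forall>x. (\<forall>v. x v \<in> E) \<longrightarrow>
      (sats x \<phi> \<longleftrightarrow> (\<exists>z\<in>E. \<forall>\<^sub>F i in U. P (case_nat (z i) (\<lambda>v. x v i)))))"
proof -
  have ex: "\<exists>P. pvp P \<and> (\<forall>x. (\<forall>v. x v \<in> E) \<longrightarrow>
      (sats x (BEx t \<phi>) \<longleftrightarrow> (\<exists>z\<in>E. \<forall>\<^sub>F i in U. P (case_nat (z i) (\<lambda>v. x v i)))))"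
    if t: "is_pv_term t" and IH: "\<exists>P. pvp P \<and> (\<forall>x. (\<forall>v. x v \<in> E) \<longrightarrow>
      (sats x \<phi> \<longleftrightarrow> (\<exists>z\<in>E. \<forall>\<^sub>F i in U. P (case_nat (z i) (\<lambda>v. x v i)))))" for t \<phi>
  proof -
    from IH obtain P where P: "pvp P"
      "\<And>x. (\<forall>v. x v \<in> E) \<Longrightarrow> sats x \<phi> \<longleftrightarrow> (\<exists>z\<in>E. \<forall>\<^sub>F i in U. P (case_nat (z i) (\<lambda>v. x v i)))" by blast
    let ?Q = "\<lambda>\<rho>. val (el (\<rho> 0) 0) \<le> val (tval t (\<lambda>v. \<rho> (Suc v))) \<and>
      P (case_nat (el (\<rho> 0) 1) (case_nat (el (\<rho> 0) 0) (\<lambda>v. \<rho> (Suc v))))"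
    have "pvd (\<lambda>\<rho>. tval t (\<lambda>v. \<rho> (Suc v)))" by (intro pvd_subst[OF pvd_tval[OF t]] pvd_var)
    then have "pvp ?Q" by (intro pvp_conj pvp_le pvn_val pvp_subst[OF P(1)] pvd_case_nat pvd_intros)
    moreover have "sats x (BEx t \<phi>) \<longleftrightarrow> (\<exists>z\<in>E. \<forall>\<^sub>F i in U. ?Q (case_nat (z i) (\<lambda>v. x v i)))"
      if x: "\<forall>v. x v \<in> E" for x
    proof -
      have "sats x (BEx t \<phi>) \<longleftrightarrow> (\<exists>a\<in>E. \<exists>z\<in>E. \<forall>\<^sub>F i in U. val (a i) \<le> val (tval t (\<lambda>v. x v i)) \<and>
          P (case_nat (z i) (case_nat (a i) (\<lambda>v. x v i))))"
        by (auto simp: sat_BEx P(2) case_nat_closed x case_nat_apply eventually_conj_iff)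
      also have "\<dots> \<longleftrightarrow> (\<exists>z\<in>E. \<forall>\<^sub>F i in U. ?Q (case_nat (z i) (\<lambda>v. x v i)))"
        using ex_pair_iff[of x "\<lambda>i a z. val a \<le> val (tval t (\<lambda>v. x v i)) \<and>
          P (case_nat z (case_nat a (\<lambda>v. x v i)))"] x by simp
      finally show ?thesis .
    qed
    ultimately show ?thesis by blast
  qed
  assume "Sigma_b_1 \<phi>"
  then show ?thesis
  proof (induction rule: Sigma_b_1.induct)
    case (1 \<phi>)
    then obtain P where P: "pvp P"
      "\<And>x. (\<forall>v. x v \<in> E) \<Longrightarrow> (sats x \<phi> \<longleftrightarrow> (\<forall>\<^sub>F i in U. P (\<lambda>v. x v i)))"
      using sharply_bounded_sat by blast
    have "pvp (\<lambda>\<rho>. P (\<lambda>v. \<rho> (Suc v)))" by (intro pvp_subst[OF P(1)] pvd_var)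
    then show ?case by (intro exI[of _ "\<lambda>\<rho>. P (\<lambda>v. \<rho> (Suc v))"]) (use P(2) in auto)
  next
    case (2 \<phi> \<psi>)
    then obtain P Q where P: "pvp P" "pvp Q"
      "\<And>x. (\<forall>v. x v \<in> E) \<Longrightarrow> sats x \<phi> \<longleftrightarrow> (\<exists>z\<in>E. \<forall>\<^sub>F i in U. P (case_nat (z i) (\<lambda>v. x v i)))"
      "\<And>x. (\<forall>v. x v \<in> E) \<Longrightarrow> sats x \<psi> \<longleftrightarrow> (\<exists>z\<in>E. \<forall>\<^sub>F i in U. Q (case_nat (z i) (\<lambda>v. x v i)))" by blast
    let ?Q = "\<lambda>\<rho>. P (case_nat (el (\<rho> 0) 0) (\<lambda>v. \<rho> (Suc v))) \<and>
      Q (case_nat (el (\<rho> 0) 1) (\<lambda>v. \<rho> (Suc v)))"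
    have "pvp ?Q" by (intro pvp_conj pvp_subst[OF P(1)] pvp_subst[OF P(2)] pvd_case_nat pvd_intros)
    moreover have "sats x (And \<phi> \<psi>) \<longleftrightarrow> (\<exists>z\<in>E. \<forall>\<^sub>F i in U. ?Q (case_nat (z i) (\<lambda>v. x v i)))"
      if x: "\<forall>v. x v \<in> E" for x
    proof -
      have "sats x (And \<phi> \<psi>) \<longleftrightarrow> (\<exists>a\<in>E. \<exists>b\<in>E. \<forall>\<^sub>F i in U.
          P (case_nat (a i) (\<lambda>v. x v i)) \<and> Q (case_nat (b i) (\<lambda>v. x v i)))"
        by (auto simp: P(3,4) x eventually_conj_iff)
      also have "\<dots> \<longleftrightarrow> (\<exists>z\<in>E. \<forall>\<^sub>F i in U. ?Q (case_nat (z i) (\<lambda>v. x v i)))"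
        using ex_pair_iff[of x "\<lambda>i a b. P (case_nat a (\<lambda>v. x v i)) \<and> Q (case_nat b (\<lambda>v. x v i))"] x
        by simp
      finally show ?thesis .
    qed
    ultimately show ?case by blast
  next
    case (3 \<phi> \<psi>)
    then obtain P Q where P: "pvp P" "pvp Q"
      "\<And>x. (\<forall>v. x v \<in> E) \<Longrightarrow> sats x \<phi> \<longleftrightarrow> (\<exists>z\<in>E. \<forall>\<^sub>F i in U. P (case_nat (z i) (\<lambda>v. x v i)))"
      "\<And>x. (\<forall>v. x v \<in> E) \<Longrightarrow> sats x \<psi> \<longleftrightarrow> (\<exists>z\<in>E. \<forall>\<^sub>F i in U. Q (case_nat (z i) (\<lambda>v. x v i)))" by blast
    then show ?case
      by (intro exI[of _ "\<lambda>\<rho>. P \<rho> \<or> Q \<rho>"]) (auto simp: pvp_disj ev_disj[symmetric])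
  next
    case (4 t \<phi>)
    then show ?case by (intro ex) auto
  next
    case (5 t \<phi>)
    then show ?case by (intro ex) auto
  next
    case (6 t \<phi>)
    then obtain P where P: "pvp P"
      "\<And>x. (\<forall>v. x v \<in> E) \<Longrightarrow> sats x \<phi> \<longleftrightarrow> (\<exists>z\<in>E. \<forall>\<^sub>F i in U. P (case_nat (z i) (\<lambda>v. x v i)))" by blast
    let ?Q = "\<lambda>\<rho>. \<forall>l<Suc (length (tval t (\<lambda>v. \<rho> (Suc v)))).
      P (case_nat (el (\<rho> 0) l) (case_nat (num l) (\<lambda>v. \<rho> (Suc v))))"
    have t: "pvd (\<lambda>\<rho>. tval t (\<lambda>v. \<rho> (Suc v)))"
      by (intro pvd_subst[OF pvd_tval] pvd_var) (use 6 in simp)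
    have "pvp ?Q"
      by (intro pvp_all pvp_subst[OF P(1)] pvd_case_nat pvd_intros lenb_intros t)
    moreover have "sats x (BAll (len t) \<phi>) \<longleftrightarrow> (\<exists>z\<in>E. \<forall>\<^sub>F i in U. ?Q (case_nat (z i) (\<lambda>v. x v i)))"
      (is "?L \<longleftrightarrow> ?R") if x: "\<forall>v. x v \<in> E" for x
    proof -
      have L: "?L \<longleftrightarrow> (\<forall>a\<in>E. (\<forall>\<^sub>F i in U. val (a i) \<le> length (tval t (\<lambda>v. x v i))) \<longrightarrow>
          (\<exists>z\<in>E. \<forall>\<^sub>F i in U. P (case_nat (z i) (case_nat (a i) (\<lambda>v. x v i)))))"
        by (simp add: sat_BAll P(2) case_nat_closed x case_nat_apply)
      show ?thesis
      proof
        assume ?L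
        have "\<exists>w\<in>E. \<forall>\<^sub>F i in U. \<forall>j\<le>length (tval t (\<lambda>v. x v i)).
            P (case_nat (el (w i) j) (case_nat (num j) (\<lambda>v. x v i)))"
          by (rule collection[OF P(1) pvd_tval]) (use x 6 \<open>?L\<close>[unfolded L] in auto)
        then show ?R by (simp add: less_Suc_eq_le)
      next
        assume ?R
        then obtain w where w: "w \<in> E" "\<forall>\<^sub>F i in U. \<forall>j\<le>length (tval t (\<lambda>v. x v i)).
            P (case_nat (el (w i) j) (case_nat (num j) (\<lambda>v. x v i)))"
          by (auto simp: less_Suc_eq_le)
        show ?L unfolding L
        proof (intro ballI impI)
          fix a assume a: "a \<in> E" "\<forall>\<^sub>F i in U. val (a i) \<le> length (tval t (\<lambda>v. x v i))"
          have "pvd (\<lambda>\<rho>. el (\<rho> 0) (val (\<rho> 1)))" by (intro pvd_intros)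
          then have "(\<lambda>i. (\<lambda>\<rho>. el (\<rho> 0) (val (\<rho> 1))) (\<lambda>v. case_nat w (case_nat a x) v i)) \<in> E"
            by (rule closed) (intro case_nat_closed a w x[rule_format])
          moreover from a(2) w(2) have "\<forall>\<^sub>F i in U.
              P (case_nat (el (w i) (val (a i))) (case_nat (a i) (\<lambda>v. x v i)))"
            by (rule eventually_elim2) (metis num_val)
          ultimately show "\<exists>z\<in>E. \<forall>\<^sub>F i in U. P (case_nat (z i) (case_nat (a i) (\<lambda>v. x v i)))"
            by (intro bexI[of _ "\<lambda>i. el (w i) (val (a i))"]) auto
        qed
      qed
    qed
    ultimately show ?case by blast
  qed
qed

lemma sat_BB:
  assumes "Sigma_b_1 \<phi>" and x: "\<And>v. x v \<in> E"
  shows "sats x (BB \<phi>)"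
proof -
  obtain P where P: "pvp P"
    "\<And>x. (\<forall>v. x v \<in> E) \<Longrightarrow> sats x \<phi> \<longleftrightarrow> (\<exists>z\<in>E. \<forall>\<^sub>F i in U. P (case_nat (z i) (\<lambda>v. x v i)))"
    using Sigma_b_1_sat[OF assms(1)] by blast
  have env1: "(\<lambda>v i. tval (if v < 2 then Var v else Var (v + 2))
      (\<lambda>u. case_nat y (case_nat j (case_nat T (case_nat X x))) u i)) = case_nat y (case_nat j x)"
    for y j T X
    by (intro ext) (auto split: nat.split simp: numeral_2_eq_2)
  have env2: "(\<lambda>v i. tval (if v = 0 then elt (Var 1) (Var 0) else if v = 1 then Var 0 else Var (v + 2))
      (\<lambda>u. case_nat j (case_nat w (case_nat T (case_nat X x))) u i)) =
      case_nat (\<lambda>i. el (w i) (val (j i))) (case_nat j x)" for w j T X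
    by (intro ext) (auto split: nat.split simp: numeral_2_eq_2)
  have "sats (case_nat T (case_nat X x)) (Ex (BAll (len (Var 2))
       (fm_subst (\<lambda>i. if i = 0 then elt (Var 1) (Var 0)
                      else if i = 1 then Var 0 else Var (i + 2)) \<phi>)))"
    if XT: "X \<in> E" "T \<in> E" and prem: "sats (case_nat T (case_nat X x)) (BAll (len (Var 1)) (BEx (Var 1)
       (fm_subst (\<lambda>i. if i < 2 then Var i else Var (i + 2)) \<phi>)))" for X T
  proof -
    \<comment> \<open>What is collected for \<open>j\<close> is a pair: \<open>y\<close> and the
      witness that reduces the formula at \<open>j\<close> and \<open>y\<close> to a PV predicate.
      The skipped variable 2 is \<open>X\<close>.\<close>
    let ?P = "\<lambda>\<rho>. P (case_nat (el (\<rho> 0) 1) (case_nat (el (\<rho> 0) 0)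
      (case_nat (\<rho> 1) (\<lambda>v. \<rho> (Suc (Suc (Suc v)))))))"
    have xX: "case_nat X x v \<in> E" for v by (intro case_nat_closed XT x)
    have "\<exists>w\<in>E. \<forall>\<^sub>F i in U. \<forall>j\<le>length ((\<lambda>\<rho>. \<rho> 0) (\<lambda>v. case_nat X x v i)).
        ?P (case_nat (el (w i) j) (case_nat (num j) (\<lambda>v. case_nat X x v i)))"
    proof (rule collection)
      show "pvp ?P" by (intro pvp_subst[OF P(1)] pvd_case_nat pvd_intros)
      show "pvd (\<lambda>\<rho>. \<rho> 0)" by (rule pvd_var)
      show "case_nat X x v \<in> E" for v by fact
      fix j assume j: "j \<in> E" "\<forall>\<^sub>F i in U. val (j i) \<le> length ((\<lambda>v. case_nat X x v i) 0)"
      then obtain y where y: "y \<in> E" "sats (case_nat y (case_nat j x)) \<phi>"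
        using prem[unfolded sat_BAll sat_BEx sat_subst env1] by auto
      then obtain z where z: "z \<in> E"
        "\<forall>\<^sub>F i in U. P (case_nat (z i) (\<lambda>v. case_nat y (case_nat j x) v i))"
        using P(2)[of "case_nat y (case_nat j x)"] by (auto simp: case_nat_closed j x)
      then show "\<exists>z\<in>E. \<forall>\<^sub>F i in U. ?P (case_nat (z i) (case_nat (j i) (\<lambda>v. case_nat X x v i)))"
        using ex_pair_iff[of x "\<lambda>i a b. P (case_nat b (case_nat a (case_nat (j i) (\<lambda>v. x v i))))"] x y(1)
        by (auto simp: case_nat_apply)
    qed
    then obtain w where w: "w \<in> E" "\<forall>\<^sub>F i in U. \<forall>j\<le>length (X i).
        P (case_nat (el (el (w i) j) 1) (case_nat (el (el (w i) j) 0) (case_nat (num j) (\<lambda>v. x v i))))"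
      by auto
    \<comment> \<open>The conclusion wants only the first components; the second ones are recovered
      from \<open>w\<close> when the formula is verified.\<close>
    have "pvd (\<lambda>\<rho>. code (map (\<lambda>l. el (el (\<rho> 0) l) 0) [0..<Suc (length (\<rho> 1))]))"
      by (intro pvd_code_map pvd_intros lenb_intros)
    then have "(\<lambda>i. (\<lambda>\<rho>. code (map (\<lambda>l. el (el (\<rho> 0) l) 0) [0..<Suc (length (\<rho> 1))]))
        (\<lambda>v. case_nat w (case_nat X x) v i)) \<in> E"
      by (rule closed) (intro case_nat_closed w XT x)
    then have W: "(\<lambda>i. code (map (\<lambda>l. el (el (w i) l) 0) [0..<Suc (length (X i))])) \<in> E"
      (is "?w \<in> E") by (simp del: upt_Suc)
    have "sats (case_nat (\<lambda>i. el (?w i) (val (j i))) (case_nat j x)) \<phi>"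
      if j: "j \<in> E" "\<forall>\<^sub>F i in U. val (j i) \<le> length (X i)" for j
    proof -
      have el: "(\<lambda>i. el (v i) (val (j i))) \<in> E" if "v \<in> E" for v
      proof -
        have "pvd (\<lambda>\<rho>. el (\<rho> 0) (val (\<rho> 1)))" by (intro pvd_intros)
        then have "(\<lambda>i. (\<lambda>\<rho>. el (\<rho> 0) (val (\<rho> 1))) (\<lambda>u. case_nat v (case_nat j x) u i)) \<in> E"
          by (rule closed) (intro case_nat_closed j that x)
        then show ?thesis by simp
      qed
      have z: "(\<lambda>i. el (el (w i) (val (j i))) 1) \<in> E"
      proof -
        have "pvd (\<lambda>\<rho>. el (\<rho> 0) 1)" by (intro pvd_intros)
        then have "(\<lambda>i. (\<lambda>\<rho>. el (\<rho> 0) 1)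
            (\<lambda>u. case_nat (\<lambda>i. el (w i) (val (j i))) x u i)) \<in> E"
          by (rule closed) (intro case_nat_closed el w x)
        then show ?thesis by simp
      qed
      from j(2) w(2) have "\<forall>\<^sub>F i in U. P (case_nat (el (el (w i) (val (j i))) 1)
          (case_nat (el (?w i) (val (j i))) (case_nat (j i) (\<lambda>v. x v i))))"
        by (rule eventually_elim2) (simp del: upt_Suc, metis num_val)
      then show ?thesis
        using P(2)[of "case_nat (\<lambda>i. el (?w i) (val (j i))) (case_nat j x)"] z
        by (auto simp: case_nat_closed j x el W case_nat_apply simp del: upt_Suc)
    qed
    then show ?thesis
      unfolding sat.simps sat_BAll sat_subst env2
      by (intro bexI[OF _ W] ballI impI) (simp add: numeral_2_eq_2 del: upt_Suc)
  qed
  then show ?thesis by (simp add: BB_def)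
qed

lemma sat_provable:
  assumes "PV1 \<union> BB_Sigma_b_1 \<turnstile> \<phi>" "\<And>v. x v \<in> E"
  shows "sats x \<phi>"
proof (rule soundness[OF assms])
  fix \<gamma> assume "\<gamma> \<in> PV1 \<union> BB_Sigma_b_1"
  then consider "\<gamma> \<in> PV1" | \<phi> where "Sigma_b_1 \<phi>" "\<gamma> \<in> closures (BB \<phi>)"
    unfolding BB_Sigma_b_1_def by blast
  then show "sats x \<gamma>"
    by cases (auto intro: sat_PV1 assms sat_closures sat_BB)
qed

end

section \<open>Construction of a model\<close>

lemma ex_free_ultrafilter:
  "\<exists>U :: nat filter. U \<le> sequentially \<and> (\<forall>A. (\<forall>\<^sub>F i in U. \<not> A i) \<longleftrightarrow> \<not> (\<forall>\<^sub>F i in U. A i))"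
proof -
  let ?X = "{F :: nat filter. F \<noteq> bot \<and> F \<le> sequentially}"
  let ?P = "\<lambda>F G :: nat filter. G \<le> F"
  have "\<exists>U\<in>?X. \<forall>F\<in>?X. ?P U F \<longrightarrow> F = U"
  proof (rule predicate_Zorn)
    show "partial_order_on ?X (relation_of ?P ?X)"
      by (rule partial_order_on_relation_ofI) auto
    fix C assume C: "C \<in> Chains (relation_of ?P ?X)"
    then have CX: "C \<subseteq> ?X" and chain: "\<And>F G. F \<in> C \<Longrightarrow> G \<in> C \<Longrightarrow> F \<le> G \<or> G \<le> F"
      by (auto simp: Chains_def relation_of_def)
    show "\<exists>u\<in>?X. \<forall>a\<in>C. ?P a u"
    proof (cases "C = {}")
      case True
      then show ?thesis by (auto intro!: exI[of _ sequentially])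
    next
      case False
      have "eventually (\<lambda>_. False) (Inf C) \<longleftrightarrow> (\<exists>F\<in>C. eventually (\<lambda>_. False) F)"
      proof (rule eventually_Inf_base[OF False])
        fix F G assume "F \<in> C" "G \<in> C"
        then show "\<exists>x\<in>C. x \<le> inf F G" using chain[of F G] by (auto intro: bexI[of _ F] bexI[of _ G])
      qed
      then have "Inf C \<noteq> bot" using CX by (auto simp: trivial_limit_def)
      moreover have "Inf C \<le> sequentially" using False CX by (auto intro: Inf_lower2)
      ultimately show ?thesis by (auto intro!: exI[of _ "Inf C"] Inf_lower)
    qed
  qed
  then obtain U where U: "U \<noteq> bot" "U \<le> sequentially"
    and min: "\<And>F. F \<noteq> bot \<Longrightarrow> F \<le> sequentially \<Longrightarrow> F \<le> U \<Longrightarrow> F = U" by blast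
  have "(\<forall>\<^sub>F i in U. \<not> A i) \<longleftrightarrow> \<not> (\<forall>\<^sub>F i in U. A i)" for A
  proof
    assume A: "\<forall>\<^sub>F i in U. \<not> A i"
    show "\<not> (\<forall>\<^sub>F i in U. A i)"
    proof
      assume "\<forall>\<^sub>F i in U. A i"
      with A have "\<forall>\<^sub>F i in U. False" by eventually_elim simp
      with U(1) show False by (simp add: trivial_limit_def)
    qed
  next
    assume A: "\<not> (\<forall>\<^sub>F i in U. A i)"
    \<comment> \<open>Adjoining the complement of \<open>A\<close> keeps the filter proper, so by
      minimality it leaves \<open>U\<close> unchanged.\<close>
    have "inf U (principal {i. \<not> A i}) = U"
    proof (rule min)
      show "inf U (principal {i. \<not> A i}) \<noteq> bot"
        using A by (simp add: trivial_limit_def eventually_inf_principal)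
    qed (use U(2) in \<open>auto intro: le_infI1\<close>)
    moreover have "\<forall>\<^sub>F i in inf U (principal {i. \<not> A i}). \<not> A i"
      by (simp add: eventually_inf_principal)
    ultimately show "\<forall>\<^sub>F i in U. \<not> A i" by simp
  qed
  with U(2) show ?thesis by blast
qed

subsection \<open>Positions and promises\<close>

text \<open>
  A position \<open>\<rho>\<close> of stage \<open>s\<close> lists the values of \<open>s + 1\<close> constants.  A round asks, for all
  \<open>l \<le> |B \<rho>|\<close>, for a valid answer to the query \<open>Q\<close>, in which \<open>l\<close> is the value of the variable
  \<open>s + 1\<close>; the sequence of the answers is the next constant.  The predicate \<open>\<theta>\<close> is a promise
  about all objects that can be named, and is therefore required of all queries.
\<close>

type_synonym round = "(env \<Rightarrow> str) \<times> (env \<Rightarrow> str)"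

definition trunc :: "nat \<Rightarrow> env \<Rightarrow> env" where
  "trunc s \<rho> = (\<lambda>i. if i \<le> s then \<rho> i else [])"

definition dep :: "nat \<Rightarrow> (env \<Rightarrow> 'a) \<Rightarrow> bool" where
  "dep s F \<longleftrightarrow> (\<forall>\<rho> \<rho>'. (\<forall>i\<le>s. \<rho> i = \<rho>' i) \<longrightarrow> F \<rho> = F \<rho>')"

definition rounds :: "round list \<Rightarrow> bool" where
  "rounds R \<longleftrightarrow> (\<forall>(Q, B)\<in>set R. pvd Q \<and> pvd B)"

locale game =
  fixes valid :: "str \<Rightarrow> str \<Rightarrow> str \<Rightarrow> bool"
begin

definition answers :: "nat \<Rightarrow> env \<Rightarrow> (env \<Rightarrow> str \<Rightarrow> bool) \<Rightarrow> round \<Rightarrow> str \<Rightarrow> bool" where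
  "answers s \<rho> \<theta> q u \<longleftrightarrow> (\<forall>l\<le>length (snd q \<rho>).
     \<theta> \<rho> (fst q (\<rho>(Suc s := num l))) \<and> valid (\<rho> 0) (fst q (\<rho>(Suc s := num l))) (el u l))"

primrec survive :: "nat \<Rightarrow> env \<Rightarrow> (env \<Rightarrow> str \<Rightarrow> bool) \<Rightarrow> round list \<Rightarrow> bool" where
  "survive s \<rho> \<theta> [] \<longleftrightarrow> True"
| "survive s \<rho> \<theta> (q # R) \<longleftrightarrow> (\<exists>u. answers s \<rho> \<theta> q u \<and> survive (Suc s) (\<rho>(Suc s := u)) \<theta> R)"

type_synonym state = "nat \<times> env set \<times> (env \<Rightarrow> str \<Rightarrow> bool)"

text \<open>The analogue of finite satisfiability: the surviving position may depend on the list of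
  rounds. Hence, if only the last clause fails, a single list of rounds is lost from every position
  of \<open>A\<close>.\<close>

fun consistent :: "state \<Rightarrow> bool" where
  "consistent (s, A, \<theta>) \<longleftrightarrow> (\<forall>\<rho>\<in>A. trunc s \<rho> = \<rho>) \<and> dep s \<theta> \<and>
     (\<forall>R. rounds R \<longrightarrow> (\<exists>\<rho>\<in>A. survive s \<rho> \<theta> R))"

fun extends :: "state \<Rightarrow> state \<Rightarrow> bool" where
  "extends (s, A, \<theta>) (s', A', \<theta>') \<longleftrightarrow> s \<le> s' \<and>
     (\<forall>\<rho>\<in>A'. trunc s \<rho> \<in> A \<and> (\<forall>y. \<theta>' \<rho> y \<longrightarrow> \<theta> \<rho> y))"

lemma trunc_le [simp]: "i \<le> s \<Longrightarrow> trunc s \<rho> i = \<rho> i"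
  by (simp add: trunc_def)

lemma trunc_trunc: "s \<le> s' \<Longrightarrow> trunc s (trunc s' \<rho>) = trunc s \<rho>"
  by (rule ext) (simp add: trunc_def)

lemma trunc_upd: "trunc s \<rho> = \<rho> \<Longrightarrow> trunc s (\<rho>(Suc s := u)) = \<rho>"
    "trunc s \<rho> = \<rho> \<Longrightarrow> trunc (Suc s) (\<rho>(Suc s := u)) = \<rho>(Suc s := u)"
  by (auto simp: trunc_def fun_eq_iff split: if_splits) (metis le_Suc_eq)

lemma depD: "dep s F \<Longrightarrow> (\<And>i. i \<le> s \<Longrightarrow> \<rho> i = \<rho>' i) \<Longrightarrow> F \<rho> = F \<rho>'"
  by (simp add: dep_def)

lemma dep_trunc: "dep s F \<Longrightarrow> s \<le> s' \<Longrightarrow> F (trunc s' \<rho>) = F \<rho>"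
  by (rule depD) auto

lemma dep_upd: "dep s F \<Longrightarrow> s \<le> s' \<Longrightarrow> F (\<rho>(Suc s' := u)) = F \<rho>"
  by (rule depD) auto

lemma dep_mono: "dep s F \<Longrightarrow> s \<le> s' \<Longrightarrow> dep s' F"
  unfolding dep_def by (meson le_trans)

lemma extends_refl: "consistent S \<Longrightarrow> extends S S"
  by (cases S) auto

lemma extends_trans:
  assumes "extends S S'" "extends S' S''" "consistent S" "consistent S'"
  shows "extends S S''"
proof -
  obtain s A \<theta> s' A' \<theta>' s'' A'' \<theta>'' where S: "S = (s, A, \<theta>)" "S' = (s', A', \<theta>')" "S'' = (s'', A'', \<theta>'')"
    by (metis prod.exhaust)
  from assms have s: "s \<le> s'" "s' \<le> s''" and d: "dep s \<theta>" "dep s' \<theta>'" by (auto simp: S)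
  have "trunc s \<rho> \<in> A \<and> (\<forall>y. \<theta>'' \<rho> y \<longrightarrow> \<theta> \<rho> y)" if "\<rho> \<in> A''" for \<rho>
  proof -
    from that assms(2) have *: "trunc s' \<rho> \<in> A'" "\<And>y. \<theta>'' \<rho> y \<Longrightarrow> \<theta>' \<rho> y" by (auto simp: S)
    from *(1) assms(1) have **: "trunc s (trunc s' \<rho>) \<in> A" "\<And>y. \<theta>' (trunc s' \<rho>) y \<Longrightarrow> \<theta> (trunc s' \<rho>) y"
      by (auto simp: S)
    then show ?thesis
      using *(2) s by (auto simp: trunc_trunc dep_trunc[OF d(1)] dep_trunc[OF d(2)])
  qed
  with s show ?thesis by (auto simp: S)
qed

text \<open>Consistency speaks of all lists of rounds, in particular of those that begin with
  \<open>(Q, B)\<close>; the rest of such a list is survived after that round.\<close>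

lemma ask_step:
  assumes con: "consistent (s, A, \<theta>)" and "pvd Q" "pvd B"
  defines "A' \<equiv> {\<rho>(Suc s := u) | \<rho> u. \<rho> \<in> A \<and> answers s \<rho> \<theta> (Q, B) u}"
  shows "consistent (Suc s, A', \<theta>)" "extends (s, A, \<theta>) (Suc s, A', \<theta>)"
proof -
  have "\<exists>\<rho>\<in>A'. survive (Suc s) \<rho> \<theta> R" if "rounds R" for R
  proof -
    have "rounds ((Q, B) # R)" using that assms(2,3) by (simp add: rounds_def)
    with con obtain \<rho> where "\<rho> \<in> A" "survive s \<rho> \<theta> ((Q, B) # R)" by auto
    then show ?thesis by (auto simp: A'_def)
  qed
  with con show "consistent (Suc s, A', \<theta>)"
    by (auto simp: A'_def trunc_upd intro: dep_mono)
  show "extends (s, A, \<theta>) (Suc s, A', \<theta>)"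
    using con by (auto simp: A'_def trunc_upd)
qed

lemma pvd_trunc: "pvd (\<lambda>\<rho>. trunc s \<rho> i)"
  by (cases "i \<le> s") (auto simp: trunc_def intro: pvd_var pvd_const)

lemma pvd_upd:
  "pvd A \<Longrightarrow> (\<And>i. pvd (\<lambda>\<rho>. G \<rho> i)) \<Longrightarrow> pvd (\<lambda>\<rho>. ((G \<rho>)(k := A \<rho>)) i)"
  by (cases "i = k") auto

text \<open>Pairs are to serve as indices of queries, which are bounded by a length, so their codes
  have to be polynomial as numbers. The code has twice the digits of both numerals, hence the
  squares, and 4 more; with the factor 2 of \<open>val_less_power_length\<close> this gives
  \<open>32 = 2 ^ 5\<close>.\<close>

lemma val_code_pair: "val (code [num j, num l]) \<le> 32 * (Suc j * Suc j) * (Suc l * Suc l)"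
proof -
  have p: "2 ^ length (num m) \<le> Suc m" for m
    using power_length_le_val[of "num m"] by simp
  have exponents: "(2::nat) ^ Suc (2 * a + 2 * b + 4) = 32 * (2 ^ a * 2 ^ a) * (2 ^ b * 2 ^ b)" for a b
    unfolding power_Suc power_add mult_2[of a] mult_2[of b] by simp
  have "val (code [num j, num l]) \<le> 2 ^ Suc (length (code [num j, num l]))"
    using val_less_power_length[of "code [num j, num l]"] by linarith
  also have "length (code [num j, num l]) = 2 * length (num j) + 2 * length (num l) + 4"
    by (simp add: length_code)
  also have "(2::nat) ^ Suc (2 * length (num j) + 2 * length (num l) + 4) =
      32 * (2 ^ length (num j) * 2 ^ length (num j)) * (2 ^ length (num l) * 2 ^ length (num l))"
    by (rule exponents)
  also have "\<dots> \<le> 32 * (Suc j * Suc j) * (Suc l * Suc l)"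
    by (intro mult_mono p order_refl) auto
  finally show ?thesis .
qed

text \<open>
  If every continuation of \<open>\<rho>\<close> with a new constant \<open>j \<le> |B \<rho>|\<close> is refuted by the rounds \<open>R\<close>,
  then playing these rounds for all \<open>j\<close> in parallel yields a sequence of witnesses: \<open>\<tau> \<rho> j\<close> is
  the position reached for \<open>j\<close>, and \<open>y \<rho> j\<close> is a witness in case one has been found already.
\<close>

lemma parallel:
  fixes \<tau> :: "env \<Rightarrow> str \<Rightarrow> env" and y :: "env \<Rightarrow> str \<Rightarrow> str"
  assumes P: "pvp P" and depP: "\<And>a b. dep s0 (\<lambda>\<rho>. P (case_nat a (case_nat b \<rho>)))"
    and B: "pvd B" and depB: "dep s0 B" and dep\<theta>: "dep s0 \<theta>"
    and \<theta>': "\<And>\<rho> y. \<theta>' \<rho> y \<longleftrightarrow> \<theta> \<rho> y \<and> \<not> P (case_nat y (case_nat (\<rho> (Suc s0)) \<rho>))"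
    and "rounds R" "consistent (s, A, \<theta>)" "s0 \<le> s" "Suc s0 \<le> t"
    and \<tau>: "\<And>i. pvd (\<lambda>\<rho>. \<tau> (\<lambda>i. \<rho> (Suc i)) (\<rho> 0) i)"
      "\<And>\<rho> j i. i \<le> s0 \<Longrightarrow> \<tau> \<rho> j i = \<rho> i" "\<And>\<rho> j. \<tau> \<rho> j (Suc s0) = j"
    and y: "pvd (\<lambda>\<rho>. y (\<lambda>i. \<rho> (Suc i)) (\<rho> 0))"
    and refuted: "\<And>\<rho> j. \<rho> \<in> A \<Longrightarrow> j \<le> length (B \<rho>) \<Longrightarrow>
      P (case_nat (y \<rho> (num j)) (case_nat (num j) \<rho>)) \<or> \<not> survive t (\<tau> \<rho> (num j)) \<theta>' R"
  shows "\<exists>s' A' w. consistent (s', A', \<theta>) \<and> extends (s, A, \<theta>) (s', A', \<theta>) \<and> pvd w \<and>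
    (\<forall>\<rho>\<in>A'. \<forall>j\<le>length (B \<rho>). P (case_nat (el (w \<rho>) j) (case_nat (num j) \<rho>)))"
  using assms(7-)
proof (induction R arbitrary: s A t \<tau> y)
  \<comment> \<open>The empty list refutes nothing, so \<open>y\<close> is already a witness for
    every index.\<close>
  case Nil
  have "pvd (\<lambda>\<rho>. code (map (\<lambda>l. y \<rho> (num l)) [0..<Suc (length (B \<rho>))]))"
    by (intro pvd_code_map pvn_Suc pvn_length lenb_Suc lenb_length B) (simp add: Nil)
  moreover have "P (case_nat (el (code (map (\<lambda>l. y \<rho> (num l)) [0..<Suc (length (B \<rho>))])) j)
      (case_nat (num j) \<rho>))" if "\<rho> \<in> A" "j \<le> length (B \<rho>)" for \<rho> j
  proof -
    have "el (code (map (\<lambda>l. y \<rho> (num l)) [0..<Suc (length (B \<rho>))])) j = y \<rho> (num j)"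
      using that(2) by (simp del: upt_Suc add: less_Suc_eq_le)
    then show ?thesis using Nil.prems(9)[OF that] by simp
  qed
  ultimately show ?case using Nil.prems(2) extends_refl[OF Nil.prems(2)] by blast
next
  case (Cons q R)
  obtain Q Bq where q: "q = (Q, Bq)" by (cases q)
  from Cons.prems(1) have Q: "pvd Q" and Bq: "pvd Bq" and R: "rounds R" by (auto simp: q rounds_def)
  note con = Cons.prems(2) and s = Cons.prems(3) and t = Cons.prems(4)
    and \<tau> = Cons.prems(5-7) and y = Cons.prems(8)
  \<comment> \<open>After the round the real position has one more constant; truncation recovers the
    position to which \<open>\<tau>\<close> applies.\<close>
  define \<sigma> where "\<sigma> \<rho> j = \<tau> (trunc s \<rho>) j" for \<rho> j
  have \<sigma>: "pvd (\<lambda>\<rho>. \<sigma> (G \<rho>) (J \<rho>) i)" if "pvd J" "\<And>i. pvd (\<lambda>\<rho>. G \<rho> i)" for J G i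
    unfolding \<sigma>_def
    by (rule pvd_shift[of "\<lambda>\<rho> j. \<tau> \<rho> j i", OF \<tau>(1) that(1)])
      (rule pvd_subst[OF pvd_trunc that(2)])
  \<comment> \<open>One real round asks the queries of all simulated games: the index is read as a
    pair \<open>(j, l)\<close>, and query \<open>l\<close> of game \<open>j\<close> is
    asked.\<close>
  define Q' where "Q' \<rho> = Q ((\<sigma> \<rho> (el (\<rho> (Suc s)) 0))(Suc t := el (\<rho> (Suc s)) 1))" for \<rho>
  have Q': "pvd Q'" unfolding Q'_def
    by (intro pvd_subst[OF Q] pvd_upd \<sigma> pvd_intros)
  define F where "F \<rho> = Bq (\<sigma> (\<lambda>i. \<rho> (Suc i)) (\<rho> 0))" for \<rho>
  have F: "pvd F" unfolding F_def by (intro pvd_subst[OF Bq] \<sigma> pvd_var)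
  \<comment> \<open>The number of queries depends on the game; \<open>M\<close> bounds it for all
    \<open>j\<close> up to the length of \<open>B \<rho>\<close>.\<close>
  define M where "M \<rho> = Max {length (F \<rho>') | \<rho>'. \<forall>i. length (\<rho>' i) \<le>
    case_nat (length (B \<rho>)) (\<lambda>i. length (\<rho> i)) i}" for \<rho>
  have g: "lenb (\<lambda>\<rho>. case_nat (length (B \<rho>)) (\<lambda>i. length (\<rho> i)) i)" for i
    by (cases i) (auto intro: lenb_length B pvd_var)
  have M: "lenb M" unfolding M_def
    by (rule lenb_subst(1)[where g = "\<lambda>i \<rho>. case_nat (length (B \<rho>)) (\<lambda>i. length (\<rho> i)) i", OF F g])
  have le_M: "length (Bq (\<sigma> \<rho> (num j))) \<le> M \<rho>" if "j \<le> length (B \<rho>)" for \<rho> j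
  proof -
    have "length (F (case_nat (num j) \<rho>)) \<le> M \<rho>" unfolding M_def
      by (rule lenb_subst(2)[where g = "\<lambda>i \<rho>. case_nat (length (B \<rho>)) (\<lambda>i. length (\<rho> i)) i", OF F g])
        (use order_trans[OF length_num that] in \<open>auto split: nat.split\<close>)
    then show ?thesis by (simp add: F_def)
  qed
  have "lenb (\<lambda>\<rho>. 32 * (Suc (length (B \<rho>)) * Suc (length (B \<rho>))) * (Suc (M \<rho>) * Suc (M \<rho>)))"
    by (intro lenb_intros B M)
  then obtain B' where B': "pvd B'"
    "\<And>\<rho>. 32 * (Suc (length (B \<rho>)) * Suc (length (B \<rho>))) * (Suc (M \<rho>) * Suc (M \<rho>)) \<le> length (B' \<rho>)"
    unfolding lenb_def by blast
  have le_B': "val (code [num j, num l]) \<le> length (B' \<rho>)"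
    if "j \<le> length (B \<rho>)" "l \<le> length (Bq (\<sigma> \<rho> (num j)))" for \<rho> j l
  proof -
    note val_code_pair
    also have "32 * (Suc j * Suc j) * (Suc l * Suc l) \<le>
        32 * (Suc (length (B \<rho>)) * Suc (length (B \<rho>))) * (Suc (M \<rho>) * Suc (M \<rho>))"
      by (intro mult_mono Suc_le_mono[THEN iffD2] that order_trans[OF that(2) le_M[OF that(1)]]) auto
    also note B'(2)
    finally show ?thesis .
  qed
  define A' where "A' = {\<rho>(Suc s := u) | \<rho> u. \<rho> \<in> A \<and> answers s \<rho> \<theta> (Q', B') u}"
  note step = ask_step[OF con Q' B'(1), folded A'_def]
  \<comment> \<open>The answers for game \<open>j\<close>, cut out of the common sequence of
    answers.\<close>
  define v where "v \<rho> j = code (map (\<lambda>l. el (\<rho> (Suc s)) (val (code [j, num l]))) [0..<Suc (length (Bq (\<sigma> \<rho> j)))])"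
    for \<rho> j
  define \<tau>' where "\<tau>' \<rho> j = (\<sigma> \<rho> j)(Suc t := v \<rho> j)" for \<rho> j
  define Y where "Y \<rho> j l = Q ((\<sigma> \<rho> j)(Suc t := num l))" for \<rho> j l
  \<comment> \<open>A witness found earlier is kept; otherwise a query of this round that satisfies
    \<open>P\<close> is taken, if there is one.\<close>
  define y' where "y' \<rho> j = (if P (case_nat (y (trunc s \<rho>) j) (case_nat j \<rho>)) then y (trunc s \<rho>) j
    else Y \<rho> j (srch (\<lambda>l. P (case_nat (Y \<rho> j l) (case_nat j \<rho>))) (Suc (length (Bq (\<sigma> \<rho> j))))))" for \<rho> j
  have Bq\<sigma>: "pvd (\<lambda>\<rho>. Bq (\<sigma> (G \<rho>) (J \<rho>)))" if "pvd J" "\<And>i. pvd (\<lambda>\<rho>. G \<rho> i)" for J G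
    by (intro pvd_subst[OF Bq] \<sigma> that)
  have Y: "pvd (\<lambda>\<rho>. Y (G \<rho>) (J \<rho>) (L \<rho>))" if "pvd J" "\<And>i. pvd (\<lambda>\<rho>. G \<rho> i)" "pvn L" for J G L
    unfolding Y_def by (intro pvd_subst[OF Q] pvd_upd \<sigma> that pvd_num)
  have \<tau>': "pvd (\<lambda>\<rho>. \<tau>' (\<lambda>i. \<rho> (Suc i)) (\<rho> 0) i)" for i
    unfolding \<tau>'_def v_def
    by (intro pvd_upd \<sigma> pvd_code_map pvn_Suc pvn_length lenb_Suc lenb_length Bq\<sigma> pvd_intros)
  have yt: "pvd (\<lambda>\<rho>. y (trunc s (\<lambda>i. \<rho> (Suc i))) (\<rho> 0))"
    by (rule pvd_shift[of y, OF y pvd_var]) (rule pvd_subst[OF pvd_trunc pvd_var])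
  have y': "pvd (\<lambda>\<rho>. y' (\<lambda>i. \<rho> (Suc i)) (\<rho> 0))"
    unfolding y'_def
    by (intro pvd_if pvp_subst[OF P] pvd_case_nat yt pvd_var Y pvn_srch pvn_Suc pvn_length
        lenb_Suc lenb_length Bq\<sigma> pvn_val)
  have ref: "P (case_nat (y' \<rho> (num j)) (case_nat (num j) \<rho>)) \<or> \<not> survive (Suc t) (\<tau>' \<rho> (num j)) \<theta>' R"
    if "\<rho> \<in> A'" and "j \<le> length (B \<rho>)" for \<rho> j
  proof -
    from \<open>\<rho> \<in> A'\<close> obtain r u where r: "\<rho> = r(Suc s := u)" "r \<in> A" and u: "answers s r \<theta> (Q', B') u"
      unfolding A'_def by blast
    have tr: "trunc s \<rho> = r" "trunc s r = r" using con r by (auto simp: trunc_upd)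
    have \<sigma>\<rho>: "\<sigma> \<rho> = \<tau> r" "\<sigma> r = \<tau> r" unfolding \<sigma>_def tr by simp_all
    have BB: "B \<rho> = B r" unfolding r by (rule dep_upd[OF depB s])
    have PP: "P (case_nat a (case_nat b \<rho>)) = P (case_nat a (case_nat b r))" for a b
      unfolding r by (rule dep_upd[OF depP s])
    from that have j: "j \<le> length (B r)" by (simp add: BB)
    show ?thesis
    proof (cases "P (case_nat (y r (num j)) (case_nat (num j) \<rho>))")
      case True
      then show ?thesis by (simp add: y'_def tr)
    next
      case False
      then have "\<not> survive t (\<tau> r (num j)) \<theta>' (q # R)"
        using Cons.prems(9)[OF r(2) j] by (simp add: PP)
      \<comment> \<open>Game \<open>j\<close> is lost in this round or later. The real answers are
        valid and the queries satisfy \<open>\<theta>\<close>, so a loss in this round can only come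
        from the extra clause of \<open>\<theta>'\<close>: a query satisfies \<open>P\<close> and is
        itself the witness.\<close>
      then consider l where "l \<le> length (Bq (\<tau> r (num j)))"
          "\<not> (\<theta>' (\<tau> r (num j)) (Y \<rho> (num j) l) \<and> valid (\<tau> r (num j) 0) (Y \<rho> (num j) l) (el (v \<rho> (num j)) l))"
        | "\<not> survive (Suc t) (\<tau>' \<rho> (num j)) \<theta>' R"
        unfolding q survive.simps answers_def fst_conv snd_conv Y_def \<tau>'_def \<sigma>\<rho> by blast
      then show ?thesis
      proof cases
        case 1
        let ?c = "val (code [num j, num l])"
        have c: "?c \<le> length (B' r)" using le_B'[OF j] 1(1) by (simp add: \<sigma>\<rho>)
        have Q'c: "Q' (r(Suc s := num ?c)) = Y \<rho> (num j) l"
        proof -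
          have "\<sigma> (r(Suc s := x)) = \<tau> r" for x unfolding \<sigma>_def trunc_upd(1)[OF tr(2)] ..
          then show ?thesis by (simp add: Q'_def Y_def \<sigma>\<rho>)
        qed
        have "el (v \<rho> (num j)) l = el u ?c"
          using 1(1) by (simp add: v_def r(1) \<sigma>\<rho>[unfolded r(1)] less_Suc_eq_le del: upt_Suc)
        with u c have "\<theta> r (Y \<rho> (num j) l)" "valid (r 0) (Y \<rho> (num j) l) (el (v \<rho> (num j)) l)"
          unfolding answers_def using Q'c by auto
        moreover have "\<tau> r (num j) 0 = r 0" "\<theta> (\<tau> r (num j)) = \<theta> r"
          using \<tau>(2) by (auto intro: depD[OF dep\<theta>])
        ultimately have "P (case_nat (Y \<rho> (num j) l) (case_nat (num j) (\<tau> r (num j))))"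
          using 1(2) by (simp add: \<theta>' \<tau>(3))
        also have "P (case_nat (Y \<rho> (num j) l) (case_nat (num j) (\<tau> r (num j)))) =
            P (case_nat (Y \<rho> (num j) l) (case_nat (num j) \<rho>))"
          unfolding PP by (rule depD[OF depP]) (rule \<tau>(2))
        finally show ?thesis
          using False 1(1) srchI[of "\<lambda>l. P (case_nat (Y \<rho> (num j) l) (case_nat (num j) \<rho>))" l
              "Suc (length (Bq (\<sigma> \<rho> (num j))))"]
          by (simp add: y'_def tr \<sigma>\<rho> less_Suc_eq_le del: srch.simps)
      qed simp
    qed
  qed
  have \<tau>'2: "\<tau>' \<rho> j i = \<rho> i" if "i \<le> s0" for \<rho> j i
    using that s t \<tau>(2) by (simp add: \<tau>'_def \<sigma>_def)
  have \<tau>'3: "\<tau>' \<rho> j (Suc s0) = j" for \<rho> j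
    using t \<tau>(3) by (simp add: \<tau>'_def \<sigma>_def)
  have "\<exists>s' A'' w. consistent (s', A'', \<theta>) \<and> extends (Suc s, A', \<theta>) (s', A'', \<theta>) \<and> pvd w \<and>
    (\<forall>\<rho>\<in>A''. \<forall>j\<le>length (B \<rho>). P (case_nat (el (w \<rho>) j) (case_nat (num j) \<rho>)))"
    by (rule Cons.IH[OF R step(1) _ _ \<tau>' \<tau>'2 \<tau>'3 y' ref]) (use s t in auto)
  then show ?case using extends_trans[OF step(2) _ con step(1)] by blast
qed

end

section \<open>Enumeration of the tasks and the limit of the states\<close>

instance pv_fun :: countable
  by countable_datatype

instance pv_term :: countable
  by countable_datatype

lemma pvd_dep:
  assumes "pvd F"
  shows "\<exists>n. dep n F"
proof -
  from assms obtain t where t: "\<And>\<rho>. F \<rho> = tval t \<rho>" unfolding pvd_def by auto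
  obtain n where "tm_below n t" using ex_tm_below by blast
  then have "dep n F" unfolding dep_def t by (auto intro: tval_cong)
  then show ?thesis ..
qed

context game
begin

fun collected :: "(env \<Rightarrow> bool) \<Rightarrow> (env \<Rightarrow> str) \<Rightarrow> state \<Rightarrow> bool" where
  "collected P B (s, A, \<theta>) \<longleftrightarrow>
    (\<exists>w. pvd w \<and> (\<forall>\<rho>\<in>A. \<forall>j\<le>length (B \<rho>). P (case_nat (el (w \<rho>) j) (case_nat (num j) \<rho>))))"

fun refuted :: "(env \<Rightarrow> bool) \<Rightarrow> (env \<Rightarrow> str) \<Rightarrow> state \<Rightarrow> bool" where
  "refuted P B (s, A, \<theta>) \<longleftrightarrow> (\<exists>r\<le>s. \<forall>\<rho>\<in>A. val (\<rho> r) \<le> length (B \<rho>) \<and>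
      (\<forall>y. \<theta> \<rho> y \<longrightarrow> \<not> P (case_nat y (case_nat (\<rho> r) \<rho>))))"

text \<open>A constant for an index without witness is adjoined if that is consistent. Otherwise one
  list of rounds refutes it for all positions and indices, and \<open>parallel\<close> converts this
  list into a definable sequence of witnesses.\<close>

lemma collection_step:
  assumes con: "consistent (s, A, \<theta>)"
    and P: "pvp P" and depP: "\<And>a b. dep s (\<lambda>\<rho>. P (case_nat a (case_nat b \<rho>)))"
    and B: "pvd B" and depB: "dep s B"
  shows "\<exists>S. consistent S \<and> extends (s, A, \<theta>) S \<and> (collected P B S \<or> refuted P B S)"
proof -
  define A' where "A' = {\<rho>(Suc s := num j) | \<rho> j. \<rho> \<in> A \<and> j \<le> length (B \<rho>)}"
  define \<theta>' where "\<theta>' \<rho> y \<longleftrightarrow> \<theta> \<rho> y \<and> \<not> P (case_nat y (case_nat (\<rho> (Suc s)) \<rho>))" for \<rho> y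
  have dep\<theta>: "dep s \<theta>" using con by simp
  have tr: "trunc s \<rho> = \<rho>" if "\<rho> \<in> A" for \<rho> using con that by simp
  have dep\<theta>': "dep (Suc s) \<theta>'"
    unfolding dep_def
  proof (intro allI impI ext)
    fix \<rho> \<rho>' :: env and y assume eq: "\<forall>i\<le>Suc s. \<rho> i = \<rho>' i"
    have "\<theta> \<rho> = \<theta> \<rho>'" by (rule depD[OF dep\<theta>]) (use eq in auto)
    moreover have "P (case_nat y (case_nat a \<rho>)) = P (case_nat y (case_nat a \<rho>'))" for a
      by (rule depD[OF depP]) (use eq in auto)
    ultimately show "\<theta>' \<rho> y = \<theta>' \<rho>' y" using eq by (simp add: \<theta>'_def)
  qed
  show ?thesis
  proof (cases "consistent (Suc s, A', \<theta>')")
    case True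
    moreover have "extends (s, A, \<theta>) (Suc s, A', \<theta>')"
      by (auto simp: A'_def \<theta>'_def trunc_upd tr)
    moreover have "refuted P B (Suc s, A', \<theta>')"
      unfolding refuted.simps
      by (intro exI[of _ "Suc s"]) (auto simp: A'_def \<theta>'_def dep_upd[OF depB])
    ultimately show ?thesis by blast
  next
    case False
    then obtain R where R: "rounds R" "\<And>\<rho>. \<rho> \<in> A' \<Longrightarrow> \<not> survive (Suc s) \<rho> \<theta>' R"
      using dep\<theta>' by (auto simp: A'_def trunc_upd tr)
    have "\<exists>s' A'' w. consistent (s', A'', \<theta>) \<and> extends (s, A, \<theta>) (s', A'', \<theta>) \<and> pvd w \<and>
      (\<forall>\<rho>\<in>A''. \<forall>j\<le>length (B \<rho>). P (case_nat (el (w \<rho>) j) (case_nat (num j) \<rho>)))"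
    \<comment> \<open>The simulated game starts with \<open>j\<close> as the new constant. No
      witness has been found yet, and the empty string is a default: initially the refutation covers
      every index.\<close>
    proof (rule parallel[where R = R and \<theta>' = \<theta>' and t = "Suc s" and \<tau> = "\<lambda>\<rho> j. \<rho>(Suc s := j)"
          and y = "\<lambda>_ _. []", OF P depP B depB dep\<theta> _ R(1) con])
      show "P (case_nat [] (case_nat (num j) \<rho>)) \<or> \<not> survive (Suc s) (\<rho>(Suc s := num j)) \<theta>' R"
        if "\<rho> \<in> A" "j \<le> length (B \<rho>)" for \<rho> j
        using R(2)[of "\<rho>(Suc s := num j)"] that unfolding A'_def by blast
      show "pvd (\<lambda>\<rho>. ((\<lambda>i. \<rho> (Suc i))(Suc s := \<rho> 0)) i)" for i by (intro pvd_upd pvd_var)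
    qed (auto simp: \<theta>'_def intro: pvd_const)
    then show ?thesis by (metis collected.simps)
  qed
qed

text \<open>The decision on collection is conditional because an instance may mention constants that
  do not exist at stage \<open>s\<close>; the enumeration of the tasks returns to it later.\<close>

fun handled :: "(env \<Rightarrow> bool) \<Rightarrow> (env \<Rightarrow> str) \<Rightarrow> (env \<Rightarrow> str) \<Rightarrow> state \<Rightarrow> state \<Rightarrow> bool" where
  "handled P B Q (s, A, \<theta>) (s', A', \<theta>') \<longleftrightarrow> s < s' \<and>
    (\<forall>\<rho>\<in>A'. \<theta> \<rho> (Q (trunc s \<rho>)) \<and> valid (\<rho> 0) (Q (trunc s \<rho>)) (el (\<rho> (Suc s)) 0)) \<and>
    ((\<forall>a b. dep s (\<lambda>\<rho>. P (case_nat a (case_nat b \<rho>)))) \<and> dep s B \<longrightarrow>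
      collected P B (s', A', \<theta>') \<or> refuted P B (s', A', \<theta>'))"

lemma ex_handled:
  assumes con: "consistent S" and P: "pvp P" and B: "pvd B" and Q: "pvd Q"
  shows "\<exists>S'. consistent S' \<and> extends S S' \<and> handled P B Q S S'"
proof -
  obtain s A \<theta> where S: "S = (s, A, \<theta>)" by (metis prod.exhaust)
  note con' = con[unfolded S]
  let ?Q = "\<lambda>\<rho>. Q (trunc s \<rho>)"
  define A1 where "A1 = {\<rho>(Suc s := u) | \<rho> u. \<rho> \<in> A \<and> answers s \<rho> \<theta> (?Q, \<lambda>_. []) u}"
  have "pvd ?Q" by (intro pvd_subst[OF Q] pvd_trunc)
  note step = ask_step[OF con' this pvd_const[of "[]"], folded A1_def]
  have A1: "\<theta> \<rho> (Q (trunc s \<rho>)) \<and> valid (\<rho> 0) (Q (trunc s \<rho>)) (el (\<rho> (Suc s)) 0)"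
    if \<rho>: "trunc (Suc s) \<rho> \<in> A1" for \<rho>
  proof -
    from \<rho> obtain r u where r: "trunc (Suc s) \<rho> = r(Suc s := u)" "r \<in> A" "answers s r \<theta> (?Q, \<lambda>_. []) u"
      unfolding A1_def by blast
    have tr: "trunc s r = r" using con' r by simp
    have "trunc s \<rho> = trunc s (trunc (Suc s) \<rho>)" by (simp add: trunc_trunc)
    also have "\<dots> = r" unfolding r(1) by (rule trunc_upd(1)[OF tr])
    finally have tr\<rho>: "trunc s \<rho> = r" .
    have "\<theta> \<rho> = \<theta> r" unfolding tr\<rho>[symmetric] using con' by (auto simp: dep_trunc)
    moreover have "r 0 = \<rho> 0" unfolding tr\<rho>[symmetric] by simp
    moreover have "\<rho> (Suc s) = u" using fun_cong[OF r(1), of "Suc s"] by simp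
    ultimately show ?thesis using r(3) tr\<rho> unfolding answers_def by (auto simp: trunc_upd[OF tr])
  qed
  show ?thesis
  proof (cases "(\<forall>a b. dep s (\<lambda>\<rho>. P (case_nat a (case_nat b \<rho>)))) \<and> dep s B")
    case True
    then have "dep (Suc s) (\<lambda>\<rho>. P (case_nat a (case_nat b \<rho>)))" "dep (Suc s) B" for a b
      by (auto intro: dep_mono[of s _ "Suc s"])
    from collection_step[OF step(1) P this(1) B this(2)] obtain S'
      where S': "consistent S'" "extends (Suc s, A1, \<theta>) S'" "collected P B S' \<or> refuted P B S'"
      by blast
    obtain s' A' \<theta>' where S'_eq: "S' = (s', A', \<theta>')" by (metis prod.exhaust)
    have "extends S S'" unfolding S by (rule extends_trans[OF step(2) S'(2) con' step(1)])
    moreover have "handled P B Q S S'"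
      unfolding S S'_eq handled.simps
    proof (intro conjI ballI impI)
      show "s < s'" using S'(2) by (simp add: S'_eq)
      show "collected P B (s', A', \<theta>') \<or> refuted P B (s', A', \<theta>')" using S'(3) by (simp only: S'_eq)
      fix \<rho> assume "\<rho> \<in> A'"
      then have "trunc (Suc s) \<rho> \<in> A1" using S'(2) by (simp add: S'_eq)
      from A1[OF this] show "\<theta> \<rho> (Q (trunc s \<rho>))"
        "valid (\<rho> 0) (Q (trunc s \<rho>)) (el (\<rho> (Suc s)) 0)" by blast+
    qed
    ultimately show ?thesis using S'(1) by blast
  next
    case False
    have "trunc (Suc s) \<rho> = \<rho>" if "\<rho> \<in> A1" for \<rho> using step(1) that by simp
    then have "\<theta> \<rho> (Q (trunc s \<rho>)) \<and> valid (\<rho> 0) (Q (trunc s \<rho>)) (el (\<rho> (Suc s)) 0)"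
      if "\<rho> \<in> A1" for \<rho> using A1[of \<rho>] that by simp
    with False have "handled P B Q S (Suc s, A1, \<theta>)"
      unfolding S handled.simps by blast
    then show ?thesis using step S by blast
  qed
qed

lemma extends_chain:
  assumes "\<And>d. consistent (f d)" "\<And>d. extends (f d) (f (Suc d))" "d \<le> e"
  shows "extends (f d) (f e)"
  using assms(3)
proof (induction e rule: dec_induct)
  case base
  show ?case by (rule extends_refl) (rule assms)
next
  case (step n)
  then show ?case by (intro extends_trans[OF _ assms(2) assms(1,1)])
qed

text \<open>The states form a generic sequence in which every task recurs. A position
  \<open>\<alpha> i\<close> chosen from state \<open>i\<close> truncates to a position of each
  earlier state, so what state \<open>d\<close> guarantees holds for all \<open>i \<ge> d\<close>
  and hence almost everywhere.\<close>

theorem ex_bb_model: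
  assumes start: "\<And>R. rounds R \<Longrightarrow>
    \<exists>N. S N \<and> survive 0 ((\<lambda>_. [])(0 := N)) (\<lambda>_ _. True) R"
  shows "\<exists>U E N. bb_model U E \<and> N \<in> E \<and> (\<forall>i. S (N i)) \<and>
    (\<forall>C\<in>E. \<exists>a\<in>E. \<forall>\<^sub>F i in U. valid (N i) (C i) (a i))"
proof -
  define S0 :: state where "S0 = (0, {(\<lambda>_. [])(0 := N) | N. S N}, \<lambda>_ _. True)"
  have S0: "consistent S0"
    unfolding S0_def consistent.simps
  proof (intro conjI allI impI ballI)
    show "trunc 0 \<rho> = \<rho>" if "\<rho> \<in> {(\<lambda>_. [])(0 := N) | N. S N}" for \<rho>
      using that by (auto simp: trunc_def)
    show "dep 0 (\<lambda>_ _. True)" by (simp add: dep_def)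
    show "\<exists>\<rho>\<in>{(\<lambda>_. [])(0 := N) | N. S N}. survive 0 \<rho> (\<lambda>_ _. True) R" if "rounds R" for R
      using start[OF that] by blast
  qed
  define fix_term where "fix_term t = (if is_pv_term t then t else zero)" for t
  \<comment> \<open>The second component of the decoded pair is padding, by which every triple
    occurs at arbitrarily late stages.\<close>
  define e where "e d = (case from_nat (fst (prod_decode d)) of (t1, t2, t3) \<Rightarrow>
    (fix_term t1, fix_term t2, fix_term t3))" for d :: nat
  have fix_term: "is_pv_term (fix_term t)" for t by (simp add: fix_term_def)
  have e: "\<exists>d\<ge>m. e d = (t1, t2, t3)" if "is_pv_term t1" "is_pv_term t2" "is_pv_term t3" for m t1 t2 t3
    using that by (intro exI[of _ "prod_encode (to_nat (t1, t2, t3), m)"])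
      (auto simp: e_def fix_term_def le_prod_encode_2)
  define task where "task d = (case e d of (t1, t2, t3) \<Rightarrow> handled (\<lambda>\<rho>. tru (tval t1 \<rho>)) (tval t2) (tval t3))" for d
  have "\<exists>f. \<forall>d. (consistent (f d) \<and> extends S0 (f d) \<and> d \<le> fst (f d)) \<and>
      (extends (f d) (f (Suc d)) \<and> task d (f d) (f (Suc d)))"
  proof (rule dependent_nat_choice)
    show "\<exists>S. consistent S \<and> extends S0 S \<and> 0 \<le> fst S"
      using S0 extends_refl by blast
    fix S d assume S: "consistent S \<and> extends S0 S \<and> d \<le> fst S"
    obtain t1 t2 t3 where t: "e d = (t1, t2, t3)" by (metis prod.exhaust)
    then have "is_pv_term t1" "is_pv_term t2" "is_pv_term t3"
      using fix_term by (auto simp: e_def split: prod.splits)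
    then have "pvp (\<lambda>\<rho>. tru (tval t1 \<rho>))" "pvd (tval t2)" "pvd (tval t3)"
      by (simp_all add: pvp_tru pvd_tval)
    from ex_handled[OF _ this, of S] S obtain S' where S': "consistent S'" "extends S S'"
      "handled (\<lambda>\<rho>. tru (tval t1 \<rho>)) (tval t2) (tval t3) S S'" by blast
    from S'(3) S have "Suc d \<le> fst S'" by (cases S; cases S') auto
    moreover have "extends S0 S'" using S S' S0 by (blast intro: extends_trans)
    ultimately show "\<exists>S'. (consistent S' \<and> extends S0 S' \<and> Suc d \<le> fst S') \<and> extends S S' \<and> task d S S'"
      using S' unfolding task_def t prod.case by blast
  qed
  then obtain f where f: "\<And>d. consistent (f d)" "\<And>d. extends S0 (f d)" "\<And>d. d \<le> fst (f d)"
    "\<And>d. extends (f d) (f (Suc d))" "\<And>d. task d (f d) (f (Suc d))" by blast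
  define s where "s d = fst (f d)" for d
  define A where "A d = fst (snd (f d))" for d
  define \<theta> where "\<theta> d = snd (snd (f d))" for d
  have f_eq: "f d = (s d, A d, \<theta> d)" for d by (simp add: s_def A_def \<theta>_def)
  have "\<exists>\<rho>. \<rho> \<in> A d" for d
    using f(1)[of d] unfolding f_eq by (auto simp: rounds_def dest: spec[of _ "[]"])
  then obtain \<alpha> where \<alpha>: "\<And>i. \<alpha> i \<in> A i" by metis
  have ext: "extends (s d, A d, \<theta> d) (s d', A d', \<theta> d')" if "d \<le> d'" for d d'
    using extends_chain[of f, OF f(1,4) that] by (simp add: f_eq)
  have \<alpha>A: "trunc (s d) (\<alpha> i) \<in> A d" if "d \<le> i" for d i
    using ext[OF that] \<alpha>[of i] by auto
  have s_mono: "s d \<le> s d'" if "d \<le> d'" for d d' using ext[OF that] by auto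
  have s_ge: "d \<le> s d" for d using f(3) by (simp add: s_def)
  have dep\<theta>: "dep (s d) (\<theta> d)" for d using f(1)[of d] by (simp add: f_eq)
  obtain U :: "nat filter" where U: "U \<le> sequentially"
    "\<And>A. (\<forall>\<^sub>F i in U. \<not> A i) \<longleftrightarrow> \<not> (\<forall>\<^sub>F i in U. A i)"
    using ex_free_ultrafilter by blast
  have ev_ge: "\<forall>\<^sub>F i in U. d \<le> i" for d
    using U(1) eventually_ge_at_top[of d] by (auto simp: le_filter_def)
  define E where "E = {\<lambda>i. F (\<alpha> i) | F. pvd F}"
  have E: "(\<lambda>i. F (\<alpha> i)) \<in> E" if "pvd F" for F using that unfolding E_def by blast
  \<comment> \<open>A promise concerns strings that may be named only later. It takes effect because
    each element of \<open>E\<close> is itself asked as a query beyond any given stage.\<close>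
  have query: "\<exists>a\<in>E. \<exists>d\<ge>m. \<forall>\<^sub>F i in U. valid (\<alpha> i 0) (C i) (a i) \<and> \<theta> d (trunc (s d) (\<alpha> i)) (C i)"
    if "C \<in> E" for C m
  proof -
    from that obtain F where F: "C = (\<lambda>i. F (\<alpha> i))" "pvd F" unfolding E_def by blast
    from F(2) obtain t where t: "is_pv_term t" "\<And>\<rho>. F \<rho> = tval t \<rho>" unfolding pvd_def by blast
    obtain n where n: "dep n F" using pvd_dep[OF F(2)] by blast
    from e[of zero zero t "m + n"] t obtain d where d: "m + n \<le> d" "e d = (zero, zero, t)" by auto
    have H: "\<theta> d \<rho> (F (trunc (s d) \<rho>)) \<and> valid (\<rho> 0) (F (trunc (s d) \<rho>)) (el (\<rho> (Suc (s d))) 0)"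
      "s d < s (Suc d)"
      if "\<rho> \<in> A (Suc d)" for \<rho>
      using f(5)[of d] that by (auto simp: task_def d f_eq t(2))
    have "valid (\<alpha> i 0) (C i) (el (\<alpha> i (Suc (s d))) 0) \<and> \<theta> d (trunc (s d) (\<alpha> i)) (C i)"
      if "Suc d \<le> i" for i
    proof -
      let ?r = "trunc (s (Suc d)) (\<alpha> i)"
      note r = \<alpha>A[OF that]
      have sd: "s d < s (Suc d)" by (rule H(2)[OF r])
      then have "trunc (s d) ?r = trunc (s d) (\<alpha> i)" by (simp add: trunc_trunc)
      moreover have "F (trunc (s d) (\<alpha> i)) = C i"
        unfolding F(1) by (rule dep_trunc[OF n]) (use s_ge[of d] d(1) in linarith)
      moreover have "\<theta> d ?r = \<theta> d (trunc (s d) (\<alpha> i))"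
        using sd by (simp add: dep_trunc[OF dep\<theta>])
      moreover have "?r 0 = \<alpha> i 0" "?r (Suc (s d)) = \<alpha> i (Suc (s d))" using sd by simp_all
      ultimately show ?thesis using H(1)[OF r] by metis
    qed
    then have "\<forall>\<^sub>F i in U. valid (\<alpha> i 0) (C i) (el (\<alpha> i (Suc (s d))) 0) \<and> \<theta> d (trunc (s d) (\<alpha> i)) (C i)"
      by (rule eventually_mono[OF ev_ge[of "Suc d"]])
    moreover have "(\<lambda>i. el (\<alpha> i (Suc (s d))) 0) \<in> E" by (rule E) (intro pvd_intros)
    moreover have "m \<le> d" using d(1) by simp
    ultimately show ?thesis by (intro bexI exI[of _ d] conjI)
  qed
  have "bb_model U E"
  proof
    show "(\<forall>\<^sub>F i in U. \<not> A i) \<longleftrightarrow> \<not> (\<forall>\<^sub>F i in U. A i)" for A by (rule U)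
  next
    fix F :: "env \<Rightarrow> str" and x :: "nat \<Rightarrow> nat \<Rightarrow> str"
    assume F: "pvd F" and x: "\<And>v. x v \<in> E"
    then have "\<forall>v. \<exists>G. x v = (\<lambda>i. G (\<alpha> i)) \<and> pvd G" unfolding E_def by blast
    then obtain G where G: "\<And>v. x v = (\<lambda>i. G v (\<alpha> i))" "\<And>v. pvd (G v)" by metis
    have "pvd (\<lambda>\<rho>. F (\<lambda>v. G v \<rho>))" by (rule pvd_subst[OF F]) (use G in auto)
    from E[OF this] show "(\<lambda>i. F (\<lambda>v. x v i)) \<in> E" by (simp add: G(1))
  next
    fix P B and x :: "nat \<Rightarrow> nat \<Rightarrow> str"
    assume P: "pvp P" and B: "pvd B" and x: "\<And>v. x v \<in> E"
      and hyp: "\<And>j. j \<in> E \<Longrightarrow> \<forall>\<^sub>F i in U. val (j i) \<le> length (B (\<lambda>v. x v i)) \<Longrightarrow>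
        \<exists>z\<in>E. \<forall>\<^sub>F i in U. P (case_nat (z i) (case_nat (j i) (\<lambda>v. x v i)))"
    from x have "\<forall>v. \<exists>G. x v = (\<lambda>i. G (\<alpha> i)) \<and> pvd G" unfolding E_def by blast
    then obtain G where G: "\<And>v. x v = (\<lambda>i. G v (\<alpha> i))" "\<And>v. pvd (G v)" by metis
    define P' where "P' \<rho> = P (case_nat (\<rho> 0) (case_nat (\<rho> 1) (\<lambda>v. G v (\<lambda>i. \<rho> (Suc (Suc i))))))" for \<rho>
    define B' where "B' \<rho> = B (\<lambda>v. G v \<rho>)" for \<rho>
    have P'_eq: "P' (case_nat z (case_nat j \<rho>)) = P (case_nat z (case_nat j (\<lambda>v. G v \<rho>)))" for z j \<rho>
      by (simp add: P'_def)
    have P': "pvp P'" unfolding P'_def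
      by (intro pvp_subst[OF P] pvd_case_nat pvd_var pvd_subst[OF G(2)])
    then obtain t1 where t1: "is_pv_term t1" "\<And>\<rho>. bv (P' \<rho>) = tval t1 \<rho>"
      unfolding pvp_def pvd_def by blast
    have t1_eq: "(\<lambda>\<rho>. tru (tval t1 \<rho>)) = P'" by (simp add: t1(2)[symmetric])
    have B': "pvd B'" unfolding B'_def by (rule pvd_subst[OF B]) (rule G(2))
    then obtain t2 where t2: "is_pv_term t2" "B' = tval t2" unfolding pvd_def by blast
    obtain n1 where "dep n1 (\<lambda>\<rho>. bv (P' \<rho>))" using pvd_dep P' unfolding pvp_def by blast
    then have n1: "dep n1 (\<lambda>\<rho>. P' (case_nat a (case_nat b \<rho>)))" for a b
      unfolding dep_def by (auto split: nat.split)
    obtain n2 where n2: "dep n2 B'" using pvd_dep[OF B'] by blast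
    from e[OF t1(1) t2(1), of zero "n1 + n2"] obtain d where d: "n1 + n2 \<le> d" "e d = (t1, t2, zero)"
      by auto
    have depP: "dep (s d) (\<lambda>\<rho>. P' (case_nat a (case_nat b \<rho>)))" for a b
      by (rule dep_mono[OF n1]) (use d s_ge[of d] in linarith)
    have depB: "dep (s d) B'"
      by (rule dep_mono[OF n2]) (use d s_ge[of d] in linarith)
    have sd: "s d \<le> s (Suc d)" by (rule s_mono) simp
    have P'_trunc: "P' (case_nat a (case_nat b (trunc (s (Suc d)) \<rho>))) = P' (case_nat a (case_nat b \<rho>))" for a b \<rho>
      by (rule dep_trunc[OF depP sd])
    have B'_trunc: "B' (trunc (s (Suc d)) \<rho>) = B' \<rho>" for \<rho>
      by (rule dep_trunc[OF depB sd])
    have "task d (f d) (f (Suc d))" by (rule f)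
    then have "collected P' B' (s (Suc d), A (Suc d), \<theta> (Suc d)) \<or> refuted P' B' (s (Suc d), A (Suc d), \<theta> (Suc d))"
      using depP depB unfolding task_def d(2) prod.case t1_eq t2(2)[symmetric] f_eq handled.simps by blast
    then show "\<exists>w\<in>E. \<forall>\<^sub>F i in U. \<forall>j\<le>length (B (\<lambda>v. x v i)).
        P (case_nat (el (w i) j) (case_nat (num j) (\<lambda>v. x v i)))"
    proof
      assume "collected P' B' (s (Suc d), A (Suc d), \<theta> (Suc d))"
      then obtain w where w: "pvd w" "\<And>\<rho> j. \<rho> \<in> A (Suc d) \<Longrightarrow> j \<le> length (B' \<rho>) \<Longrightarrow>
          P' (case_nat (el (w \<rho>) j) (case_nat (num j) \<rho>))" by auto
      have "(\<lambda>i. w (trunc (s (Suc d)) (\<alpha> i))) \<in> E"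
        by (rule E) (rule pvd_subst[OF w(1) pvd_trunc])
      moreover have "\<forall>\<^sub>F i in U. \<forall>j\<le>length (B (\<lambda>v. x v i)).
          P (case_nat (el (w (trunc (s (Suc d)) (\<alpha> i))) j) (case_nat (num j) (\<lambda>v. x v i)))"
        using ev_ge[of "Suc d"]
      proof (rule eventually_mono)
        fix i assume "Suc d \<le> i"
        from w(2)[OF \<alpha>A[OF this], unfolded P'_trunc B'_trunc]
        show "\<forall>j\<le>length (B (\<lambda>v. x v i)).
            P (case_nat (el (w (trunc (s (Suc d)) (\<alpha> i))) j) (case_nat (num j) (\<lambda>v. x v i)))"
          unfolding P'_eq G(1) B'_def by blast
      qed
      ultimately show ?thesis by (intro bexI[of _ "\<lambda>i. w (trunc (s (Suc d)) (\<alpha> i))"])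
    next
      assume "refuted P' B' (s (Suc d), A (Suc d), \<theta> (Suc d))"
      then obtain r where r: "r \<le> s (Suc d)" "\<And>\<rho>. \<rho> \<in> A (Suc d) \<Longrightarrow> val (\<rho> r) \<le> length (B' \<rho>)"
        "\<And>\<rho> y. \<rho> \<in> A (Suc d) \<Longrightarrow> \<theta> (Suc d) \<rho> y \<Longrightarrow> \<not> P' (case_nat y (case_nat (\<rho> r) \<rho>))"
        by auto
      have bnd: "val (\<alpha> i r) \<le> length (B' (\<alpha> i))" if "Suc d \<le> i" for i
        using r(2)[OF \<alpha>A[OF that]] r(1) by (simp add: B'_trunc)
      have "(\<lambda>i. \<alpha> i r) \<in> E" by (rule E) (rule pvd_var)
      moreover have "\<forall>\<^sub>F i in U. val (\<alpha> i r) \<le> length (B (\<lambda>v. x v i))"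
        using ev_ge[of "Suc d"] by (rule eventually_mono) (use bnd in \<open>simp add: B'_def G(1)\<close>)
      ultimately obtain z where z: "z \<in> E"
        "\<forall>\<^sub>F i in U. P (case_nat (z i) (case_nat (\<alpha> i r) (\<lambda>v. x v i)))"
        using hyp by blast
      \<comment> \<open>The alleged witness \<open>z\<close> was asked after the promise was made,
        and promises only get stronger; so \<open>z\<close> obeys the promise that it is no
        witness.\<close>
      from query[OF z(1), of "Suc d"] obtain d' where d': "Suc d \<le> d'"
        "\<forall>\<^sub>F i in U. \<theta> d' (trunc (s d') (\<alpha> i)) (z i)"
        unfolding eventually_conj_iff by blast
      have "\<not> P (case_nat (z i) (case_nat (\<alpha> i r) (\<lambda>v. x v i)))"
        if "\<theta> d' (trunc (s d') (\<alpha> i)) (z i)" "d' \<le> i" for i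
      proof -
        have "\<theta> (Suc d) (trunc (s d') (\<alpha> i)) (z i)"
          using ext[OF d'(1)] \<alpha>A[OF that(2)] that(1) by auto
        then have "\<theta> (Suc d) (trunc (s (Suc d)) (\<alpha> i)) (z i)"
          using s_mono[OF d'(1)] by (simp add: dep_trunc[OF dep\<theta>])
        moreover have "Suc d \<le> i" using that(2) d'(1) by simp
        ultimately show ?thesis
          using r(3)[OF \<alpha>A] r(1) by (auto simp: P'_trunc P'_eq[symmetric] G(1))
      qed
      with d'(2) ev_ge[of d'] have "\<forall>\<^sub>F i in U. \<not> P (case_nat (z i) (case_nat (\<alpha> i r) (\<lambda>v. x v i)))"
        by (auto elim: eventually_elim2)
      with z(2) U(2) show ?thesis by blast
    qed
  qed
  moreover have "(\<lambda>i. \<alpha> i 0) \<in> E" by (rule E) (rule pvd_var)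
  moreover have "S (\<alpha> i 0)" for i
  proof -
    have "trunc 0 (\<alpha> i) \<in> {(\<lambda>_. [])(0 := N) | N. S N}"
      using f(2)[of i] \<alpha>[of i] by (simp add: S0_def f_eq)
    then obtain N where "S N" "trunc 0 (\<alpha> i) = (\<lambda>_. [])(0 := N)" by blast
    then show ?thesis by (metis fun_upd_same trunc_le le_refl)
  qed
  moreover have "\<exists>a\<in>E. \<forall>\<^sub>F i in U. valid (\<alpha> i 0) (C i) (a i)" if "C \<in> E" for C
    using query[OF that, of 0] unfolding eventually_conj_iff by blast
  ultimately show ?thesis by blast
qed

end

section \<open>Circuits\<close>

lemma val_digit_2 [simp]: "val [False] = 2"
  by simp

definition gate_out :: "str \<Rightarrow> str \<Rightarrow> bool" where
  "gate_out g v = (let a = tru (fval digit_fun [el g 1, v]); b = tru (fval digit_fun [el g 2, v]) in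
     if el g 0 = [] then a \<and> b else if el g 0 = [True] then a \<or> b else \<not> a)"

lemma gate_out_cong: "(\<And>i. i < 3 \<Longrightarrow> el g i = el g' i) \<Longrightarrow> gate_out g v = gate_out g' v"
  by (simp add: gate_out_def)

text \<open>The digits of the constants false and true are leftmost, hence last in the list, and new
  values are prepended. So node \<open>i\<close> is digit \<open>i\<close> counted from the
  left.\<close>

primrec nodes :: "str \<Rightarrow> str \<Rightarrow> nat \<Rightarrow> str" where
  "nodes gs x 0 = x @ [True, False]"
| "nodes gs x (Suc n) =
    (if n < cnt gs then gate_out (el gs n) (nodes gs x n) # nodes gs x n else nodes gs x n)"

lemma length_nodes: "length (nodes gs x n) \<le> length x + 2 + min n (cnt gs)"
  by (induction n) auto

lemma nodes_stable: "cnt gs \<le> n \<Longrightarrow> nodes gs x n = nodes gs x (cnt gs)"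
  by (induction n rule: dec_induct) auto

text \<open>Conditions are conditional terms themselves; these rules keep them folded.\<close>

lemma tval_gate:
  "tru (tval (ite e (conj a b) (ite e' (disj a b) (neg a))) \<rho>) \<longleftrightarrow>
    (let a = tru (tval a \<rho>); b = tru (tval b \<rho>) in
     if tru (tval e \<rho>) then a \<and> b else if tru (tval e' \<rho>) then a \<or> b else \<not> a)"
  "tval (ite e (ite b (s1 a) (s2 a)) a) \<rho> =
    (if tru (tval e \<rho>) then tru (tval b \<rho>) # tval a \<rho> else tval a \<rho>)"
  "tval (conj a (disj b e)) \<rho> = bv (tru (tval a \<rho>) \<and> (tru (tval b \<rho>) \<or> tru (tval e \<rho>)))"
  "tval (conj a (conj b e)) \<rho> = bv (tru (tval a \<rho>) \<and> tru (tval b \<rho>) \<and> tru (tval e \<rho>))"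
  by (auto simp: bv_def Let_def)

lemma tval_lt: "tru (tval (lt s t) \<rho>) \<longleftrightarrow> val (tval s \<rho>) < val (tval t \<rho>)"
  by auto

lemma tval_gate_val: "tru (tval (gate_val g v) \<rho>) = gate_out (tval g \<rho>) (tval v \<rho>)"
  unfolding Let_def tval_gate(1) tval_eq by (simp add: gate_out_def Let_def numeral_2_eq_2 del: fval_digit)

lemma tval_is_gate:
  "tru (tval (is_gate t m) \<rho>) \<longleftrightarrow> cnt (tval t \<rho>) = 3 \<and> val (el (tval t \<rho>) 0) \<le> 2 \<and>
    val (el (tval t \<rho>) 1) < val (tval m \<rho>) \<and> val (el (tval t \<rho>) 2) < val (tval m \<rho>)"
proof -
  have "num 3 = [True, True]" by (simp add: numeral_3_eq_3)
  then have "num n = [True, True] \<longleftrightarrow> n = 3" for n by (metis num_inj)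
  then show ?thesis unfolding tval_gate(4) tval_eq tval_lt tru_simps
    by (simp add: numeral_2_eq_2 not_le)
qed

lemma fval_node_vals [simp]: "fval node_vals_fun [gs, x, u] = nodes gs x (length u)"
  unfolding node_vals_fun_def
proof (subst Let_def, rule fval_lrec_2[where R = "\<lambda>u. nodes gs x (length u)"], goal_cases)
  case (3 d y)
  show ?case unfolding if_cancel tval_gate(2) tval_gate_val tval_lt
    by (simp add: numeral_3_eq_3 numeral_2_eq_2)
next
  case (4 d y)
  show ?case using length_nodes[of gs x "length (d # y)"] by simp
qed auto

lemma fval_circuit_val:
  "fval circuit_val_fun [C, x] =
    bv (tru (fval digit_fun [el C 1, nodes (el C 0) x (cnt (el C 0))]))"
  using nodes_stable[OF cnt_le_length, of "el C 0" x] by (simp add: circuit_val_fun_def bv_def del: fval_digit)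

text \<open>Evaluation reads only three elements of each gate; this allows \<open>norm\<close> to
  drop the other digits of a code.\<close>

lemma circuit_val_cong:
  assumes "cnt (el C 0) = cnt (el C' 0)" "el C 1 = el C' 1"
    "\<And>l i. l < cnt (el C 0) \<Longrightarrow> i < 3 \<Longrightarrow> el (el (el C 0) l) i = el (el (el C' 0) l) i"
  shows "fval circuit_val_fun [C, x] = fval circuit_val_fun [C', x]"
proof -
  have "n \<le> cnt (el C 0) \<Longrightarrow> nodes (el C 0) x n = nodes (el C' 0) x n" for n
  proof (induction n)
    case (Suc n)
    then have "gate_out (el (el C 0) n) v = gate_out (el (el C' 0) n) v" for v
      by (intro gate_out_cong assms(3)) auto
    with Suc assms(1) show ?case by simp
  qed simp
  then show ?thesis using assms by (simp add: fval_circuit_val del: fval_digit)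
qed

section \<open>Bounds on codes of circuits\<close>

lemma fval_are_gates:
  "fval are_gates_fun [gs, x, u] = bv (\<forall>l<length u. l < cnt gs \<longrightarrow> cnt (el gs l) = 3 \<and>
    val (el (el gs l) 0) \<le> 2 \<and> val (el (el gs l) 1) < length x + 2 + l \<and>
    val (el (el gs l) 2) < length x + 2 + l)" (is "_ = ?R u")
  unfolding are_gates_fun_def
proof (subst Let_def, rule fval_lrec_2[where R = ?R], goal_cases)
  case (3 d y)
  have neg: "tru (tval (neg e) \<rho>) \<longleftrightarrow> \<not> tru (tval e \<rho>)" for e \<rho> by simp
  show ?case unfolding if_cancel tval_gate(3) tval_is_gate neg tval_lt
    by (simp add: numeral_3_eq_3 numeral_2_eq_2) (auto simp: less_Suc_eq)
qed (auto simp: bv_def)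

lemma is_circuit_bounds:
  assumes "fval is_circuit_fun [C, x] = [True]"
  defines "n \<equiv> 2 + length x + cnt (el C 0)"
  shows "val (el C 1) \<le> n"
    "l < cnt (el C 0) \<Longrightarrow> i < 3 \<Longrightarrow> val (el (el (el C 0) l) i) \<le> n"
proof -
  let ?gs = "el C 0"
  have "tru (fval are_gates_fun [?gs, x, ?gs])"
    and out: "val (el C 1) < length (nodes ?gs x (length ?gs))"
    using assms(1) unfolding is_circuit_fun_def fval.simps tval_gate(4) tval_lt
    by simp_all
  then have gates: "\<forall>l<length ?gs. l < cnt ?gs \<longrightarrow> cnt (el ?gs l) = 3 \<and>
    val (el (el ?gs l) 0) \<le> 2 \<and> val (el (el ?gs l) 1) < length x + 2 + l \<and>
    val (el (el ?gs l) 2) < length x + 2 + l" by (simp add: fval_are_gates)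
  show "val (el C 1) \<le> n" using out length_nodes[of ?gs x "length ?gs"] by (simp add: n_def)
  assume l: "l < cnt ?gs" "i < 3"
  then have "l < length ?gs" using cnt_le_length[of ?gs] by simp
  with gates l have "val (el (el ?gs l) 0) \<le> 2" "val (el (el ?gs l) 1) < length x + 2 + l"
    "val (el (el ?gs l) 2) < length x + 2 + l" by auto
  moreover from l(2) have "i = 0 \<or> i = 1 \<or> i = 2" by auto
  ultimately show "val (el (el ?gs l) i) \<le> n" using l(1) by (auto simp: n_def)
qed

text \<open>A code of the same circuit without redundant digits, hence short.\<close>

definition norm :: "str \<Rightarrow> str" where
  "norm C = code [code (map (\<lambda>l. code [el (el (el C 0) l) 0, el (el (el C 0) l) 1, el (el (el C 0) l) 2])
     [0..<cnt (el C 0)]), el C 1]"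

lemma circuit_val_norm: "fval circuit_val_fun [norm C, x] = fval circuit_val_fun [C, x]"
proof (rule circuit_val_cong)
  show "cnt (el (norm C) 0) = cnt (el C 0)" "el (norm C) 1 = el C 1" by (simp_all add: norm_def)
  show "el (el (el (norm C) 0) l) i = el (el (el C 0) l) i" if "l < cnt (el (norm C) 0)" "i < 3" for l i
  proof -
    from that(2) consider "i = 0" | "i = 1" | "i = 2" by linarith
    then show ?thesis using that(1) by cases (auto simp: norm_def)
  qed
qed

lemma pvd_norm: "pvd A \<Longrightarrow> pvd (\<lambda>\<rho>. norm (A \<rho>))"
proof -
  assume A: "pvd A"
  have "pvd (\<lambda>\<rho>. norm (\<rho> 0))"
    unfolding norm_def
    by (intro pvd_code pvd_code_map pvd_intros lenb_mono[OF lenb_length cnt_le_length])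
  then show ?thesis using pvd_subst[of "\<lambda>\<rho>. norm (\<rho> 0)" "\<lambda>\<rho> _. A \<rho>"] A by simp
qed

definition circ :: "nat \<Rightarrow> nat \<Rightarrow> nat \<Rightarrow> str \<Rightarrow> bool" where
  "circ k c n C \<longleftrightarrow>
    fval is_circuit_fun [C, replicate n True] = [True] \<and> cnt (el C 0) \<le> c * n ^ k"

text \<open>Even if a numeral is estimated by its value, a normalised code has of the order of gates
  times nodes many digits, and both numbers are at most \<open>(c + 3) * n ^ k\<close>. One factor
  \<open>n\<close> absorbs the constant, so the exponent \<open>2 * k + 1\<close> is independent of
  \<open>c\<close>.\<close>

lemma length_norm:
  assumes "circ k c n C" "k \<ge> 1" "58 * (c + 3) ^ 2 \<le> n"
  shows "length (norm C) \<le> n ^ (2 * k + 1)"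
proof -
  let ?s = "cnt (el C 0)"
  define N where "N = 2 + n + ?s"
  have "fval is_circuit_fun [C, replicate n True] = [True]" using assms(1) by (simp add: circ_def)
  note b = is_circuit_bounds[OF this, unfolded length_replicate, folded N_def]
  have len: "length (el (el (el C 0) l) i) \<le> N" if "l < ?s" "i < 3" for l i
    using order_trans[OF length_le_val b(2)[OF that]] .
  have gate: "length (code [el (el (el C 0) l) 0, el (el (el C 0) l) 1, el (el (el C 0) l) 2]) \<le> 6 * N + 6"
    if "l < ?s" for l
    using len[OF that, of 0] len[OF that, of 1] len[OF that, of 2] by (simp add: length_code)
  have "length (code (map (\<lambda>l. code [el (el (el C 0) l) 0, el (el (el C 0) l) 1, el (el (el C 0) l) 2])
     [0..<?s])) = (\<Sum>l<?s. 2 * length (code [el (el (el C 0) l) 0, el (el (el C 0) l) 1, el (el (el C 0) l) 2]) + 2)"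
    by (simp add: length_code[of "map _ _"] comp_def sum_list_sum_nth atLeast0LessThan)
  also have "\<dots> \<le> (\<Sum>l<?s. 2 * (6 * N + 6) + 2)"
    by (intro sum_mono add_mono mult_left_mono gate) auto
  also have "\<dots> = ?s * (12 * N + 14)" by simp
  also have "\<dots> \<le> N * (12 * N + 14)" by (intro mult_right_mono) (auto simp: N_def)
  finally have "length (norm C) \<le> 2 * (N * (12 * N + 14)) + 2 * length (el C 1) + 4"
    unfolding norm_def by (simp add: length_code[of "[_, _]"])
  also have "length (el C 1) \<le> N" using order_trans[OF length_le_val b(1)] .
  \<comment> \<open>The left side is \<open>24 * N ^ 2 + 30 * N + 4\<close>, and 58 is the sum of
    its coefficients.\<close>
  also have "2 * (N * (12 * N + 14)) + 2 * N + 4 \<le> 58 * (N * N)"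
  proof -
    have "1 \<le> N" by (simp add: N_def)
    then have "N \<le> N * N" "1 \<le> N * N" by auto
    moreover have "N * (12 * N + 14) = 12 * (N * N) + 14 * N" by (simp add: algebra_simps)
    ultimately show ?thesis by linarith
  qed
  also have "\<dots> \<le> 58 * (((c + 3) * n ^ k) * ((c + 3) * n ^ k))"
  proof -
    have "1 \<le> n" using assms(3) by (cases n) auto
    then have "n \<le> n ^ k" "1 \<le> n ^ k" using assms(2) by (simp_all add: self_le_power)
    moreover have "?s \<le> c * n ^ k" using assms(1) by (simp add: circ_def)
    ultimately have "N \<le> (c + 3) * n ^ k" by (simp add: N_def algebra_simps)
    then show ?thesis by (intro mult_left_mono mult_mono) auto
  qed
  also have "\<dots> = (58 * (c + 3) ^ 2) * n ^ (2 * k)"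
  proof -
    have "n ^ (2 * k) = n ^ k * n ^ k" by (simp add: mult_2 power_add)
    then show ?thesis by (simp add: power2_eq_square algebra_simps)
  qed
  also have "\<dots> \<le> n * n ^ (2 * k)" using assms(3) by (rule mult_right_mono) simp
  finally show ?thesis by simp
qed


section \<open>The hard function\<close>

lemma unary_symbol:
  assumes "pvd (\<lambda>\<rho>. F (\<rho> 0))"
  shows "\<exists>f. is_pv_fun f \<and> arity f = 1 \<and> (\<forall>x. fval f [x] = F x)"
proof -
  from assms obtain t where t: "is_pv_term t" "\<And>\<rho>. F (\<rho> 0) = tval t \<rho>" unfolding pvd_def by auto
  define u where "u = tm_subst (\<lambda>i. Var 0) t"
  obtain n where "tm_below n t" using ex_tm_below by blast
  then have "tm_below 1 u" unfolding u_def by (rule tm_below_subst) simp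
  moreover have "is_pv_term u" unfolding u_def using t(1) by (simp add: is_pv_term_subst)
  moreover have "fval (Lam 1 u) [x] = F x" for x
    using t(2)[of "\<lambda>_. x"] by (simp add: u_def tval_subst)
  ultimately show ?thesis by (intro exI[of _ "Lam 1 u"]) auto
qed

text \<open>
  An input \<open>x\<close> is read as the sequence of a circuit \<open>D\<close>, a string \<open>v\<close> and a string \<open>w\<close>.  The values
  of \<open>D\<close> on the inputs \<open>(v, b)\<close>, padded to the length of \<open>w\<close>, are the digits of the code of a
  sequence, the element 0 of which is the circuit that is to be refuted at \<open>x\<close>.
\<close>

definition decode :: "nat \<Rightarrow> str \<Rightarrow> str" where
  "decode k x = el (rev (map (\<lambda>b. fval circuit_val_fun
     [el x 0, pad (length (el x 2)) (code [el x 1, num b])] = [True]) [0..<length x ^ (2 * k + 2)])) 0"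

definition hard :: "nat \<Rightarrow> str \<Rightarrow> str" where
  "hard k x = bv (fval circuit_val_fun [decode k x, x] \<noteq> [True])"

lemma pvn_length_power: "pvd A \<Longrightarrow> pvn (\<lambda>\<rho>. length (A \<rho>) ^ j)"
  using pvn_length[OF pvd_replicate_power[of A j]] by simp

lemma pvd_hard: "pvd (\<lambda>\<rho>. hard k (\<rho> 0))"
  unfolding hard_def decode_def pvp_def[symmetric]
  by (intro pvp_not pvp_eq pvd_App2[of circuit_val_fun] pvd_el pvd_digits pvd_pad pvd_intros
      pvn_length_power lenb_intros) auto


section \<open>Compression of the counterexamples\<close>

text \<open>From \<open>m \<le> j * 2 ^ Suc (m div j)\<close> by raising to the power
  \<open>j\<close>.\<close>

lemma power_le_exp: "(m::nat) ^ j \<le> (2 * j) ^ j * 2 ^ m"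
proof (cases "j = 0")
  case False
  have "m \<le> j * Suc (m div j)"
    using False by (metis div_mult_mod_eq add.commute add_le_mono le_refl less_imp_le_nat
        mod_less_divisor mult.commute mult_Suc_right neq0_conv)
  also have "\<dots> \<le> j * 2 ^ Suc (m div j)"
    by (intro mult_left_mono) (simp_all add: less_imp_le_nat less_exp del: power_Suc)
  finally have "m ^ j \<le> (j * 2 ^ Suc (m div j)) ^ j" by (rule power_mono) simp
  also have "\<dots> = (2 * j) ^ j * 2 ^ (m div j * j)"
    by (simp add: power_mult_distrib power_mult)
  also have "\<dots> \<le> (2 * j) ^ j * 2 ^ m" by (intro mult_left_mono power_increasing) auto
  finally show ?thesis .
qed simp

lemma pb_less_exp:
  assumes "pb p"
  shows "\<exists>M. \<forall>m\<ge>M. p m \<le> 2 ^ m"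
proof -
  from assms obtain K where p: "\<And>n. p n \<le> (K + n) ^ K" unfolding pb_def by blast
  let ?C = "(2 * Suc (2 * K)) ^ Suc (2 * K)"
  have "p m \<le> 2 ^ m" if "m \<ge> ?C + K + 2" for m
  proof -
    from that have "K \<le> m" "2 \<le> m" by linarith+
    then have "K + m \<le> m * m" using mult_le_mono1[of 2 m m] by linarith
    then have "p m \<le> (m * m) ^ K" using p[of m] power_mono[of "K + m" "m * m" K] by simp
    moreover have "(m * m) ^ K = m ^ (2 * K)" by (simp add: power_mult power2_eq_square)
    moreover have "?C * m ^ (2 * K) \<le> ?C * 2 ^ m"
    proof -
      have "?C * m ^ (2 * K) \<le> m * m ^ (2 * K)" using that by (intro mult_right_mono) auto
      also have "\<dots> = m ^ Suc (2 * K)" by simp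
      also have "\<dots> \<le> ?C * 2 ^ m" by (rule power_le_exp)
      finally show ?thesis .
    qed
    ultimately show ?thesis by simp
  qed
  then show ?thesis by blast
qed

lemma length_num_le: "l < 2 ^ m \<Longrightarrow> length (num l) \<le> m"
proof -
  assume "l < 2 ^ m"
  moreover have "2 ^ length (num l) \<le> Suc l" using power_length_le_val[of "num l"] by simp
  ultimately have "(2::nat) ^ length (num l) \<le> 2 ^ m" by linarith
  then show ?thesis by (rule power_le_imp_le_exp[rotated]) simp
qed

text \<open>A string that is no circuit of the required size is refuted by any answer, so the
  teacher never has to recognise circuits.\<close>

definition refutes :: "nat \<Rightarrow> nat \<Rightarrow> str \<Rightarrow> str \<Rightarrow> str \<Rightarrow> bool" where
  "refutes k c N C a \<longleftrightarrow> (circ k c (length N) C \<longrightarrow>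
     length a = length N \<and> (hard k a = [True] \<longleftrightarrow> fval circuit_val_fun [C, a] \<noteq> [True]))"

text \<open>Positions beyond the end of \<open>T\<close> contribute digits 2 on the right, which
  cannot alter an element that \<open>T\<close> has already ended.\<close>

lemma rev_map_digits:
  "length T \<le> L \<Longrightarrow> rev (map (\<lambda>b. b < length T \<and> rev T ! b) [0..<L]) = replicate (L - length T) False @ T"
proof -
  assume L: "length T \<le> L"
  have "map (\<lambda>b. b < length T \<and> rev T ! b) [0..<L] = rev T @ replicate (L - length T) False"
    using L by (auto simp: list_eq_iff_nth_eq nth_append)
  then show ?thesis by simp
qed

locale small_circuits =
  fixes k :: nat
  assumes k: "k \<ge> 1"
    and small: "is_pv_fun g \<Longrightarrow> arity g = 1 \<Longrightarrow> \<exists>c. \<forall>n. \<exists>D. circ k c n D \<and>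
      (\<forall>x. length x = n \<longrightarrow> (fval g [x] = [True] \<longleftrightarrow> fval circuit_val_fun [D, x] = [True]))"
begin

text \<open>The growth of descriptions in a round. If the earlier answers are described by
  \<open>m ^ e\<close> digits, the digits of the queries are computed from inputs of length
  \<open>m ^ (e + 1)\<close>. Circuits on these have codes of length
  \<open>(m ^ (e + 1)) ^ (2 * k + 1)\<close> by \<open>length_norm\<close>, and one more factor
  \<open>m\<close> pays for packing.\<close>

fun exponent :: "nat \<Rightarrow> nat \<Rightarrow> nat" where
  "exponent 0 e = e"
| "exponent (Suc d) e = exponent d ((e + 1) * (2 * k + 1) + 1)"

lemma exponent_ge: "e \<le> exponent d e"
proof (induction d arbitrary: e)
  case (Suc d)
  have "e \<le> (e + 1) * (2 * k + 1) + 1" by simp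
  with Suc show ?case by (metis exponent.simps(2) order_trans)
qed simp

text \<open>
  Since the query is determined by \<open>(1\<^sup>m, v, l)\<close>, its digits are computed by a circuit \<open>D\<close> whose
  size is a fixed power of \<open>m\<close>.  Thus \<open>(D, v, l)\<close> is a short description of a counterexample, and
  the whole sequence of counterexamples is described by \<open>(v, D)\<close>.
\<close>

lemma short_survive:
  fixes c K :: nat
  assumes "rounds R" "exponent (length R) e < K" "e \<ge> 1"
    and "\<And>i. pvd (\<lambda>\<rho>. \<tau> (\<rho> 0) (\<rho> 1) i)" "\<And>w v. \<tau> w v 0 = replicate (length w ^ K) True"
  shows "\<exists>M. \<forall>m\<ge>M. \<forall>v. length v \<le> m ^ e \<longrightarrow>
    game.survive (refutes k c) s (\<tau> (replicate m True) v) (\<lambda>_ _. True) R"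
  using assms
proof (induction R arbitrary: e \<tau> s)
  case Nil
  show ?case by (simp add: game.survive.simps)
next
  case (Cons r R)
  obtain Q B where r: "r = (Q, B)" by (cases r)
  from Cons.prems(1) have Q: "pvd Q" and B: "pvd B" and R: "rounds R" by (auto simp: r rounds_def)
  note e = Cons.prems(3) and \<tau> = Cons.prems(4) and \<tau>0 = Cons.prems(5)
  define p where "p = (e + 1) * (2 * k + 1)"
  have K: "exponent (length R) (p + 1) < K" using Cons.prems(2) by (simp add: p_def)
  then have pK: "p + 1 < K" using exponent_ge[of "p + 1" "length R"] by linarith
  have ep: "e + 1 \<le> p" by (simp add: p_def)
  have \<tau>': "pvd (\<lambda>\<rho>. \<tau> (W \<rho>) (V \<rho>) i)" if "pvd W" "pvd V" for W V i
    using pvd_subst[OF \<tau>[of i], of "\<lambda>\<rho>. case_nat (W \<rho>) (\<lambda>_. V \<rho>)"] that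
    by (simp add: pvd_case_nat)

  \<comment> \<open>The one-element sequence protects the circuit from the digits that
    \<open>decode\<close> reads past its end, and \<open>norm\<close> makes it short.\<close>
  define target where
    "target d = code [norm (Q ((\<tau> (el d 0) (el d 1))(Suc s := el d 2)))]" for d
  \<comment> \<open>The argument is a pair of a query description \<open>d\<close> and a digit
    position. \<open>G\<close> is one PV function for all \<open>m\<close>, so its circuits share
    the factor \<open>cg\<close>.\<close>
  define G where "G z = bv (val (el z 1) < length (target (el z 0)) \<and>
    rev (target (el z 0)) ! val (el z 1))" for z
  have "pvd (\<lambda>\<rho>. G (\<rho> 0))"
    unfolding G_def pvp_def[symmetric] target_def
    by (intro pvp_digit pvd_code pvd_norm pvd_subst[OF Q] game.pvd_upd \<tau>' pvd_intros)
  then obtain g where g: "is_pv_fun g" "arity g = 1" "\<And>x. fval g [x] = G x"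
    using unary_symbol by blast
  obtain cg where cg: "\<And>n. \<exists>D. circ k cg n D \<and>
      (\<forall>x. length x = n \<longrightarrow> (G x = [True] \<longleftrightarrow> fval circuit_val_fun [D, x] = [True]))"
    using small[OF g(1,2)] unfolding g(3) by blast

  \<comment> \<open>The answer holds a circuit, the query description and a string of ones whose
    length tells \<open>decode\<close> the input length of the circuit. Padding brings it to the
    length of the first constant.\<close>
  define X where "X w v' l = pad (length w ^ K)
    (code [el v' 1, code [w, el v' 0, num l], replicate (length w ^ (e + 1)) True])" for w v' l
  define \<sigma> where "\<sigma> w v' = (\<tau> w (el v' 0))(Suc s :=
    code (map (X w v') [0..<Suc (length (B (\<tau> w (el v' 0))))]))" for w v'
  have \<sigma>: "pvd (\<lambda>\<rho>. \<sigma> (\<rho> 0) (\<rho> 1) i)" for i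
  proof -
    have B\<tau>: "pvd (\<lambda>\<rho>. B (\<tau> (\<rho> 0) (el (\<rho> 1) 0)))"
      by (intro pvd_subst[OF B] \<tau>' pvd_intros)
    have "pvd (\<lambda>\<rho>. pad (length (replicate (length (\<rho> 1) ^ K) True)) (code [el (\<rho> 2) 1,
        code [\<rho> 1, el (\<rho> 2) 0, num (val (\<rho> 0))], replicate (length (\<rho> 1) ^ (e + 1)) True]))"
      by (intro pvd_pad pvd_replicate_power pvd_intros)
    then have "pvd (\<lambda>\<rho>. code (map (X (\<rho> 0) (\<rho> 1)) [0..<Suc (length (B (\<tau> (\<rho> 0) (el (\<rho> 1) 0))))]))"
      by (intro pvd_code_map pvn_Suc pvn_length lenb_Suc lenb_length B\<tau>) (simp add: X_def numeral_2_eq_2)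
    then show ?thesis unfolding \<sigma>_def by (intro game.pvd_upd \<tau>' pvd_intros)
  qed
  \<comment> \<open>\<open>M\<close> has to be uniform in \<open>v\<close>, because the new
    description contains a circuit that depends on \<open>m\<close>.\<close>
  have "\<exists>M. \<forall>m\<ge>M. \<forall>v. length v \<le> m ^ (p + 1) \<longrightarrow>
      game.survive (refutes k c) (Suc s) (\<sigma> (replicate m True) v) (\<lambda>_ _. True) R"
    by (rule Cons.IH[OF R K _ \<sigma>]) (simp_all add: \<sigma>_def \<tau>0)
  then obtain M1 where M1: "\<And>m v. m \<ge> M1 \<Longrightarrow> length v \<le> m ^ (p + 1) \<Longrightarrow>
      game.survive (refutes k c) (Suc s) (\<sigma> (replicate m True) v) (\<lambda>_ _. True) R"
    by blast

  have "pvd (\<lambda>\<rho>. B (\<tau> (\<rho> 0) (\<rho> 1)))" by (intro pvd_subst[OF B] \<tau>' pvd_var)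
  from pvd_bounded[OF this] obtain n q where q: "mono q" "pb q"
    "\<And>\<rho> :: env. length (B (\<tau> (\<rho> 0) (\<rho> 1))) \<le> q (\<Sum>i<n. length (\<rho> i))" by blast
  have B_bound: "length (B (\<tau> w v)) \<le> q (length w + length v)" for w v
  proof -
    define \<rho> :: env where "\<rho> = case_nat w (case_nat v (\<lambda>_. []))"
    have "(\<Sum>i<n. length (\<rho> i)) \<le> (\<Sum>i<n + 2. length (\<rho> i))" by (rule sum_mono2) auto
    also have "\<dots> = length w + length v"
      by (simp add: \<rho>_def sum.lessThan_Suc_shift numeral_2_eq_2 del: sum.lessThan_Suc)
    finally have "q (\<Sum>i<n. length (\<rho> i)) \<le> q (length w + length v)" by (rule monoD[OF q(1)])
    with q(3)[of \<rho>] have "length (B (\<tau> (\<rho> 0) (\<rho> 1))) \<le> q (length w + length v)" by (rule order_trans)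
    then show ?thesis by (simp add: \<rho>_def)
  qed
  \<comment> \<open>Polynomially many queries and digit positions are eventually at most
    \<open>2 ^ m\<close>, so the numerals of their indices have at most \<open>m\<close>
    digits.\<close>
  have "pb (\<lambda>m. q (m + m ^ e) + 1)"
    by (rule pb_add[OF pb_comp[OF q(2) pb_add[OF pb_id pb_power[OF pb_id]]] pb_const])
  from pb_less_exp[OF this] obtain M2 where M2: "\<And>m. m \<ge> M2 \<Longrightarrow> q (m + m ^ e) + 1 \<le> 2 ^ m" by blast
  from pb_less_exp[OF pb_power[OF pb_id]] obtain M3
    where M3: "\<And>m. m \<ge> M3 \<Longrightarrow> m ^ (K * (2 * k + 2)) \<le> 2 ^ m" by blast

  have "game.survive (refutes k c) s (\<tau> (replicate m True) v) (\<lambda>_ _. True) (r # R)"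
    if m: "m \<ge> M1 + M2 + M3 + 58 * (cg + 3) ^ 2 + 58 * (c + 3) ^ 2" and v: "length v \<le> m ^ e" for m v
  proof -
    \<comment> \<open>From here on one factor \<open>m \<ge> 58\<close> absorbs the
      constants.\<close>
    have "58 * 3 ^ 2 \<le> 58 * (c + 3) ^ 2" by (intro mult_left_mono power_mono) auto
    with m have m58: "58 \<le> m" by simp
    have mpow: "m \<le> m ^ j" if "j \<ge> 1" for j
      using power_increasing[OF that, of m] m58 by simp
    define w where "w = replicate m True"
    define n where "n = m ^ (e + 1)"
    obtain D0 where D0: "circ k cg n D0"
      "\<And>x. length x = n \<Longrightarrow> (G x = [True] \<longleftrightarrow> fval circuit_val_fun [D0, x] = [True])"
      using cg by blast
    define D where "D = norm D0"
    have "m \<le> n" unfolding n_def by (rule mpow) simp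
    with m have "58 * (cg + 3) ^ 2 \<le> n" by linarith
    then have "length D \<le> n ^ (2 * k + 1)" unfolding D_def by (rule length_norm[OF D0(1) k])
    also have "\<dots> = m ^ p" unfolding n_def p_def by (rule power_mult[symmetric])
    finally have D_len: "length D \<le> m ^ p" .
    define v' where "v' = code [v, D]"
    have pw: "m ^ i \<le> m ^ j" if "i \<le> j" for i j
      using m58 by (intro power_increasing[OF that]) simp
    have mp: "m ^ e \<le> m ^ p" "n \<le> m ^ p" "m \<le> m ^ p"
      using pw[of e p] pw[OF ep] mpow[of p] ep by (simp_all only: n_def)
    have "length v' \<le> m ^ (p + 1)"
    proof -
      have "length v' \<le> 2 * m ^ p + 2 * m ^ p + 4" using v D_len mp by (simp add: v'_def length_code)
      also have "\<dots> \<le> 58 * m ^ p" using mp(3) m58 by simp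
      also have "\<dots> \<le> m * m ^ p" using m58 by (rule mult_right_mono) simp
      finally show ?thesis by simp
    qed
    then have surv: "game.survive (refutes k c) (Suc s) (\<sigma> w v') (\<lambda>_ _. True) R"
      unfolding w_def using m by (intro M1) auto
    have \<sigma>_eq: "\<sigma> w v' = (\<tau> w v)(Suc s := code (map (X w v') [0..<Suc (length (B (\<tau> w v)))]))"
      by (simp add: \<sigma>_def v'_def)
    have "refutes k c (\<tau> w v 0) (Q ((\<tau> w v)(Suc s := num l))) (X w v' l)"
      if l: "l \<le> length (B (\<tau> w v))" for l
    proof -
      define C where "C = Q ((\<tau> w v)(Suc s := num l))"
      define d where "d = code [w, v, num l]"
      have len_w: "length w = m" by (simp add: w_def)
      have "length (num l) \<le> m"
      proof (rule length_num_le)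
        have "l \<le> q (m + m ^ e)"
          using l B_bound[of w v] monoD[OF q(1), of "length w + length v" "m + m ^ e"] v len_w by simp
        then show "l < 2 ^ m" using M2[of m] m by simp
      qed
      then have d_len: "length d \<le> 4 * m + 2 * m ^ e + 6"
        using v by (simp add: d_def length_code len_w)
      have X_eq: "X w v' l = pad (m ^ K) (code [D, d, replicate n True])"
        by (simp add: X_def v'_def d_def len_w n_def)
      have "length (code [D, d, replicate n True]) = 2 * length D + 2 * length d + 2 * n + 6"
        by (simp add: length_code)
      then have "length (code [D, d, replicate n True]) \<le> 58 * m ^ p"
        using D_len d_len mp m58 by linarith
      also have "\<dots> \<le> m * m ^ p" using m58 by (rule mult_right_mono) simp
      also have "\<dots> = m ^ (p + 1)" by simp
      also have "\<dots> \<le> m ^ K" using pK m58 by (intro power_increasing) auto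
      finally have X_len: "length (X w v' l) = m ^ K" by (simp add: X_eq)
      have X_el: "el (X w v' l) 0 = D" "el (X w v' l) 1 = d" "el (X w v' l) 2 = replicate n True"
        by (simp_all add: X_eq)
      have target: "target d = code [norm C]" by (simp add: target_def d_def C_def)
      \<comment> \<open>\<open>D\<close> is correct on inputs of length exactly \<open>n\<close>.
        The pair of \<open>d\<close> and \<open>b\<close> fits into \<open>n\<close> digits and is
        padded, which \<open>G\<close> does not notice because the elements stay the same.\<close>
      have digit: "fval circuit_val_fun [D, pad n (code [d, num b])] = [True] \<longleftrightarrow>
          b < length (code [norm C]) \<and> rev (code [norm C]) ! b" if b: "b < (m ^ K) ^ (2 * k + 2)" for b
      proof -
        have "b < m ^ (K * (2 * k + 2))" using b by (simp only: power_mult)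
        also have "\<dots> \<le> 2 ^ m" by (rule M3) (use m in simp)
        finally have "length (num b) \<le> m" by (rule length_num_le)
        moreover have "length (code [d, num b]) = 2 * length d + 2 * length (num b) + 4"
          by (simp add: length_code)
        ultimately have "length (code [d, num b]) \<le> 58 * m ^ e"
          using d_len mpow[OF e] m58 by linarith
        also have "\<dots> \<le> m * m ^ e" using m58 by (rule mult_right_mono) simp
        finally have "length (pad n (code [d, num b])) = n" by (simp add: n_def)
        from D0(2)[OF this] show ?thesis
          unfolding D_def circuit_val_norm by (simp add: G_def target)
      qed
      show ?thesis
        unfolding refutes_def C_def[symmetric]
      proof (intro impI conjI)
        assume "circ k c (length (\<tau> w v 0)) C"
        then have C: "circ k c (m ^ K) C" by (simp add: \<tau>0 len_w)
        show "length (X w v' l) = length (\<tau> w v 0)" by (simp add: \<tau>0 len_w X_len)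
        have mK: "m \<le> m ^ K" using pK by (intro mpow) simp
        have "length (norm C) \<le> (m ^ K) ^ (2 * k + 1)"
          by (rule length_norm[OF C k]) (use m mK in simp)
        moreover have "1 \<le> (m ^ K) ^ (2 * k + 1)" using m58 by simp
        moreover have "length (code [norm C]) = 2 * length (norm C) + 2" by (simp add: length_code)
        ultimately have "length (code [norm C]) \<le> 58 * (m ^ K) ^ (2 * k + 1)" by linarith
        also have "\<dots> \<le> m ^ K * (m ^ K) ^ (2 * k + 1)" using m58 mK by (intro mult_right_mono) auto
        also have "\<dots> = (m ^ K) ^ (2 * k + 2)" by simp
        finally have "length (code [norm C]) \<le> (m ^ K) ^ (2 * k + 2)" .
        note rev_map_digits[OF this, symmetric]
        also have "map (\<lambda>b. b < length (code [norm C]) \<and> rev (code [norm C]) ! b) [0..<(m ^ K) ^ (2 * k + 2)] =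
            map (\<lambda>b. fval circuit_val_fun [D, pad n (code [d, num b])] = [True]) [0..<(m ^ K) ^ (2 * k + 2)]"
          by (rule map_cong) (use digit in auto)
        finally have digits: "rev (map (\<lambda>b. fval circuit_val_fun [D, pad n (code [d, num b])] = [True])
            [0..<(m ^ K) ^ (2 * k + 2)]) =
            replicate ((m ^ K) ^ (2 * k + 2) - length (code [norm C])) False @ code [norm C]" ..
        have "decode k (X w v' l) = el (replicate ((m ^ K) ^ (2 * k + 2) - length (code [norm C])) False @ code [norm C]) 0"
          unfolding decode_def X_el X_len length_replicate by (simp only: digits)
        also have "\<dots> = norm C" by (simp add: el_append)
        finally show "hard k (X w v' l) = [True] \<longleftrightarrow> fval circuit_val_fun [C, X w v' l] \<noteq> [True]"
          by (simp add: hard_def circuit_val_norm)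
      qed
    qed
    then have "game.answers (refutes k c) s (\<tau> w v) (\<lambda>_ _. True) r
        (code (map (X w v') [0..<Suc (length (B (\<tau> w v)))]))"
      unfolding game.answers_def r by (simp add: less_Suc_eq_le del: upt_Suc)
    with surv show ?thesis unfolding \<sigma>_eq w_def[symmetric] game.survive.simps by blast
  qed
  then show ?case by blast
qed

lemma start:
  assumes "rounds R"
  shows "\<exists>N. N = replicate (length N) True \<and>
    game.survive (refutes k c) 0 ((\<lambda>_. [])(0 := N)) (\<lambda>_ _. True) R"
proof -
  \<comment> \<open>Larger than the exponent reached at the end of the game, so that the answers of
    all rounds fit into \<open>m ^ K\<close> digits.\<close>
  define K where "K = Suc (exponent (length R) 1)"
  have pos: "pvd (\<lambda>\<rho>. ((\<lambda>_. [])(0 := replicate (length (\<rho> 0) ^ K) True)) i)" for i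
    by (intro game.pvd_upd pvd_replicate_power pvd_var pvd_const)
  have "\<exists>M. \<forall>m\<ge>M. \<forall>v. length v \<le> m ^ 1 \<longrightarrow> game.survive (refutes k c) 0
      (((\<lambda>w (v::str). (\<lambda>_. [])(0 := replicate (length w ^ K) True))) (replicate m True) v) (\<lambda>_ _. True) R"
    by (rule short_survive[where K = K, OF assms _ _ pos]) (simp_all add: K_def)
  then obtain m where "\<forall>v :: str. length v \<le> m ^ 1 \<longrightarrow> game.survive (refutes k c) 0
      ((\<lambda>_. [])(0 := replicate (length (replicate m True) ^ K) True)) (\<lambda>_ _. True) R" by blast
  from this[rule_format, of "[]"] have "game.survive (refutes k c) 0
      ((\<lambda>_. [])(0 := replicate (m ^ K) True)) (\<lambda>_ _. True) R" by simp
  then show ?thesis by (intro exI[of _ "replicate (m ^ K) True"]) simp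
qed

end


section \<open>The theorem\<close>

lemma length_bound_string:
  "length (tval (bound_string k c t) \<rho>) = c * length (tval t \<rho>) ^ k"
proof -
  have "length (tval (power_string k t) \<rho>) = length (tval t \<rho>) ^ k"
    by (induction k) (simp_all add: length_concat_map_const mult.commute)
  then show ?thesis by (induction c) simp_all
qed

lemma sat_UP:
  "sat U E x (UP k c f) \<longleftrightarrow> (\<forall>N\<in>E. (\<forall>\<^sub>F i in U. replicate (length (N i)) True = N i) \<longrightarrow>
    (\<exists>C\<in>E. (\<forall>\<^sub>F i in U. fval is_circuit_fun [C i, N i] = [True]) \<and>
      (\<forall>\<^sub>F i in U. cnt (el (C i) 0) \<le> c * length (N i) ^ k) \<and>
      (\<forall>a\<in>E. (\<forall>\<^sub>F i in U. length (a i) = length (N i)) \<longrightarrow>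
        ((\<forall>\<^sub>F i in U. fval f [a i] = [True]) \<longleftrightarrow>
         (\<forall>\<^sub>F i in U. fval circuit_val_fun [C i, a i] = [True])))))"
  by (simp add: UP_def length_bound_string numeral_2_eq_2 iff_conv_conj_imp)

text \<open>The principal ultrafilter at 0 looks at a single coordinate, where \<open>sat\<close> is
  truth for strings; collection is choice for finitely many indices.\<close>

lemma standard_model: "bb_model (principal {0}) UNIV"
proof
  fix P B and x :: "nat \<Rightarrow> nat \<Rightarrow> str"
  assume hyp: "\<And>j. j \<in> UNIV \<Longrightarrow> \<forall>\<^sub>F i in principal {0}. val (j i) \<le> length (B (\<lambda>v. x v i)) \<Longrightarrow>
    \<exists>z\<in>UNIV. \<forall>\<^sub>F i in principal {0}. P (case_nat (z i) (case_nat (j i) (\<lambda>v. x v i)))"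
  let ?B = "B (\<lambda>v. x v 0)"
  have "\<exists>z. P (case_nat z (case_nat (num j) (\<lambda>v. x v 0)))" if "j \<le> length ?B" for j
    using hyp[of "\<lambda>_. num j"] that by (auto simp: eventually_principal)
  then obtain z where z: "\<And>j. j \<le> length ?B \<Longrightarrow> P (case_nat (z j) (case_nat (num j) (\<lambda>v. x v 0)))"
    by metis
  show "\<exists>w\<in>UNIV. \<forall>\<^sub>F i in principal {0}. \<forall>j\<le>length (B (\<lambda>v. x v i)).
    P (case_nat (el (w i) j) (case_nat (num j) (\<lambda>v. x v i)))"
    using z by (intro bexI[of _ "\<lambda>_. code (map z [0..<Suc (length ?B)])"])
      (auto simp: eventually_principal less_Suc_eq_le simp del: upt_Suc)
qed (auto simp: eventually_principal)

text \<open>Truth in the standard model gives actual circuits for every \<open>n\<close> with the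
  same \<open>c\<close>; this is the source of the circuits used by the teacher.\<close>

lemma UP_sound:
  assumes "PV1 \<union> BB_Sigma_b_1 \<turnstile> UP k c f"
  shows "\<exists>C. circ k c n C \<and>
    (\<forall>x. length x = n \<longrightarrow> (fval f [x] = [True] \<longleftrightarrow> fval circuit_val_fun [C, x] = [True]))"
proof -
  interpret bb_model "principal {0}" UNIV by (rule standard_model)
  have UP: "sats (\<lambda>_ _. []) (UP k c f)" by (rule sat_provable[OF assms]) simp
  have "\<exists>C :: nat \<Rightarrow> str. circ k c n (C 0) \<and> (\<forall>a :: nat \<Rightarrow> str. length (a 0) = n \<longrightarrow>
      (fval f [a 0] = [True] \<longleftrightarrow> fval circuit_val_fun [C 0, a 0] = [True]))"
    using bspec[OF UP[unfolded sat_UP], of "\<lambda>_. replicate n True"]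
    unfolding eventually_principal circ_def by simp
  then obtain C :: "nat \<Rightarrow> str" where C: "circ k c n (C 0)" "\<And>a :: nat \<Rightarrow> str. length (a 0) = n \<Longrightarrow>
      fval f [a 0] = [True] \<longleftrightarrow> fval circuit_val_fun [C 0, a 0] = [True]" by blast
  show ?thesis
    using C(1) C(2)[of "\<lambda>_. x" for x] by blast
qed

theorem theorem6p7:
  fixes k :: nat
  assumes "k \<ge> 1"
  shows "\<exists>h. is_pv_fun h \<and> arity h = 1 \<and>
    (\<forall>c::nat. c \<ge> 1 \<longrightarrow> \<not> (PV1 \<union> BB_Sigma_b_1 \<turnstile> UP k c h))"
proof (rule ccontr)
  assume "\<not> ?thesis"
  then have contra: "\<exists>c. PV1 \<union> BB_Sigma_b_1 \<turnstile> UP k c h" if "is_pv_fun h" "arity h = 1" for h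
    using that by blast
  interpret small_circuits k
  proof
    fix g assume "is_pv_fun g" "arity g = 1"
    from contra[OF this] obtain c where "PV1 \<union> BB_Sigma_b_1 \<turnstile> UP k c g" ..
    from UP_sound[OF this] show "\<exists>c. \<forall>n. \<exists>D. circ k c n D \<and>
      (\<forall>x. length x = n \<longrightarrow> (fval g [x] = [True] \<longleftrightarrow> fval circuit_val_fun [D, x] = [True]))" by blast
  qed (rule assms)
  obtain h where h: "is_pv_fun h" "arity h = 1" "\<And>x. fval h [x] = hard k x"
    using unary_symbol[OF pvd_hard] by blast
  \<comment> \<open>The constant comes after \<open>h\<close>, and the model is built for this
    \<open>c\<close>.\<close>
  obtain c where c: "PV1 \<union> BB_Sigma_b_1 \<turnstile> UP k c h" using contra[OF h(1,2)] by blast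
  obtain U E N where M: "bb_model U E" "N \<in> E" "\<And>i. N i = replicate (length (N i)) True"
    and refuting: "\<And>C. C \<in> E \<Longrightarrow> \<exists>a\<in>E. \<forall>\<^sub>F i in U. refutes k c (N i) (C i) (a i)"
    using game.ex_bb_model[of "\<lambda>N. N = replicate (length N) True" "refutes k c", OF start] by blast
  interpret bb_model U E by (rule M)
  have "sats (\<lambda>_. N) (UP k c h)" by (rule sat_provable[OF c]) (rule M)
  moreover have "\<forall>\<^sub>F i in U. replicate (length (N i)) True = N i"
    using M(3) by (intro always_eventually) metis
  ultimately obtain C where C: "C \<in> E" "\<forall>\<^sub>F i in U. fval is_circuit_fun [C i, N i] = [True]"
    "\<forall>\<^sub>F i in U. cnt (el (C i) 0) \<le> c * length (N i) ^ k"
    "\<And>a. a \<in> E \<Longrightarrow> \<forall>\<^sub>F i in U. length (a i) = length (N i) \<Longrightarrow>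
      (\<forall>\<^sub>F i in U. fval h [a i] = [True]) \<longleftrightarrow> (\<forall>\<^sub>F i in U. fval circuit_val_fun [C i, a i] = [True])"
    using M(2) unfolding sat_UP by blast
  obtain a where a: "a \<in> E" "\<forall>\<^sub>F i in U. refutes k c (N i) (C i) (a i)"
    using refuting[OF C(1)] by blast
  have "\<forall>\<^sub>F i in U. length (a i) = length (N i) \<and>
      (hard k (a i) = [True] \<longleftrightarrow> fval circuit_val_fun [C i, a i] \<noteq> [True])"
    using a(2) C(2,3)
  proof eventually_elim
    case (elim i)
    from elim(2) have "fval is_circuit_fun [C i, replicate (length (N i)) True] = [True]"
      by (subst M(3)[symmetric])
    with elim show ?case by (simp add: refutes_def circ_def)
  qed
  then have len: "\<forall>\<^sub>F i in U. length (a i) = length (N i)"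
    and diff: "\<forall>\<^sub>F i in U. hard k (a i) = [True] \<longleftrightarrow> fval circuit_val_fun [C i, a i] \<noteq> [True]"
    by (auto elim: eventually_mono)
  from diff have "(\<forall>\<^sub>F i in U. hard k (a i) = [True]) \<longleftrightarrow>
      (\<forall>\<^sub>F i in U. fval circuit_val_fun [C i, a i] \<noteq> [True])"
    by (rule eventually_subst)
  \<comment> \<open>\<open>UP\<close> equates two statements about almost all coordinates. By the
    ultrafilter property they have opposite truth values, since \<open>hard\<close> negates the
    circuit value almost everywhere.\<close>
  with C(4)[OF a(1) len] ultra[of "\<lambda>i. fval circuit_val_fun [C i, a i] = [True]"] show False
    by (simp add: h(3))
qed

end
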